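(* The product $\mathcal U_{38}=\mathcal R_{30}\mathcal H_8$ is a nonnegative polynomial on $\mathscr C\times\mathfrak g_2$, homogeneous of degree $38$ in $Z$. For all $T\in\mathscr C$ and $Z\in\mathfrak g_2$, $$\operatorname{Lie}\{Z,TZT\}=\mathfrak g_2\quad\Longleftrightarrow\quad \mathcal U_{38}(T,Z)>0 .$$ In particular, for every quaternionic context $H$ and every $T\in\mathscr C$, $$\{Z\in\mathfrak k_H:\operatorname{Lie}\{Z,TZT\}\neq\mathfrak g_2\}=\{Z\in\mathfrak k_H:\mathcal U_{38}(T,Z)=0\}.$$ For every $(T,Z)\in\mathscr C\times\mathfrak g_2$ exactly one of the following three outcomes occurs: (i) $\mathcal R_{30}(T,Z)=0$, and the algebra $\operatorname{Lie}\{Z,TZT\}$ acts reducibly on $V$ and is a proper subalgebra of $\mathfrak g_2$; (ii) $\mathcal R_{30}(T,Z)>0$ and $\mathcal H_8(T,Z)=0$, and $\operatorname{Lie}\{Z,TZT\}$ is a principal $\mathfrak{su}(2)$; (iii) $\mathcal R_{30}(T,Z)>0$ and $\mathcal H_8(T,Z)>0$, and $\operatorname{Lie}\{Z,TZT\}=\mathfrak g_2$. The criterion is invariant under simultaneous conjugation $(T,Z)\mapsto(gTg^{-1},gZg^{-1})$ with $g\in G_2$.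
   Context: Octonions: $\mathbb O$ is the real octonion division algebra with its standard Euclidean inner product, $V=\operatorname{Im}\mathbb O\cong\mathbb R^7$. $G_2=\operatorname{Aut}(\mathbb O)$ and $\mathfrak g_2=\operatorname{Der}(\mathbb O)$ (dimension $14$) are identified with their faithful actions on $V$, so $G_2\subset SO(V)$, $\mathfrak g_2\subset\mathfrak{so}(V)$; products such as $TZT$ are compositions of linear maps and $[A,B]=AB-BA$. $\operatorname{Lie}\{U,W\}$ is the smallest real Lie subalgebra containing $U$ and $W$. A quaternionic context is a unital subalgebra $H\subset\mathbb O$ isomorphic to the quaternions; $\mathfrak k_H=\{Z\in\mathfrak g_2:Z(H)\subseteq H\}$. The quaternionic reflection is $\sigma_H(h+y)=h-y$ for $h\in H$, $y\in H^\perp$; it lies in $G_2$. Set $\mathscr C=\{\sigma_H: H\text{ a quaternionic context}\}=\{T\in G_2:T^2=I,\ \operatorname{tr}_VT=-1\}$. A principal $\mathfrak{su}(2)$ is a Lie subalgebra of $\mathfrak g_2$ isomorphic to $\mathfrak{su}(2)$ acting irreducibly on $V$. "Reducible" means having a nonzero proper invariant real subspace. Matrices carry the Frobenius inner product $\langle U,W\rangle_F=\operatorname{tr}(U^{\mathsf T}W)$. For $T\in\mathscr C$ let $\mathscr E_T=\{Q\in\operatorname{End}(V):Q^{\mathsf T}=Q,\ \operatorname{tr}Q=0,\ TQT=Q\}$, which has dimension $15$. For any Frobenius-orthonormal basis $Q_1,\dots,Q_{15}$ of $\mathscr E_T$ put $$\mathcal R_{30}(T,Z)=\det\bigl(\langle[Z,Q_i],[Z,Q_j]\rangle_F\bigr)_{i,j=1}^{15}$$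 (independent of the choice of basis). Put $A_\pm=\tfrac12(Z\pm TZT)$, $C=[A_+,A_-]$, $C_+=[A_+,C]$, $C_-=[A_-,C]$ and $$\mathcal H_8(T,Z)=\|A_-\|_F^2\|C_+\|_F^2+\|A_+\|_F^2\|C_-\|_F^2-2\|C\|_F^4 .$$ A polynomial on $\mathscr C\times\mathfrak g_2$ means the restriction of a real polynomial in the matrix entries of $(T,Z)$. *)

theory Defs
  imports "HOL-Analysis.Analysis"
begin

section \<open>Quaternions and octonions\<close>

text \<open>Both algebras are written as scalar part times imaginary part, with the product
  \<open>(a, u) (b, v) = (a b - u \<bullet> v, a v + b u + u \<times> v)\<close>
  for the cross product of \<open>\<real>\<^sup>3\<close>, respectively \<open>\<real>\<^sup>7\<close>.  The library inner product
  on the product type is the standard Euclidean inner product.\<close>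

type_synonym quat = "real \<times> (real^3)"
type_synonym octo = "real \<times> (real^7)"

definition qmult :: "quat \<Rightarrow> quat \<Rightarrow> quat" where
  "qmult x y = (fst x * fst y - snd x \<bullet> snd y,
                fst x *\<^sub>R snd y + fst y *\<^sub>R snd x + cross3 (snd x) (snd y))"

text \<open>The index type \<open>7\<close> is the ring of integers modulo 7, and the multiplication table of the
  imaginary units is \<open>e\<^sub>i e\<^bsub>i+1\<^esub> = e\<^bsub>i+3\<^esub>\<close> with its cyclic rotations
  \<open>e\<^bsub>i+1\<^esub> e\<^bsub>i+3\<^esub> = e\<^sub>i\<close> and \<open>e\<^bsub>i+3\<^esub> e\<^sub>i = e\<^bsub>i+1\<^esub>\<close>.  The three
  differences below come from the three lines of the Fano plane through the point \<open>k\<close>.\<close>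

definition cross7 :: "real^7 \<Rightarrow> real^7 \<Rightarrow> real^7" where
  "cross7 u v = (\<chi> k. (u $ (k+1) * v $ (k+3) - u $ (k+3) * v $ (k+1))
                    + (u $ (k+2) * v $ (k+6) - u $ (k+6) * v $ (k+2))
                    + (u $ (k+4) * v $ (k+5) - u $ (k+5) * v $ (k+4)))"

definition omult :: "octo \<Rightarrow> octo \<Rightarrow> octo" where
  "omult x y = (fst x * fst y - snd x \<bullet> snd y,
                fst x *\<^sub>R snd y + fst y *\<^sub>R snd x + cross7 (snd x) (snd y))"

definition oone :: octo where
  "oone = (1, 0)"

lemma omult_oone [simp]: "omult oone x = x" "omult x oone = x"
  by (auto simp: omult_def oone_def cross7_def vec_eq_iff prod_eq_iff)

lemma UNIV_7: "(UNIV :: 7 set) = {0, 1, 2, 3, 4, 5, 6}"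
proof -
  have "card {0, 1, 2, 3, 4, 5, 6 :: 7} = CARD(7)"
    by simp
  then show ?thesis
    by (metis card_subset_eq finite subset_UNIV)
qed

lemma sum_7: "sum f (UNIV :: 7 set) = f 0 + f 1 + f 2 + f 3 + f 4 + f 5 + f 6"
  unfolding UNIV_7 by (simp add: ac_simps)

lemma numerals_mod_7:
  "(7 :: 7) = 0" "(8 :: 7) = 1" "(9 :: 7) = 2" "(10 :: 7) = 3" "(11 :: 7) = 4" "(12 :: 7) = 5"
  by simp_all

text \<open>The octonion product is a composition algebra product, so the table above is one of
  the octonion division algebra.\<close>

lemma norm_omult: "norm (omult x y) = norm x * norm y"
proof -
  obtain a u b v where xy: "x = (a, u)" "y = (b, v)"
    by fastforce
  have "omult x y \<bullet> omult x y = (x \<bullet> x) * (y \<bullet> y)"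
    unfolding xy omult_def cross7_def inner_prod_def inner_vec_def sum_7
    by (simp only: fst_conv snd_conv inner_real_def vector_add_component vector_scaleR_component
        vec_lambda_beta real_scaleR_def add_0 arith_simps arith_special numerals_mod_7)
      algebra
  then show ?thesis
    by (simp add: norm_eq_sqrt_inner real_sqrt_mult)
qed

section \<open>The group and the Lie algebra of type G2\<close>

definition octo_automorphism :: "(octo \<Rightarrow> octo) \<Rightarrow> bool" where
  "octo_automorphism f \<longleftrightarrow>
     linear f \<and> bij f \<and> (\<forall>x y. f (omult x y) = omult (f x) (f y))"

definition octo_derivation :: "(octo \<Rightarrow> octo) \<Rightarrow> bool" where
  "octo_derivation d \<longleftrightarrow>
     linear d \<and> (\<forall>x y. d (omult x y) = omult (d x) y + omult x (d y))"

text \<open>\<open>V = Im \<O>\<close> is \<open>real^7\<close>, and endomorphisms of \<open>V\<close> are matrices;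
  \<open>A\<close> represents the restriction of \<open>f\<close> to \<open>V\<close>.\<close>

definition acts_on_Im :: "(octo \<Rightarrow> octo) \<Rightarrow> real^7^7 \<Rightarrow> bool" where
  "acts_on_Im f A \<longleftrightarrow> (\<forall>v. f (0, v) = (0, A *v v))"

definition G2 :: "(real^7^7) set" where
  "G2 = {A. \<exists>f. octo_automorphism f \<and> acts_on_Im f A}"

definition g2 :: "(real^7^7) set" where
  "g2 = {A. \<exists>d. octo_derivation d \<and> acts_on_Im d A}"

section \<open>Quaternionic contexts and reflections\<close>

definition quaternionic_context :: "octo set \<Rightarrow> bool" where
  "quaternionic_context H \<longleftrightarrow>
     subspace H \<and> oone \<in> H \<and> (\<forall>x\<in>H. \<forall>y\<in>H. omult x y \<in> H) \<and>
     (\<exists>f :: quat \<Rightarrow> octo. linear f \<and> bij_betw f UNIV H \<and>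
        (\<forall>p q. f (qmult p q) = omult (f p) (f q)))"

definition k_alg :: "octo set \<Rightarrow> (real^7^7) set" where
  "k_alg H = {Z. \<exists>d. octo_derivation d \<and> acts_on_Im d Z \<and> d ` H \<subseteq> H}"

definition quat_reflection :: "octo set \<Rightarrow> octo \<Rightarrow> octo" where
  "quat_reflection H x =
     (THE z. \<exists>h\<in>H. \<exists>y\<in>orthogonal_comp H. x = h + y \<and> z = h - y)"

definition reflections :: "(real^7^7) set" where
  "reflections = {T. \<exists>H. quaternionic_context H \<and> acts_on_Im (quat_reflection H) T}"

section \<open>Matrix Lie algebras\<close>

definition lie_bracket :: "'a::ring_1^'n^'n \<Rightarrow> 'a^'n^'n \<Rightarrow> 'a^'n^'n" where
  "lie_bracket A B = A ** B - B ** A"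

definition lie_subalgebra :: "(real^7^7) set \<Rightarrow> bool" where
  "lie_subalgebra L \<longleftrightarrow> subspace L \<and> (\<forall>A\<in>L. \<forall>B\<in>L. lie_bracket A B \<in> L)"

definition Lie_gen :: "real^7^7 \<Rightarrow> real^7^7 \<Rightarrow> (real^7^7) set" where
  "Lie_gen U W = lie_subalgebra hull {U, W}"

definition acts_reducibly :: "(real^7^7) set \<Rightarrow> bool" where
  "acts_reducibly L \<longleftrightarrow>
     (\<exists>W :: (real^7) set. subspace W \<and> W \<noteq> {0} \<and> W \<noteq> UNIV \<and> (\<forall>A\<in>L. \<forall>w\<in>W. A *v w \<in> W))"

definition su2 :: "(complex^2^2) set" where
  "su2 = {X. (\<forall>i j. cnj (X $ j $ i) = - (X $ i $ j)) \<and> trace X = 0}"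

definition principal_su2 :: "(real^7^7) set \<Rightarrow> bool" where
  "principal_su2 L \<longleftrightarrow>
     lie_subalgebra L \<and> L \<subseteq> g2 \<and>
     (\<exists>f :: complex^2^2 \<Rightarrow> real^7^7. linear f \<and> bij_betw f su2 L \<and>
        (\<forall>X\<in>su2. \<forall>Y\<in>su2. f (lie_bracket X Y) = lie_bracket (f X) (f Y))) \<and>
     \<not> acts_reducibly L"

section \<open>The invariants\<close>

definition frob :: "real^7^7 \<Rightarrow> real^7^7 \<Rightarrow> real" where
  "frob U W = trace (transpose U ** W)"

definition E_space :: "real^7^7 \<Rightarrow> (real^7^7) set" where
  "E_space T = {Q. transpose Q = Q \<and> trace Q = 0 \<and> T ** Q ** T = Q}"

definition frob_onb :: "(15 \<Rightarrow> real^7^7) \<Rightarrow> (real^7^7) set \<Rightarrow> bool" where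
  "frob_onb Q E \<longleftrightarrow>
     (\<forall>i j. frob (Q i) (Q j) = (if i = j then 1 else 0)) \<and> span (range Q) = E"

text \<open>The common value of the Gram determinant over all Frobenius-orthonormal bases.  For
  \<open>T\<close> in \<open>reflections\<close> the space \<open>E_space T\<close> has dimension 15, so bases exist; a change of
  basis is orthogonal and does not affect the determinant.\<close>

definition R30 :: "real^7^7 \<Rightarrow> real^7^7 \<Rightarrow> real" where
  "R30 T Z = (THE r. \<forall>Q. frob_onb Q (E_space T) \<longrightarrow>
      r = det (\<chi> i j. frob (lie_bracket Z (Q i)) (lie_bracket Z (Q j))))"

definition H8 :: "real^7^7 \<Rightarrow> real^7^7 \<Rightarrow> real" where
  "H8 T Z =
    (let Ap = (1/2) *\<^sub>R (Z + T ** Z ** T);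
         Am = (1/2) *\<^sub>R (Z - T ** Z ** T);
         C  = lie_bracket Ap Am;
         Cp = lie_bracket Ap C;
         Cm = lie_bracket Am C
     in frob Am Am * frob Cp Cp + frob Ap Ap * frob Cm Cm - 2 * (frob C C)^2)"

definition U38 :: "real^7^7 \<Rightarrow> real^7^7 \<Rightarrow> real" where
  "U38 T Z = R30 T Z * H8 T Z"

text \<open>Restriction to \<open>S \<times> S'\<close> of a real polynomial in the entries of both matrices: on the
  finite-dimensional space of pairs, \<open>real_polynomial_function\<close> is the algebra generated by
  the constants and the linear functionals.\<close>

definition polynomial_on :: "(real^7^7) set \<Rightarrow> (real^7^7) set \<Rightarrow> (real^7^7 \<Rightarrow> real^7^7 \<Rightarrow> real) \<Rightarrow> bool" where
  "polynomial_on S S' F \<longleftrightarrow>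
     (\<exists>p :: (real^7^7) \<times> (real^7^7) \<Rightarrow> real. real_polynomial_function p \<and>
        (\<forall>T\<in>S. \<forall>Z\<in>S'. F T Z = p (T, Z)))"

definition conj_by :: "real^7^7 \<Rightarrow> real^7^7 \<Rightarrow> real^7^7" where
  "conj_by g A = g ** A ** matrix_inv g"

definition outcome_reducible :: "real^7^7 \<Rightarrow> real^7^7 \<Rightarrow> bool" where
  "outcome_reducible T Z \<longleftrightarrow>
     R30 T Z = 0 \<and> acts_reducibly (Lie_gen Z (T ** Z ** T)) \<and> Lie_gen Z (T ** Z ** T) \<subset> g2"

definition outcome_principal :: "real^7^7 \<Rightarrow> real^7^7 \<Rightarrow> bool" where
  "outcome_principal T Z \<longleftrightarrow>
     R30 T Z > 0 \<and> H8 T Z = 0 \<and> principal_su2 (Lie_gen Z (T ** Z ** T))"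

definition outcome_full :: "real^7^7 \<Rightarrow> real^7^7 \<Rightarrow> bool" where
  "outcome_full T Z \<longleftrightarrow>
     R30 T Z > 0 \<and> H8 T Z > 0 \<and> Lie_gen Z (T ** Z ** T) = g2"

end

theory Submission
  imports Defs
begin

text \<open>The Lie algebra \<open>L\<close> generated by \<open>Z\<close> and \<open>T Z T\<close> is normalised by \<open>T\<close> and generated by the even and odd
  parts \<open>A\<^sub>+\<close>, \<open>A\<^sub>-\<close> of \<open>Z\<close>.

  If \<open>L\<close> preserves a subspace with orthogonal projection \<open>P\<close>, then \<open>P + T P T\<close> minus a scalar is a nonzero
  element of \<open>E_T\<close> commuting with \<open>Z\<close>; conversely such an element commutes with all of \<open>L\<close> and its eigenspaces
  are invariant.  So \<open>R30\<close> vanishes exactly in the reducible case.  Invariance of the Frobenius product turns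
  \<open>H8 \<ge> 0\<close> into two Cauchy-Schwarz inequalities, and equality says that \<open>A\<^sub>+\<close>, \<open>A\<^sub>-\<close> and their bracket span a
  subalgebra.

  It remains to see that an irreducible subalgebra of dimension at least four is everything.  It contains two
  independent commuting elements, because a compact Lie algebra of rank one has dimension at most three.
  These are diagonal in a suitable octonion frame, so the algebra contains a maximal torus and is a sum of
  root planes; irreducibility leaves only the full root system.\<close>

section \<open>The seven-dimensional cross product\<close>

text \<open>Everything stays real. A root of \<open>X\<close> appears as a plane that
  \<open>ad X\<close> rotates, hence as an eigenvalue of the symmetric map
  \<open>- (ad X)^2\<close>, so \<open>top_eigenvector\<close>, the maximum of a quadratic form on a
  sphere, does all the spectral work. Oddness of 7 enters twice: it gives two commuting skew
  matrices a common kernel vector, and it forbids a subspace of dimension 7/2, the one case in which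
  \<open>P + T P T\<close> could be scalar for a proper subspace. The 2 in \<open>H8\<close> counts
  Cauchy-Schwarz defects: by invariance \<open>Am \<bullet> Cp = - (C \<bullet> C)\<close> and
  \<open>Ap \<bullet> Cm = C \<bullet> C\<close>, so each of the two products in \<open>H8\<close>
  is at least \<open>(C \<bullet> C)^2\<close>. \<open>R30\<close> is defined through bases of a
  space that moves with \<open>T\<close>, which hides that it is polynomial in \<open>T\<close>; a
  Cauchy-Binet sum over all matrix coordinates removes the basis. A commuting pair is brought to
  standard form by completing a common kernel vector and two common eigenvectors to an octonion
  frame. After that the root system is handled by explicit brackets, with multiplication of indices
  by 2 modulo 7 as the symmetry that saves cases.\<close>

lemma forall_7: "(\<forall>i::7. P i) \<longleftrightarrow> P 0 \<and> P 1 \<and> P 2 \<and> P 3 \<and> P 4 \<and> P 5 \<and> P 6"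
proof -
  have "(\<forall>i::7. P i) \<longleftrightarrow> (\<forall>i\<in>{0,1,2,3,4,5,6::7}. P i)" unfolding UNIV_7[symmetric] by simp
  then show ?thesis by simp
qed

lemmas arith_7 = add_0 arith_simps arith_special numerals_mod_7

lemma cross7_nth:
  "cross7 u v $ 0 = (u$1 * v$3 - u$3 * v$1) + (u$2 * v$6 - u$6 * v$2) + (u$4 * v$5 - u$5 * v$4)"
  "cross7 u v $ 1 = (u$2 * v$4 - u$4 * v$2) + (u$3 * v$0 - u$0 * v$3) + (u$5 * v$6 - u$6 * v$5)"
  "cross7 u v $ 2 = (u$3 * v$5 - u$5 * v$3) + (u$4 * v$1 - u$1 * v$4) + (u$6 * v$0 - u$0 * v$6)"
  "cross7 u v $ 3 = (u$4 * v$6 - u$6 * v$4) + (u$5 * v$2 - u$2 * v$5) + (u$0 * v$1 - u$1 * v$0)"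
  "cross7 u v $ 4 = (u$5 * v$0 - u$0 * v$5) + (u$6 * v$3 - u$3 * v$6) + (u$1 * v$2 - u$2 * v$1)"
  "cross7 u v $ 5 = (u$6 * v$1 - u$1 * v$6) + (u$0 * v$4 - u$4 * v$0) + (u$2 * v$3 - u$3 * v$2)"
  "cross7 u v $ 6 = (u$0 * v$2 - u$2 * v$0) + (u$1 * v$5 - u$5 * v$1) + (u$3 * v$4 - u$4 * v$3)"
  by (simp_all only: cross7_def vec_lambda_beta arith_7)

lemma inner_7: "(u::real^7) \<bullet> v = u$0 * v$0 + u$1 * v$1 + u$2 * v$2 + u$3 * v$3 + u$4 * v$4 + u$5 * v$5 + u$6 * v$6"
  by (simp add: inner_vec_def sum_7)

declare transpose_matrix_vector [simp del]

lemma matrix_mul_linear: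
  fixes A B C :: "real^'n^'n"
  shows "(A + B) ** C = A ** C + B ** C" "A ** (B + C) = A ** B + A ** C"
    "(A - B) ** C = A ** C - B ** C" "A ** (B - C) = A ** B - A ** C"
    and matrix_mul_simps [simp]: "(c *\<^sub>R A) ** B = c *\<^sub>R (A ** B)" "A ** (c *\<^sub>R B) = c *\<^sub>R (A ** B)"
    "(- A) ** B = - (A ** B)" "A ** (- B) = - (A ** B)" "A ** 0 = 0" "0 ** A = 0"
  by (simp_all add: vec_eq_iff matrix_matrix_mult_def sum.distrib sum_subtractf
      sum_distrib_left algebra_simps sum_negf)

lemma matrix_vector_simps [simp]:
  fixes A :: "real^'n^'n"
  shows "(- A) *v x = - (A *v x)" "(c *\<^sub>R A) *v x = c *\<^sub>R (A *v x)" "A *v (- x) = - (A *v x)"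
  by (simp_all add: vec_eq_iff matrix_vector_mult_def sum_distrib_left algebra_simps sum_negf)

lemma inner_transpose:
  fixes A :: "real^'n^'m"
  shows "(A *v x) \<bullet> y = x \<bullet> (transpose A *v y)"
  by (metis dot_lmul_matrix inner_commute transpose_matrix_vector transpose_transpose)

lemma bilinear_cross7: "bilinear cross7"
  unfolding bilinear_def
  by (auto intro!: linearI simp: cross7_def vec_eq_iff algebra_simps)

lemmas cross7_simps [simp] =
  bilinear_lzero[OF bilinear_cross7] bilinear_rzero[OF bilinear_cross7]
  bilinear_lmul[OF bilinear_cross7] bilinear_rmul[OF bilinear_cross7]
  bilinear_lneg[OF bilinear_cross7] bilinear_rneg[OF bilinear_cross7]
lemmas cross7_linear =
  bilinear_ladd[OF bilinear_cross7] bilinear_radd[OF bilinear_cross7]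
  bilinear_lsub[OF bilinear_cross7] bilinear_rsub[OF bilinear_cross7]

lemma cross7_skew: "cross7 v u = - cross7 u v"
  by (auto simp: cross7_def vec_eq_iff algebra_simps)

lemma cross7_self [simp]: "cross7 u u = 0"
  by (auto simp: cross7_def vec_eq_iff algebra_simps)

lemma cross7_triple: "cross7 u v \<bullet> w = u \<bullet> cross7 v w"
  unfolding inner_7 cross7_nth by algebra

text \<open>Left alternativity \<open>u (u v) = (u u) v\<close> of the octonions, seen on imaginary
  parts. Together with \<open>cross7_triple\<close> it yields the polarised identity and the norm
  formula below without further expansion in coordinates.\<close>

lemma cross7_double: "cross7 u (cross7 u v) = (u \<bullet> v) *\<^sub>R u - (u \<bullet> u) *\<^sub>R v"
  unfolding vec_eq_iff forall_7 vector_minus_component vector_scaleR_component real_scaleR_def cross7_nth inner_7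
  by (intro conjI; algebra)

lemma cross7_orth [simp]: "u \<bullet> cross7 u v = 0" "v \<bullet> cross7 u v = 0" "cross7 u v \<bullet> u = 0" "cross7 u v \<bullet> v = 0"
proof -
  show *: "u \<bullet> cross7 u v = 0" for u v using cross7_triple[of u u v] by simp
  show "v \<bullet> cross7 u v = 0"  using *[of v u] by (simp add: cross7_skew[of u v])
  then show "cross7 u v \<bullet> u = 0" "cross7 u v \<bullet> v = 0" using * by (simp_all add: inner_commute)
qed

text \<open>Linearisation of \<open>cross7_double\<close> in the repeated factor. For mutually
  orthogonal vectors it says that two left multiplications anticommute, which is how products in a
  frame are rearranged later.\<close>

lemma cross7_polar:
  "cross7 u (cross7 v w) + cross7 v (cross7 u w)
     = (u \<bullet> w) *\<^sub>R v + (v \<bullet> w) *\<^sub>R u - (2 * (u \<bullet> v)) *\<^sub>R w"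
  using cross7_double[of "u+v" w] cross7_double[of u w] cross7_double[of v w]
  by (simp add: cross7_linear inner_add_left inner_add_right algebra_simps inner_commute scaleR_2[symmetric])

lemma norm_cross7: "cross7 u v \<bullet> cross7 u v = (u \<bullet> u) * (v \<bullet> v) - (u \<bullet> v)^2"
proof -
  have "cross7 u v \<bullet> cross7 u v = - (v \<bullet> cross7 u (cross7 u v))"
    using cross7_triple[of v u "cross7 u v"] by (simp add: cross7_skew[of u v] inner_commute)
  then show ?thesis
    by (simp add: cross7_double inner_diff_right power2_eq_square inner_commute algebra_simps)
qed

section \<open>Automorphisms and derivations of the octonions as matrices on the imaginary
  part\<close>

definition preserves_cross :: "real^7^7 \<Rightarrow> bool" where
  "preserves_cross A \<longleftrightarrow> (\<forall>u v. A *v cross7 u v = cross7 (A *v u) (A *v v))"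

definition derives_cross :: "real^7^7 \<Rightarrow> bool" where
  "derives_cross A \<longleftrightarrow> (\<forall>u v. A *v cross7 u v = cross7 (A *v u) v + cross7 u (A *v v))"

lemma omult_Im: "omult (0,u) (0,v) = (- (u \<bullet> v), cross7 u v)"
  by (simp add: omult_def)

lemma inner_orthogonal_matrix:
  fixes A :: "real^'n^'n" assumes "orthogonal_matrix A" shows "(A *v u) \<bullet> (A *v v) = u \<bullet> v"
  using assms orthogonal_transformation_matrix[of "(*v) A"] orthogonal_transformation_def[of "(*v) A"]
  by (simp add: matrix_of_matrix_vector_mul)

lemma orthogonal_matrixI:
  fixes A :: "real^'n^'n" assumes "\<And>u v. (A *v u) \<bullet> (A *v v) = u \<bullet> v" shows "orthogonal_matrix A"
  using assms orthogonal_transformation_matrix[of "(*v) A"] orthogonal_transformation_def[of "(*v) A"]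
  by (simp add: matrix_of_matrix_vector_mul)

lemma skew_matrixI:
  fixes A :: "real^'n^'n" assumes "\<And>u v. (A *v u) \<bullet> v + u \<bullet> (A *v v) = 0" shows "transpose A = - A"
proof -
  have "(A *v axis j 1) \<bullet> axis i 1 + axis j 1 \<bullet> (A *v axis i 1) = 0" for i j using assms by blast
  then have "A $ i $ j + A $ j $ i = 0" for i j
    by (simp add: matrix_vector_mul_component inner_axis inner_axis' flip: cart_eq_inner_axis) 
  then show ?thesis by (simp add: transpose_def vec_eq_iff eq_neg_iff_add_eq_0) 
qed

lemma skew_inner:
  fixes A :: "real^'n^'n" assumes "transpose A = - A" shows "(A *v u) \<bullet> v = - (u \<bullet> (A *v v))"
  using inner_transpose[of A u v] assms by simp

text \<open>An automorphism fixes 1: choosing \<open>y\<close> with \<open>f y = 1\<close> gives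
  \<open>1 = f (1 y) = f 1\<close>. Applied to a product of two imaginary octonions, the scalar part
  then says isometry and the imaginary part says that the cross product is preserved.\<close>

lemma G2_iff: "A \<in> G2 \<longleftrightarrow> orthogonal_matrix A \<and> preserves_cross A"
proof
  assume "A \<in> G2"
  then obtain f where f: "linear f" "bij f" "\<And>x y. f (omult x y) = omult (f x) (f y)" "\<And>v. f (0, v) = (0, A *v v)"
    by (auto simp: G2_def octo_automorphism_def acts_on_Im_def)
  obtain y where y: "f y = oone" using f(2) by (metis bij_pointE)
  have f1: "f oone = oone" using f(3)[of oone y] y by simp
  have f0: "f (a, v) = (a, A *v v)" for a v
  proof -
    have "(a, v) = a *\<^sub>R oone + (0, v)" by (simp add: oone_def)
    then have "f (a, v) = a *\<^sub>R f oone + f (0, v)" using f(1) by (metis linear_add linear_scale)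
    then show ?thesis by (simp add: f1 f(4)) (simp add: oone_def)
  qed
  have "(- (u \<bullet> v), A *v cross7 u v) = (- ((A *v u) \<bullet> (A *v v)), cross7 (A *v u) (A *v v))" for u v
    using f(3)[of "(0,u)" "(0,v)"] by (simp only: omult_Im f0)
  then show "orthogonal_matrix A \<and> preserves_cross A"
    by (auto simp: preserves_cross_def intro!: orthogonal_matrixI)
next
  assume A: "orthogonal_matrix A \<and> preserves_cross A"
  define f :: "octo \<Rightarrow> octo" where "f x = (fst x, A *v snd x)" for x
  have inv: "transpose A *v (A *v v) = v" "A *v (transpose A *v v) = v" for v
    using A by (simp_all add: orthogonal_matrix_def matrix_vector_mul_assoc)
  have "octo_automorphism f" unfolding octo_automorphism_def
  proof (intro conjI allI)
    show "linear f" by (auto intro!: linearI simp: f_def matrix_vector_right_distrib matrix_vector_mult_scaleR)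
    show "bij f" by (rule o_bij[of "\<lambda>x. (fst x, transpose A *v snd x)"]) (auto simp: f_def fun_eq_iff inv)
    show "f (omult x y) = omult (f x) (f y)" for x y using A
      by (simp add: f_def omult_def preserves_cross_def inner_orthogonal_matrix matrix_vector_right_distrib matrix_vector_mult_scaleR)
  qed
  then show "A \<in> G2" by (auto simp: G2_def acts_on_Im_def f_def intro!: exI[of _ f])
qed

text \<open>A derivation kills 1 because \<open>1 1 = 1\<close>. On a product of two imaginary
  octonions the scalar part gives skewness and the imaginary part the Leibniz rule.\<close>

lemma g2_iff: "A \<in> g2 \<longleftrightarrow> transpose A = - A \<and> derives_cross A"
proof
  assume "A \<in> g2"
  then obtain d where d: "linear d" "\<And>x y. d (omult x y) = omult (d x) y + omult x (d y)" "\<And>v. d (0, v) = (0, A *v v)"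
    by (auto simp: g2_def octo_derivation_def acts_on_Im_def)
  have d1: "d oone = 0" using d(2)[of oone oone] by simp
  have d0: "d (a, v) = (0, A *v v)" for a v
  proof -
    have "(a, v) = a *\<^sub>R oone + (0, v)" by (simp add: oone_def)
    then have "d (a, v) = a *\<^sub>R d oone + d (0, v)" using d(1) by (metis linear_add linear_scale)
    then show ?thesis by (simp add: d1 d(3))
  qed
  have "(0, A *v cross7 u v) = (- ((A *v u) \<bullet> v) - (u \<bullet> (A *v v)), cross7 (A *v u) v + cross7 u (A *v v))" for u v
    using d(2)[of "(0,u)" "(0,v)"] by (simp only: omult_Im d0) simp
  then have eq: "0 = - ((A *v u) \<bullet> v) - (u \<bullet> (A *v v))" "A *v cross7 u v = cross7 (A *v u) v + cross7 u (A *v v)" for u v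
    by (meson prod.inject)+
  then have "derives_cross A" by (auto simp: derives_cross_def)
  moreover have "(A *v u) \<bullet> v + u \<bullet> (A *v v) = 0" for u v using eq(1)[of u v] by linarith
  ultimately show "transpose A = - A \<and> derives_cross A"
    using skew_matrixI by blast
next
  assume A: "transpose A = - A \<and> derives_cross A"
  define d :: "octo \<Rightarrow> octo" where "d x = (0, A *v snd x)" for x
  have "octo_derivation d" unfolding octo_derivation_def
  proof (intro conjI allI)
    show "linear d" by (auto intro!: linearI simp: d_def matrix_vector_right_distrib matrix_vector_mult_scaleR)
    show "d (omult x y) = omult (d x) y + omult x (d y)" for x y using A
      by (simp add: d_def omult_def derives_cross_def skew_inner matrix_vector_right_distrib matrix_vector_mult_scaleR)
  qed
  then show "A \<in> g2" by (auto simp: g2_def acts_on_Im_def d_def intro!: exI[of _ d])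
qed

section \<open>The Lie bracket of matrices and the Frobenius product\<close>

lemma transpose_add: "transpose (A + B) = transpose A + transpose (B::'a::plus^'n^'m)"
  by (simp add: transpose_def vec_eq_iff)
lemma transpose_diff: "transpose (A - B) = transpose A - transpose (B::'a::minus^'n^'m)"
  by (simp add: transpose_def vec_eq_iff)
lemma lie_bracket_linear:
  fixes A B C :: "real^'n^'n"
  shows "lie_bracket (A + B) C = lie_bracket A C + lie_bracket B C"
    "lie_bracket A (B + C) = lie_bracket A B + lie_bracket A C"
    "lie_bracket (A - B) C = lie_bracket A C - lie_bracket B C"
    "lie_bracket A (B - C) = lie_bracket A B - lie_bracket A C"
    and lie_bracket_simps [simp]: "lie_bracket (c *\<^sub>R A) B = c *\<^sub>R lie_bracket A B"
    "lie_bracket A (c *\<^sub>R B) = c *\<^sub>R lie_bracket A B"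
    "lie_bracket (- A) B = - lie_bracket A B"
    "lie_bracket A (- B) = - lie_bracket A B"
    "lie_bracket A A = 0" "lie_bracket A 0 = 0" "lie_bracket 0 A = 0"
  by (simp_all add: lie_bracket_def vec_eq_iff matrix_matrix_mult_def sum.distrib sum_subtractf
      sum_distrib_left algebra_simps sum_negf)

lemma lie_bracket_skew: "lie_bracket B A = - lie_bracket A (B :: real^'n^'n)"
  by (simp add: lie_bracket_def)

lemma lie_bracket_jacobi:
  fixes A B C :: "real^'n^'n"
  shows "lie_bracket A (lie_bracket B C) = lie_bracket (lie_bracket A B) C + lie_bracket B (lie_bracket A C)"
  by (simp add: lie_bracket_def matrix_mul_linear matrix_mul_assoc)

lemma inner_matrix: "(A::real^'n^'m) \<bullet> B = (\<Sum>i\<in>UNIV. \<Sum>j\<in>UNIV. A $ i $ j * B $ i $ j)"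
  by (simp add: inner_vec_def)

lemma frob_eq_inner: "frob U W = U \<bullet> W"
  unfolding frob_def trace_def inner_matrix matrix_matrix_mult_def transpose_def
  by simp (rule sum.swap)

section \<open>Compact Lie algebras of rank one\<close>

text \<open>The form \<open>f x \<bullet> x\<close> attains its maximum \<open>l\<close> on the unit
  sphere of \<open>W\<close>, at \<open>v\<close> say. Then
  \<open>g x = l * (x \<bullet> x) - f x \<bullet> x\<close> is nonnegative on \<open>W\<close> and
  vanishes at \<open>v\<close>; moving from \<open>v\<close> against \<open>u = l v - f v\<close>
  would make \<open>g\<close> negative unless \<open>u = 0\<close>.\<close>

lemma top_eigenvector:
  fixes f :: "'a::euclidean_space \<Rightarrow> 'a"
  assumes lin: "linear f" and W: "subspace W" "W \<noteq> {0}" and inv: "\<And>x. x \<in> W \<Longrightarrow> f x \<in> W"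
    and sym: "\<And>x y. x \<in> W \<Longrightarrow> y \<in> W \<Longrightarrow> f x \<bullet> y = x \<bullet> f y"
  obtains v l where "v \<in> W" "norm v = 1" "f v = l *\<^sub>R v" "\<And>x. x \<in> W \<Longrightarrow> f x \<bullet> x \<le> l * (x \<bullet> x)"
proof -
  obtain w where w: "w \<in> W" "w \<noteq> 0" using W subspace_0 by fastforce
  have "(1 / norm w) *\<^sub>R w \<in> W \<inter> sphere 0 1" using w W by (simp add: subspace_scale)
  moreover have "compact (W \<inter> sphere 0 1)" using W by (simp add: closed_Int_compact closed_subspace)
  moreover have "continuous_on (W \<inter> sphere 0 1) (\<lambda>x. f x \<bullet> x)"
    using lin by (intro continuous_intros linear_continuous_on linear_linear[THEN iffD1] | simp add: linear_conv_bounded_linear)+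
  ultimately obtain v where v: "v \<in> W" "norm v = 1" and mx: "\<And>x. x \<in> W \<Longrightarrow> norm x = 1 \<Longrightarrow> f x \<bullet> x \<le> f v \<bullet> v"
    using continuous_attains_sup[of "W \<inter> sphere 0 1" "\<lambda>x. f x \<bullet> x"] by fastforce
  define l where "l = f v \<bullet> v"
  have le: "f x \<bullet> x \<le> l * (x \<bullet> x)" if "x \<in> W" for x
  proof (cases "x = 0")
    case False
    have "f ((1 / norm x) *\<^sub>R x) \<bullet> ((1 / norm x) *\<^sub>R x) \<le> l"
      unfolding l_def using False that W by (intro mx) (simp_all add: subspace_scale)
    then have "(f x \<bullet> x) / (norm x)^2 \<le> l"
      using lin by (simp add: linear_scale power2_eq_square)
    then show ?thesis using False by (simp add: divide_le_eq power2_norm_eq_inner)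
  qed (use lin in \<open>simp add: linear_0\<close>)
  define u where "u = l *\<^sub>R v - f v"
  define g where "g x = l * (x \<bullet> x) - f x \<bullet> x" for x
  have uW: "u \<in> W" unfolding u_def using v W inv by (simp add: subspace_diff subspace_scale)
  have vv: "v \<bullet> v = 1" using v by (simp add: norm_eq_1)
  have "g (v - t *\<^sub>R u) = t^2 * g u - 2 * t * (u \<bullet> u)" for t
  proof -
    have *: "g (v - t *\<^sub>R u) = l * (v \<bullet> v) - f v \<bullet> v - t * (2 * (l * (v \<bullet> u)) - f v \<bullet> u - f u \<bullet> v) + t^2 * g u"
      unfolding g_def using lin
      by (simp add: linear_diff linear_scale inner_diff_left inner_diff_right inner_commute power2_eq_square algebra_simps)
    moreover have "f u \<bullet> v = f v \<bullet> u" using sym[OF uW v(1)] by (simp add: inner_commute)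
    moreover have "l * (v \<bullet> u) - f v \<bullet> u = u \<bullet> u" by (simp add: u_def inner_diff_left)
    ultimately have "2 * (l * (v \<bullet> u)) - f v \<bullet> u - f u \<bullet> v = 2 * (u \<bullet> u)" by linarith
    with * show ?thesis using vv by (simp add: l_def)
  qed
  moreover have "g (v - t *\<^sub>R u) \<ge> 0" for t
    using le[of "v - t *\<^sub>R u"] v uW W by (simp add: g_def subspace_diff subspace_scale)
  ultimately have ge: "t^2 * g u - 2 * t * (u \<bullet> u) \<ge> 0" for t by simp
  have g0: "g u \<ge> 0" using le[OF uW] by (simp add: g_def)
  \<comment> \<open>With \<open>s (g u + 1) = u \<bullet> u\<close> the inequality \<open>ge\<close>
    at \<open>s\<close> becomes \<open>s (u \<bullet> u) + s^2 \<le> 0\<close>. The summand 1 keeps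
    the denominator positive when \<open>g u = 0\<close>.\<close>
  define s where "s = (u \<bullet> u) / (g u + 1)"
  have "s * (g u + 1) = u \<bullet> u" using g0 by (simp add: s_def)
  then have "s^2 * g u + s^2 = s * (u \<bullet> u)" by (simp add: power2_eq_square algebra_simps flip: distrib_left)
  then have "s * (u \<bullet> u) + s^2 \<le> 0" using ge[of s] by (simp add: algebra_simps)
  moreover have "s * (u \<bullet> u) \<ge> 0" using g0 by (simp add: s_def)
  ultimately have "s = 0" by (smt (verit) zero_less_power2)
  then have "u = 0" using g0 by (auto simp: s_def)
  then have "f v = l *\<^sub>R v" by (simp add: u_def)
  then show ?thesis using that v le by blast
qed

lemma inner_eq_trace: "(A::real^'n^'m) \<bullet> B = trace (transpose A ** B)"
  unfolding trace_def inner_matrix matrix_matrix_mult_def transpose_def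
  by simp (rule sum.swap)

text \<open>Cyclicity of the trace moves \<open>B\<close> to the other side, and the sign comes from
  \<open>transpose B = - B\<close>. All orthogonality relations between iterated brackets rest on
  this.\<close>

lemma lie_bracket_invariant:
  fixes A B C :: "real^'n^'n"
  assumes B: "transpose B = - B"
  shows "lie_bracket A B \<bullet> C = A \<bullet> lie_bracket B C"
proof -
  have "trace (B ** (transpose A ** C)) = trace (transpose A ** C ** B)"
    by (rule trace_mul_sym)
  then show ?thesis
    by (simp add: inner_eq_trace lie_bracket_def transpose_diff matrix_transpose_mul B matrix_mul_linear
        matrix_mul_assoc trace_add trace_sub)
qed

lemma halveI: "x = (c / 2) *\<^sub>R w" if "x + x = c *\<^sub>R w" for x :: "'a::real_vector"
proof -
  have "(1/2) *\<^sub>R (x + x) = (1/2) *\<^sub>R (c *\<^sub>R w)" using that by simp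
  then show ?thesis by simp
qed

text \<open>The span of \<open>X\<close>, \<open>Y\<close>, \<open>Y'\<close> is a copy of \<open>su(2)\<close> with root \<open>a\<close>, and \<open>W\<close>, \<open>W'\<close> are the real and imaginary parts of
  a vector of weight \<open>b\<close>.  The hypotheses \<open>up\<close> and \<open>down\<close> say that raising this vector once and lowering it
  twice both give zero, so it generates a representation of spin \<open>1/2\<close>.\<close>

lemma sl2_weight_half:
  fixes X Y Y' W W' :: "real^'n^'n" and a b :: real
  defines "R \<equiv> lie_bracket Y W" and "S \<equiv> lie_bracket Y W'"
  assumes XY: "lie_bracket X Y = a *\<^sub>R Y'" "lie_bracket X Y' = - (a *\<^sub>R Y)" "lie_bracket Y Y' = a *\<^sub>R X"
    and XW: "lie_bracket X W = b *\<^sub>R W'" "lie_bracket X W' = - (b *\<^sub>R W)"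
    and up: "lie_bracket Y' W' = R" "lie_bracket Y' W = - S"
    and down: "lie_bracket Y' S = - lie_bracket Y R" "lie_bracket Y' R = lie_bracket Y S"
    and ne: "a \<noteq> 0" "b \<noteq> 0" "W' \<noteq> 0"
  shows "a = 2 * b"
proof -
  have "lie_bracket Y R - lie_bracket Y' S = - ((a * b) *\<^sub>R W)"
    using lie_bracket_jacobi[of Y Y' W'] XY XW up by (simp add: S_def[symmetric])
  then have YR: "lie_bracket Y R = - ((a * b / 2) *\<^sub>R W)"
    using halveI[of "lie_bracket Y R" "- (a * b)" W] down by simp
  have "- lie_bracket Y S - lie_bracket Y' R = (a * b) *\<^sub>R W'"
    using lie_bracket_jacobi[of Y Y' W] XY XW up by (simp add: R_def[symmetric])
  then have YS: "lie_bracket Y S = - ((a * b / 2) *\<^sub>R W')"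
    using halveI[of "lie_bracket Y S" "- (a * b)" W'] down by (simp add: algebra_simps) (metis add.inverse_inverse minus_add_distrib)
  have "S \<noteq> 0" using YS ne by auto
  have XR: "lie_bracket X R = (b - a) *\<^sub>R S"
    using lie_bracket_jacobi[of X Y W] XY XW up by (simp add: R_def[symmetric] S_def[symmetric] algebra_simps)
  \<comment> \<open>A second evaluation of \<open>[X, R]\<close>, now from
    \<open>a X = [Y, Y']\<close>. Compared with \<open>XR\<close> it leaves
    \<open>a (2 b - a) S = 0\<close>.\<close>
  have "a *\<^sub>R lie_bracket X R = - ((a * b) *\<^sub>R S)"
  proof -
    have "a *\<^sub>R lie_bracket X R = lie_bracket Y (lie_bracket Y' R) - lie_bracket Y' (lie_bracket Y R)"
      using lie_bracket_jacobi[of Y Y' R] XY by (simp add: algebra_simps)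
    also have "\<dots> = - ((a * b / 2) *\<^sub>R S) - (a * b / 2) *\<^sub>R S"
      using YR YS down up by (simp add: S_def[symmetric])
    also have "\<dots> = - ((a * b / 2 + a * b / 2) *\<^sub>R S)" unfolding scaleR_left_distrib by simp
    also have "\<dots> = - ((a * b) *\<^sub>R S)" by simp
    finally show ?thesis .
  qed
  then have "(a * (b - a) + a * b) *\<^sub>R S = 0" unfolding scaleR_left_distrib by (simp add: XR)
  then have "a * (b - a) + a * b = 0" using \<open>S \<noteq> 0\<close> by simp
  then have "a * (2 * b - a) = 0" by (simp add: algebra_simps)
  then show ?thesis using ne by simp
qed

text \<open>\<open>D\<close> turns \<open>P\<close>, \<open>Q\<close> into each other with factor
  \<open>c\<close>, yet stretches them by at most \<open>a < c\<close>. With \<open>D = ad X\<close>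
  this expresses that no root of \<open>X\<close> exceeds the largest root \<open>a\<close>.\<close>

lemma rotation_expanding_zero:
  fixes D :: "'a::real_normed_vector \<Rightarrow> 'a"
  assumes "D P = c *\<^sub>R Q" "D Q = - (c *\<^sub>R P)" and "norm (D P) \<le> a * norm P" "norm (D Q) \<le> a * norm Q"
    and "0 < a" "a < c"
  shows "P = 0" "Q = 0"
proof -
  have *: "c * norm Q \<le> a * norm P" "c * norm P \<le> a * norm Q" using assms by simp_all
  then have "c * (norm P + norm Q) \<le> a * (norm P + norm Q)" by (simp add: algebra_simps)
  then have "norm P + norm Q \<le> 0" using assms by (simp add: mult_le_cancel_right) 
  then show "P = 0" "Q = 0" by (smt (verit) norm_ge_zero norm_le_zero_iff)+
qed

text \<open>Let \<open>a\<close> be the largest root of \<open>X\<close> and let \<open>W\<close> be a further weight vector, of weight \<open>b \<le> a\<close>.  Relative to the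
  \<open>su(2)\<close> of \<open>a\<close> it has spin \<open>1/2\<close>, so \<open>a = 2 b\<close>.  Relative to the \<open>su(2)\<close> of \<open>W\<close> the vector of weight \<open>a\<close> cannot reach
  weight zero, where there is only \<open>X\<close>, so it has spin \<open>1/2\<close> as well and \<open>b = 2 a\<close>.\<close>

theorem rank_one_dim_le_3:
  fixes L :: "(real^'n^'n) set"
  assumes sub: "subspace L" and closed: "\<And>A B. A \<in> L \<Longrightarrow> B \<in> L \<Longrightarrow> lie_bracket A B \<in> L"
    and skew: "\<And>A. A \<in> L \<Longrightarrow> transpose A = - A"
    and rank1: "\<And>A B. A \<in> L \<Longrightarrow> B \<in> L \<Longrightarrow> lie_bracket A B = 0 \<Longrightarrow> A \<noteq> 0 \<Longrightarrow> B \<in> span {A}"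
  shows "dim L \<le> 3"
proof (rule ccontr)
  assume "\<not> dim L \<le> 3"
  then have dimL: "dim L > 3" by simp
  note inv = lie_bracket_invariant[OF skew]
  have small: "\<exists>A\<in>L. A \<noteq> 0 \<and> (\<forall>b\<in>B. A \<bullet> b = 0)" if "finite B" "card B \<le> 3" "B \<subseteq> L" for B
  proof -
    have "dim (span B) \<le> 3" using dim_le_card[of "span B" B] that by (simp add: le_trans)
    moreover have "span B \<subseteq> L" using that sub by (simp add: span_minimal)
    ultimately have "span B \<subset> span L" using dimL sub by (metis dim_span leD order_le_imp_less_or_eq psubsetI span_eq_iff)
    then obtain A where "A \<noteq> 0" "A \<in> span L" "\<And>y. y \<in> span B \<Longrightarrow> orthogonal A y"
      using orthogonal_to_subspace_exists_gen[of B L] by blast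
    then show ?thesis using sub by (auto simp: span_eq_iff[THEN iffD2] orthogonal_def span_base)
  qed
  obtain X0 where X0: "X0 \<in> L" "X0 \<noteq> 0" using small[of "{}"] by auto
  define X where "X = (1 / norm X0) *\<^sub>R X0"
  have "norm X = 1" using X0 by (simp add: X_def)
  then have X: "X \<in> L" "norm X = 1" "X \<noteq> 0" "X \<bullet> X = 1"
    using X0 sub by (auto simp: subspace_scale norm_eq_1) (simp add: X_def subspace_scale)
  have centr: "B = (B \<bullet> X) *\<^sub>R X" if B: "B \<in> L" "lie_bracket X B = 0" for B
  proof -
    obtain c where "B = c *\<^sub>R X" using rank1[OF X(1) B X(3)] by (auto simp: span_singleton)
    then show ?thesis using X by simp
  qed
  have centr0: "B = 0" if "B \<in> L" "lie_bracket X B = 0" "B \<bullet> X = 0" for B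
    using centr[OF that(1,2)] that(3) by simp
  \<comment> \<open>On \<open>L\<close> this map is symmetric and nonnegative, and its eigenvalues
    are the squares of the roots of \<open>X\<close>.\<close>
  define f where "f A = - lie_bracket X (lie_bracket X A)" for A
  have lin: "linear f" by (auto intro!: linearI simp: f_def lie_bracket_linear)
  have f_inner: "f A \<bullet> B = lie_bracket X A \<bullet> lie_bracket X B" if "A \<in> L" "B \<in> L" for A B
    using inv[OF X(1), of "lie_bracket X A" B] by (simp add: f_def lie_bracket_skew[of "lie_bracket X A" X])
  have fL: "f A \<in> L" if "A \<in> L" for A using that sub closed X by (simp add: f_def subspace_neg)
  have sym: "f A \<bullet> B = A \<bullet> f B" if "A \<in> L" "B \<in> L" for A B
    using f_inner[OF that] f_inner[OF that(2,1)] by (simp add: inner_commute)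
  have XXA: "lie_bracket X A \<bullet> X = 0" for A
    using inv[OF X(1), of A X] lie_bracket_skew[of A X] by simp
  obtain Y l where Y: "Y \<in> L" "norm Y = 1" "f Y = l *\<^sub>R Y" and top: "\<And>A. A \<in> L \<Longrightarrow> f A \<bullet> A \<le> l * (A \<bullet> A)"
    using top_eigenvector[OF lin sub _ fL sym] X by blast
  \<comment> \<open>A root vector \<open>W\<close> and its image \<open>W'\<close> form an
    \<open>su(2)\<close> with \<open>X\<close>: \<open>[W, W']\<close> commutes with
    \<open>X\<close>, hence is a multiple of it, and invariance of the inner product identifies the
    factor as the root \<open>b\<close>.\<close>
  have eig_pos: "\<exists>b>0. l = b^2 \<and> W \<bullet> X = 0 \<and>
      (\<exists>W'\<in>L. W' \<noteq> 0 \<and> lie_bracket X W = b *\<^sub>R W' \<and> lie_bracket X W' = - (b *\<^sub>R W) \<and> lie_bracket W W' = b *\<^sub>R X)"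
    if W: "W \<in> L" "norm W = 1" "f W = l *\<^sub>R W" "lie_bracket X W \<noteq> 0" for W l
  proof -
    have "l * (W \<bullet> W) = lie_bracket X W \<bullet> lie_bracket X W" using f_inner[OF W(1,1)] W by simp
    moreover have WW: "W \<bullet> W = 1" using W by (simp add: norm_eq_1)
    ultimately have "l > 0" using W by simp
    define b where "b = sqrt l"
    have b: "b > 0" "l = b^2" using \<open>l > 0\<close> by (simp_all add: b_def)
    define W' where "W' = (1 / b) *\<^sub>R lie_bracket X W"
    have 1: "lie_bracket X W = b *\<^sub>R W'" using b by (simp add: W'_def)
    have "lie_bracket X (lie_bracket X W) = - ((b * b) *\<^sub>R W)" using W(3) b by (simp add: f_def power2_eq_square) (metis minus_minus)
    then have 2: "lie_bracket X W' = - (b *\<^sub>R W)" using b by (simp add: W'_def)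
    have W'L: "W' \<in> L" using closed X W sub by (simp add: W'_def subspace_scale)
    have "W \<bullet> X = 0" using XXA[of W'] 2 b by simp
    have "lie_bracket X (lie_bracket W W') = 0"
      using lie_bracket_jacobi[of X W W'] 1 2 by simp
    then have "lie_bracket W W' = (lie_bracket W W' \<bullet> X) *\<^sub>R X" using centr closed W W'L by blast
    moreover have "lie_bracket W W' \<bullet> X = b"
      using inv[OF W'L, of W X] 2 WW lie_bracket_skew[of W' X] by simp
    ultimately have "lie_bracket W W' = b *\<^sub>R X" by simp
    then show ?thesis using b 1 2 W'L W(4) \<open>W \<bullet> X = 0\<close> by (intro exI[of _ b]) auto
  qed
  have "lie_bracket X Y \<noteq> 0"
  proof
    assume 0: "lie_bracket X Y = 0"
    then have "l *\<^sub>R Y = 0" using Y by (simp add: f_def)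
    then have "l = 0" using Y by auto
    obtain A where A: "A \<in> L" "A \<noteq> 0" "A \<bullet> X = 0" using small[of "{X}"] X by auto
    have "lie_bracket X A \<bullet> lie_bracket X A \<le> 0" using top[OF A(1)] f_inner[OF A(1,1)] \<open>l = 0\<close> by simp
    then have "lie_bracket X A = 0" by (metis inner_ge_zero inner_eq_zero_iff order_antisym)
    then show False using centr0 A by blast
  qed
  from eig_pos[OF Y this] obtain a Y' where a: "a > 0" "l = a^2" and Y': "Y' \<in> L" "Y' \<noteq> 0"
    and XY: "lie_bracket X Y = a *\<^sub>R Y'" "lie_bracket X Y' = - (a *\<^sub>R Y)" "lie_bracket Y Y' = a *\<^sub>R X"
    and YX: "Y \<bullet> X = 0" by blast
  have bound: "norm (lie_bracket X A) \<le> a * norm A" if "A \<in> L" for A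
  proof (rule power2_le_imp_le)
    show "(norm (lie_bracket X A))\<^sup>2 \<le> (a * norm A)\<^sup>2"
      using top[OF that] f_inner[OF that that] a by (simp add: power2_norm_eq_inner power_mult_distrib)
  qed (use a in simp)
  \<comment> \<open>The complement in \<open>L\<close> of the \<open>su(2)\<close> of the largest
    root. It is nonzero because \<open>dim L > 3\<close>, and \<open>f\<close> preserves it, so it
    contains a further root vector \<open>W\<close>.\<close>
  define M where "M = {A \<in> L. A \<bullet> X = 0 \<and> A \<bullet> Y = 0 \<and> A \<bullet> Y' = 0}"
  have Msub: "subspace M" using sub by (auto simp: M_def subspace_def inner_add_left)
  have fM: "f A \<in> M" if "A \<in> M" for A
  proof -
    have A: "A \<in> L" "A \<bullet> X = 0" "A \<bullet> Y = 0" "A \<bullet> Y' = 0" using that by (auto simp: M_def)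
    have "f Y' = (a * a) *\<^sub>R Y'" "f X = 0" using XY by (simp_all add: f_def)
    then show ?thesis using A fL[OF A(1)] sym[OF A(1)] X Y Y' by (auto simp: M_def)
  qed
  have "card {X, Y, Y'} \<le> 3" by (simp add: card_insert_if)
  then obtain A where "A \<in> M" "A \<noteq> 0" using small[of "{X, Y, Y'}"] X(1) Y(1) Y'(1) by (auto simp: M_def)
  then obtain W m where W: "W \<in> M" "norm W = 1" "f W = m *\<^sub>R W"
    using top_eigenvector[OF lin Msub _ fM sym] by (metis (mono_tags, lifting) M_def mem_Collect_eq singletonD)
  have WL: "W \<in> L" and WX: "W \<bullet> X = 0" and WY: "W \<bullet> Y = 0" and WY': "W \<bullet> Y' = 0" using W by (auto simp: M_def)
  have "lie_bracket X W \<noteq> 0" using centr0[OF WL _ WX] W by auto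
  from eig_pos[OF WL W(2,3) this] obtain b W' where b: "b > 0" "m = b^2" and W': "W' \<in> L" "W' \<noteq> 0"
    and XW: "lie_bracket X W = b *\<^sub>R W'" "lie_bracket X W' = - (b *\<^sub>R W)" "lie_bracket W W' = b *\<^sub>R X" by blast
  have "b \<le> a" 
  proof -
    have "m * (W \<bullet> W) \<le> l * (W \<bullet> W)" using top[OF WL] W by simp
    then have "b^2 \<le> a^2" using W b a by (simp add: norm_eq_1)
    then show ?thesis using a b by (simp add: abs_le_square_iff[symmetric])
  qed
  have adj: "lie_bracket X A \<bullet> B = - (A \<bullet> lie_bracket X B)" for A B
    using inv[OF X(1), of A B] lie_bracket_skew[of A X] by simp
  have W'Y: "W' \<bullet> Y = 0" and W'Y': "W' \<bullet> Y' = 0"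
    using adj[of W Y] adj[of W Y'] XW XY WY WY' b by auto
  \<comment> \<open>\<open>P + i Q\<close> is \<open>[Y + i Y', W + i W']\<close>, of weight
    \<open>a + b > a\<close> up to sign, and therefore zero.\<close>
  define P where "P = lie_bracket Y W - lie_bracket Y' W'"
  define Q where "Q = lie_bracket Y W' + lie_bracket Y' W"
  have PQL: "P \<in> L" "Q \<in> L" using closed Y Y' WL W' sub by (auto simp: P_def Q_def subspace_diff subspace_add)
  have XP: "lie_bracket X P = (a + b) *\<^sub>R Q" "lie_bracket X Q = - ((a + b) *\<^sub>R P)"
    by (simp_all add: P_def Q_def lie_bracket_linear lie_bracket_jacobi[of X] XY XW algebra_simps)
  have PQ0: "P = 0" "Q = 0"
    using rotation_expanding_zero[OF XP bound[OF PQL(1)] bound[OF PQL(2)]] a b by auto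
  define R where "R = lie_bracket Y W"
  define S where "S = lie_bracket Y W'"
  have up: "lie_bracket Y' W' = R" "lie_bracket Y' W = - S"
    using PQ0 by (auto simp: P_def Q_def R_def S_def eq_neg_iff_add_eq_0 add.commute)
  have RSL: "R \<in> L" "S \<in> L" using closed Y WL W' by (auto simp: R_def S_def)
  have XR: "lie_bracket X R = (b - a) *\<^sub>R S" "lie_bracket X S = (a - b) *\<^sub>R R"
    using up by (simp_all add: R_def S_def lie_bracket_jacobi[of X Y] XY XW algebra_simps)
  \<comment> \<open>\<open>R + i S\<close> is, up to the factor 2, \<open>W + i W'\<close> lowered
    once by \<open>Y - i Y'\<close>. Lowering it again gives \<open>P2 - i Q2\<close>, on which
    \<open>ad X\<close> rotates with speed \<open>2 a - b\<close>.\<close>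
  define P2 where "P2 = lie_bracket Y R + lie_bracket Y' S"
  define Q2 where "Q2 = lie_bracket Y' R - lie_bracket Y S"
  have PQ2L: "P2 \<in> L" "Q2 \<in> L" using closed Y Y' RSL sub by (auto simp: P2_def Q2_def subspace_diff subspace_add)
  have XP2: "lie_bracket X P2 = (2 * a - b) *\<^sub>R Q2" "lie_bracket X Q2 = - ((2 * a - b) *\<^sub>R P2)"
    by (simp_all add: P2_def Q2_def lie_bracket_linear lie_bracket_jacobi[of X] XY XR)
      (simp_all add: vec_eq_iff algebra_simps)
  have PQ20: "P2 = 0 \<and> Q2 = 0"
  proof (cases "b = a")
    \<comment> \<open>At \<open>b = a\<close> the speed \<open>2 a - b\<close> does not exceed
      \<open>a\<close>. But then \<open>R\<close> and \<open>S\<close> commute with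
      \<open>X\<close>, and being orthogonal to \<open>X\<close> they vanish already.\<close>
    case True
    have "R \<bullet> X = 0" using inv[OF WL, of Y X] XW(1) lie_bracket_skew[of W X] W'Y by (simp add: R_def inner_commute)
    moreover have "S \<bullet> X = 0" using inv[OF W'(1), of Y X] XW(2) lie_bracket_skew[of W' X] WY by (simp add: S_def inner_commute)
    ultimately have "R = 0" "S = 0" using centr0 RSL XR True by auto
    then show ?thesis by (simp add: P2_def Q2_def)
  next
    case False
    then show ?thesis
      using rotation_expanding_zero[OF XP2 bound[OF PQ2L(1)] bound[OF PQ2L(2)]] a b \<open>b \<le> a\<close> by auto
  qed
  have ab: "a = 2 * b"
    by (rule sl2_weight_half[OF XY XW(1,2)])
      (use up PQ20 a b W' in \<open>auto simp: R_def[symmetric] S_def[symmetric] P2_def Q2_def eq_neg_iff_add_eq_0 add.commute\<close>)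
  \<comment> \<open>Now the roles are exchanged: \<open>[W + i W', R + i S] = - P3 + i Q3\<close>
    has weight \<open>b + (b - a) = 0\<close>. So \<open>P3\<close> and \<open>Q3\<close> are
    multiples of \<open>X\<close>, and they are orthogonal to \<open>X\<close>.\<close>
  define P3 where "P3 = lie_bracket W' S - lie_bracket W R"
  define Q3 where "Q3 = lie_bracket W' R + lie_bracket W S"
  have PQ3L: "P3 \<in> L" "Q3 \<in> L" using closed WL W' RSL sub by (auto simp: P3_def Q3_def subspace_diff subspace_add)
  have XP3: "lie_bracket X P3 = 0" "lie_bracket X Q3 = 0"
    by (simp_all add: P3_def Q3_def lie_bracket_linear lie_bracket_jacobi[of X] XW XR ab algebra_simps)
  have WR: "W \<bullet> R = 0" "W' \<bullet> S = 0" 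
    using inv[OF WL, of Y W] inv[OF W'(1), of Y W'] by (simp_all add: R_def S_def inner_commute)
  have "W' \<bullet> R = 0" using inv[OF WL, of Y W'] XW(3) YX by (simp add: R_def inner_commute)
  moreover have "W \<bullet> S = 0" using inv[OF W'(1), of Y W] XW(3) YX lie_bracket_skew[of W' W] by (simp add: S_def inner_commute)
  ultimately have "P3 \<bullet> X = 0" "Q3 \<bullet> X = 0"
    using inv[OF RSL(1), of W X] inv[OF RSL(2), of W X] inv[OF RSL(1), of W' X] inv[OF RSL(2), of W' X] WR
      lie_bracket_skew[of R X] lie_bracket_skew[of S X] XR
    by (simp_all add: P3_def Q3_def inner_diff_left inner_add_left)
  then have PQ30: "P3 = 0" "Q3 = 0" using centr0 PQ3L XP3 by auto
  have wy: "lie_bracket W Y = - R" "lie_bracket W' Y = - S" "lie_bracket W Y' = S" "lie_bracket W' Y' = - R"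
    using up lie_bracket_skew[of W Y] lie_bracket_skew[of W' Y] lie_bracket_skew[of W Y'] lie_bracket_skew[of W' Y']
    by (simp_all add: R_def S_def)
  have "lie_bracket W' S = lie_bracket W R" "lie_bracket W' R = - lie_bracket W S"
    using PQ30 by (auto simp: P3_def Q3_def eq_neg_iff_add_eq_0)
  then have "b = 2 * a"
    using a b Y' by (intro sl2_weight_half[OF XW XY(1,2)]) (simp_all add: wy)
  then show False using ab a by simp
qed

section \<open>Quaternionic reflections\<close>

lemma span_orthonormal_expansion:
  fixes B :: "'a::euclidean_space set"
  assumes "finite B" "pairwise orthogonal B" "\<And>b. b \<in> B \<Longrightarrow> norm b = 1" "x \<in> span B"
  shows "(\<Sum>b\<in>B. (b \<bullet> x) *\<^sub>R b) = x"
  using assms(4)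
proof (induction rule: span_induct_alt)
  case (step c b y)
  have "(\<Sum>b'\<in>B. (b' \<bullet> b) *\<^sub>R b') = b"
  proof -
    have "(\<Sum>b'\<in>B. (b' \<bullet> b) *\<^sub>R b') = (\<Sum>b'\<in>B. if b' = b then b else 0)"
      using assms(2,3) step(1) by (intro sum.cong) (auto simp: pairwise_def orthogonal_def norm_eq_1)
    then show ?thesis using step(1) assms(1) by simp
  qed
  then show ?case using step(2)
    by (simp add: inner_add_right scaleR_add_left sum.distrib flip: scaleR_scaleR scaleR_sum_right)
qed simp

lemma orthogonal_projection_matrix:
  fixes W :: "(real^'n) set"
  assumes "subspace W"
  obtains P :: "real^'n^'n" where "transpose P = P" "\<And>w. w \<in> W \<Longrightarrow> P *v w = w"
    "\<And>y. y \<in> orthogonal_comp W \<Longrightarrow> P *v y = 0" "trace P = real (dim W)" "\<And>x. P *v x \<in> W"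
proof -
  obtain B where B: "B \<subseteq> W" "pairwise orthogonal B" "\<And>b. b \<in> B \<Longrightarrow> norm b = 1" "card B = dim W" "span B = W" "independent B"
    using orthonormal_basis_subspace[OF assms] by metis
  have fin: "finite B" using B(6) by (simp add: independent_imp_finite)
  define P :: "real^'n^'n" where "P = (\<chi> i j. \<Sum>b\<in>B. b $ i * b $ j)"
  have Pv: "P *v x = (\<Sum>b\<in>B. (b \<bullet> x) *\<^sub>R b)" for x
    by (simp add: P_def vec_eq_iff matrix_vector_mult_def inner_vec_def sum_distrib_left sum_distrib_right mult.commute mult.left_commute)
      (subst sum.swap, simp add: mult.commute mult.left_commute)
  have "transpose P = P" by (simp add: P_def transpose_def vec_eq_iff mult.commute)
  moreover have "P *v w = w" if "w \<in> W" for w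
    unfolding Pv using that B fin by (intro span_orthonormal_expansion) auto
  moreover have "P *v y = 0" if "y \<in> orthogonal_comp W" for y
    unfolding Pv using that B by (intro sum.neutral) (auto simp: orthogonal_comp_def orthogonal_def)
  moreover have "trace P = real (dim W)"
  proof -
    have "trace P = (\<Sum>b\<in>B. b \<bullet> b)" by (simp add: trace_def P_def inner_vec_def) (rule sum.swap)
    also have "\<dots> = (\<Sum>b\<in>B. 1)" using B(3) by (intro sum.cong) (auto simp: norm_eq_1)
    finally show ?thesis using B by simp
  qed
  moreover have "P *v x \<in> W" for x
    unfolding Pv using B assms by (intro subspace_sum) (auto simp: subspace_scale)
  ultimately show ?thesis using that by blast
qed

lemma subspace_orthogonal_decomp:
  fixes W :: "'a::euclidean_space set"
  assumes "subspace W"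
  obtains w y where "w \<in> W" "y \<in> orthogonal_comp W" "x = w + y"
proof -
  obtain w y where wy: "w \<in> span W" "\<And>u. u \<in> span W \<Longrightarrow> orthogonal y u" "x = w + y"
    using orthogonal_subspace_decomp_exists[of W x] by metis
  have "w \<in> W" using wy(1) assms by (simp add: span_eq_iff[THEN iffD2])
  moreover have "y \<in> orthogonal_comp W"
    using wy(2)[OF span_base] by (simp add: orthogonal_comp_def orthogonal_def inner_commute)
  ultimately show ?thesis using that wy(3) by blast
qed

lemma matrix_eqI_decomp:
  fixes A B :: "real^'n^'m"
  assumes "subspace W" "\<And>w. w \<in> W \<Longrightarrow> A *v w = B *v w" "\<And>y. y \<in> orthogonal_comp W \<Longrightarrow> A *v y = B *v y"
  shows "A = B"
proof -
  have "A *v x = B *v x" for x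
    by (rule subspace_orthogonal_decomp[OF assms(1), of x]) (simp add: matrix_vector_right_distrib assms)
  then show ?thesis by (simp add: matrix_eq)
qed

lemma orthogonal_compD:
  "y \<in> orthogonal_comp W \<Longrightarrow> w \<in> W \<Longrightarrow> y \<bullet> w = 0"
  "y \<in> orthogonal_comp W \<Longrightarrow> w \<in> W \<Longrightarrow> w \<bullet> y = 0"
  by (auto simp: orthogonal_comp_def orthogonal_def inner_commute)

text \<open>Resolves the definite description: two decompositions differ by a vector of
  \<open>H\<close> that is orthogonal to \<open>H\<close>.\<close>

lemma quat_reflection_eq:
  assumes "subspace H" "h \<in> H" "y \<in> orthogonal_comp H"
  shows "quat_reflection H (h + y) = h - y"
  unfolding quat_reflection_def
proof (rule the_equality)
  show "\<exists>h'\<in>H. \<exists>y'\<in>orthogonal_comp H. h + y = h' + y' \<and> h - y = h' - y'" using assms by blast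
next
  fix z assume "\<exists>h'\<in>H. \<exists>y'\<in>orthogonal_comp H. h + y = h' + y' \<and> z = h' - y'"
  then obtain h' y' where *: "h' \<in> H" "y' \<in> orthogonal_comp H" "h + y = h' + y'" "z = h' - y'" by blast
  have "h - h' \<in> H" "y' - y \<in> orthogonal_comp H" "h - h' = y' - y"
    using assms * subspace_orthogonal_comp[of H] by (auto simp: subspace_diff algebra_simps)
  then have "(h - h') \<bullet> (h - h') = 0" using orthogonal_compD by metis
  then show "z = h - y" using * by simp
qed

text \<open>\<open>W\<close> is the imaginary part of the context \<open>H\<close>. Since
  \<open>H\<close> contains the scalars it splits as the product of the reals and \<open>W\<close>,
  and the isomorphism with the quaternions gives \<open>dim H = 4\<close>.\<close>

lemma reflection_subspace:
  assumes "T \<in> reflections"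
  obtains W where "subspace W" "dim W = 3" "\<And>u v. u \<in> W \<Longrightarrow> v \<in> W \<Longrightarrow> cross7 u v \<in> W"
    "\<And>w. w \<in> W \<Longrightarrow> T *v w = w" "\<And>y. y \<in> orthogonal_comp W \<Longrightarrow> T *v y = - y"
proof -
  obtain H where H: "quaternionic_context H" "acts_on_Im (quat_reflection H) T"
    using assms by (auto simp: reflections_def)
  then obtain f :: "quat \<Rightarrow> octo" where sub: "subspace H" and one: "oone \<in> H"
    and mult: "\<And>x y. x \<in> H \<Longrightarrow> y \<in> H \<Longrightarrow> omult x y \<in> H" and f: "linear f" "bij_betw f UNIV H"
    by (auto simp: quaternionic_context_def)
  define W where "W = {v. (0, v) \<in> H}"
  have Re: "(a, 0) \<in> H" for a using subspace_scale[OF sub one, of a] by (simp add: oone_def)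
  have iff: "(a, v) \<in> H \<longleftrightarrow> v \<in> W" for a v
    using subspace_add[OF sub Re[of "-a"], of "(a, v)"] subspace_add[OF sub Re[of a], of "(0, v)"] by (auto simp: W_def)
  have HW: "H = UNIV \<times> W" using iff by auto
  have W: "subspace W"
    using sub by (auto simp: W_def subspace_def zero_prod_def) (metis add_0 add_Pair, metis scale_zero_right scaleR_Pair)
  have "dim H = dim (UNIV :: quat set)"
    using f dim_image_eq[of f UNIV] by (simp add: bij_betw_def inj_on_def)
  then have "dim H = 4" by simp
  then have dimW: "dim W = 3" using W by (simp add: HW dim_Times)
  have T: "quat_reflection H (0, v) = (0, T *v v)" for v using H by (simp add: acts_on_Im_def)
  have Hperp: "(0, y) \<in> orthogonal_comp H" if "y \<in> orthogonal_comp W" for y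
    using that by (auto simp: HW orthogonal_comp_def orthogonal_def)
  show ?thesis
  proof
    show "subspace W" "dim W = 3" by fact+
    show "cross7 u v \<in> W" if "u \<in> W" "v \<in> W" for u v
      using mult[of "(0,u)" "(0,v)"] that by (simp add: omult_Im iff)
    show "T *v w = w" if "w \<in> W" for w
      using quat_reflection_eq[OF sub _ subspace_0[OF subspace_orthogonal_comp], of "(0,w)"] that T[of w] by (simp add: iff)
    show "T *v y = - y" if "y \<in> orthogonal_comp W" for y
      using quat_reflection_eq[OF sub subspace_0[OF sub] Hperp[OF that]] T[of y] by simp
  qed
qed

lemma dim_orthogonal_comp: 
  fixes W :: "'a::euclidean_space set" 
  assumes "subspace W" shows "dim (orthogonal_comp W) + dim W = DIM('a)"
proof -
  have "{y \<in> UNIV. \<forall>x\<in>W. orthogonal x y} = orthogonal_comp W" by (auto simp: orthogonal_comp_def)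
  then show ?thesis using dim_subspace_orthogonal_to_vectors[OF assms subspace_UNIV] by simp
qed

text \<open>For \<open>y \<noteq> 0\<close> multiplication by \<open>y\<close> maps \<open>W\<close>
  injectively into the four-dimensional complement, and its image with \<open>y\<close> spans that
  complement. So \<open>z = t y + cross7 y w\<close> with \<open>w\<close> in \<open>W\<close>, and
  \<open>cross7_double\<close> turns \<open>cross7 y z\<close> into a multiple of
  \<open>w\<close>.\<close>

lemma perp_cross_perp:
  assumes W: "subspace W" "dim W = 3" and cl: "\<And>u v. u \<in> W \<Longrightarrow> v \<in> W \<Longrightarrow> cross7 u v \<in> W"
    and y: "y \<in> orthogonal_comp W" and z: "z \<in> orthogonal_comp W"
  shows "cross7 y z \<in> W"
proof (cases "y = 0")
  case True then show ?thesis using W by (simp add: subspace_0)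
next
  case False
  define U where "U = orthogonal_comp W"
  have U: "subspace U" "dim U = 4"
    using dim_orthogonal_comp[OF W(1)] W(2) by (simp_all add: U_def subspace_orthogonal_comp)
  have yW: "cross7 y w \<in> U" if "w \<in> W" for w
  proof -
    have "w' \<bullet> cross7 y w = 0" if "w' \<in> W" for w'
      using cross7_triple[of y w w'] orthogonal_compD(1)[OF y cl[OF \<open>w \<in> W\<close> that]] by (simp add: inner_commute)
    then show ?thesis by (auto simp: U_def orthogonal_comp_def orthogonal_def)
  qed
  have lin: "linear (cross7 y)" using bilinear_cross7 by (simp add: bilinear_def)
  have inj: "inj_on (cross7 y) W"
  proof (rule linear_inj_on_iff_eq_0[OF lin W(1), THEN iffD2], intro ballI impI)
    fix w assume "w \<in> W" "cross7 y w = 0"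
    then have "(y \<bullet> y) *\<^sub>R w = 0" using cross7_double[of y w] orthogonal_compD(1)[OF y, of w] by simp
    then show "w = 0" using False by simp
  qed
  define K where "K = cross7 y ` W"
  have K: "subspace K" "dim K = 3"
    using W lin inj dim_image_eq[OF lin, of W] by (auto simp: K_def linear_subspace_image span_eq_iff[THEN iffD2])
  have "z \<in> span (insert y K)"
  proof -
    have "y \<notin> span K"
    proof
      assume "y \<in> span K"
      then obtain w where "y = cross7 y w" using K(1) by (auto simp: span_eq_iff[THEN iffD2] K_def)
      then have "y \<bullet> y = 0" by (metis cross7_orth(1))
      then show False using False by simp
    qed
    then have "dim (insert y K) = 4" using K by (simp add: dim_insert)
    moreover have "insert y K \<subseteq> U" using y yW by (auto simp: K_def U_def)
    ultimately have "span (insert y K) = U"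
      using U by (metis dim_span dim_eq_span span_eq_iff order_refl)
    then show ?thesis using z by (simp add: U_def)
  qed
  then obtain t k where "z = t *\<^sub>R y + k" "k \<in> K" using K(1)
    by (auto simp: span_insert span_eq_iff[THEN iffD2]) (metis add.commute diff_add_cancel)
  then obtain w where w: "w \<in> W" "z = t *\<^sub>R y + cross7 y w" by (auto simp: K_def)
  have "cross7 y z = - ((y \<bullet> y) *\<^sub>R w)"
    using orthogonal_compD(1)[OF y w(1)] by (simp add: w(2) cross7_linear cross7_double)
  then show ?thesis using w W by (simp add: subspace_neg subspace_scale)
qed

text \<open>\<open>T = 2 P - 1\<close> for the projection \<open>P\<close> onto \<open>W\<close>.
  The cross product is preserved because \<open>W\<close> and its complement grade it modulo 2:
  products of two elements of the same part lie in \<open>W\<close>, mixed products in the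
  complement.\<close>

theorem reflection_props:
  assumes "T \<in> reflections"
  shows "transpose T = T" "T ** T = mat 1" "trace T = -1" "preserves_cross T" "orthogonal_matrix T"
proof -
  obtain W where W: "subspace W" "dim W = 3" and cl: "\<And>u v. u \<in> W \<Longrightarrow> v \<in> W \<Longrightarrow> cross7 u v \<in> W"
    and Tw: "\<And>w. w \<in> W \<Longrightarrow> T *v w = w" and Ty: "\<And>y. y \<in> orthogonal_comp W \<Longrightarrow> T *v y = - y"
    using reflection_subspace[OF assms] by metis
  obtain P where P: "transpose P = P" "\<And>w. w \<in> W \<Longrightarrow> P *v w = w"
    "\<And>y. y \<in> orthogonal_comp W \<Longrightarrow> P *v y = 0" "trace P = real (dim W)"
    using orthogonal_projection_matrix[OF W(1)] by metis
  have TP: "T = P + P - mat 1"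
    by (rule matrix_eqI_decomp[OF W(1)]; unfold matrix_vector_mult_diff_rdistrib matrix_vector_mult_add_rdistrib)
      (simp_all add: Tw Ty P)
  have tr: "trace (mat 1 :: real^7^7) = 7" by (simp add: trace_def mat_def)
  show sym: "transpose T = T" unfolding TP transpose_diff transpose_add transpose_mat P(1) ..
  show sq: "T ** T = mat 1"
    by (rule matrix_eqI_decomp[OF W(1)]) (auto simp: Tw Ty simp flip: matrix_vector_mul_assoc)
  show "trace T = -1" using P(4) W(2) unfolding TP trace_sub trace_add tr by simp
  show "orthogonal_matrix T" by (simp add: orthogonal_matrix_def sym sq)
  have WU: "cross7 w y \<in> orthogonal_comp W" if "w \<in> W" "y \<in> orthogonal_comp W" for w y
  proof -
    have "cross7 w y \<bullet> w' = 0" if "w' \<in> W" for w'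
      using cross7_triple[of w' w y] orthogonal_compD(2)[OF \<open>y \<in> _\<close> cl[OF that \<open>w \<in> W\<close>]] by (simp add: inner_commute)
    then show ?thesis by (auto simp: orthogonal_comp_def orthogonal_def inner_commute)
  qed
  have 1: "T *v cross7 w v = cross7 w (T *v v)" if "w \<in> W" for w v
    by (rule subspace_orthogonal_decomp[OF W(1), of v])
      (simp add: that cross7_linear matrix_vector_right_distrib Tw Ty cl WU)
  have 2: "T *v cross7 y v = - cross7 y (T *v v)" if y: "y \<in> orthogonal_comp W" for y v
  proof (rule subspace_orthogonal_decomp[OF W(1), of v])
    fix w z assume wz: "w \<in> W" "z \<in> orthogonal_comp W" "v = w + z"
    have "cross7 y w \<in> orthogonal_comp W"
      using WU[OF wz(1) y] cross7_skew[of y w] subspace_orthogonal_comp[of W] by (simp add: subspace_neg)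
    then show ?thesis using perp_cross_perp[OF W cl y wz(2)]
      by (simp add: wz cross7_linear matrix_vector_right_distrib Tw Ty)
  qed
  show "preserves_cross T" unfolding preserves_cross_def
  proof (intro allI)
    show "T *v cross7 u v = cross7 (T *v u) (T *v v)" for u v
      by (rule subspace_orthogonal_decomp[OF W(1), of u])
        (simp add: cross7_linear matrix_vector_right_distrib Tw Ty 1 2)
  qed
qed

section \<open>The Gram determinant\<close>

lemma sum_UNIV_funs:
  "(\<Sum>J\<in>(UNIV::('n::finite \<Rightarrow> 'u::finite) set). \<Prod>k\<in>UNIV. f k (J k)) = (\<Prod>k\<in>UNIV. \<Sum>a\<in>UNIV. (f k a :: real))"
  using prod_sum_PiE[of "UNIV::'n set" "\<lambda>_. UNIV :: 'u set" f] by (simp add: PiE_UNIV_domain)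

text \<open>Cauchy-Binet with the minors indexed by all functions instead of subsets, hence the factorial.\<close>

lemma cauchy_binet_functions:
  fixes x y :: "'n::finite \<Rightarrow> 'u::finite \<Rightarrow> real"
  shows "(\<Sum>J\<in>UNIV. det (\<chi> k i. x i (J k)) * det (\<chi> k i. y i (J k)))
    = fact CARD('n) * det (\<chi> i j. \<Sum>a\<in>UNIV. x i a * y j a)"
proof -
  let ?P = "{p. p permutes (UNIV::'n set)}"
  define s :: "('n \<Rightarrow> 'n) \<Rightarrow> real" where "s p = of_int (sign p)" for p
  define G :: "real^'n^'n" where "G = (\<chi> i j. \<Sum>a\<in>UNIV. x i a * y j a)"
  have "(\<Sum>J\<in>UNIV. det (\<chi> k i. x i (J k)) * det (\<chi> k i. y i (J k)))
      = (\<Sum>J\<in>UNIV. \<Sum>p\<in>?P. \<Sum>q\<in>?P. s p * s q * (\<Prod>k\<in>UNIV. x (p k) (J k) * y (q k) (J k)))"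
    unfolding det_def sum_product prod.distrib s_def vec_lambda_beta
    by (intro sum.cong refl) (simp only: mult_ac)
  also have "\<dots> = (\<Sum>p\<in>?P. \<Sum>q\<in>?P. \<Sum>J\<in>UNIV. s p * s q * (\<Prod>k\<in>UNIV. x (p k) (J k) * y (q k) (J k)))"
    by (subst sum.swap) (intro sum.cong refl sum.swap)
  also have "\<dots> = (\<Sum>p\<in>?P. s p * (\<Sum>q\<in>?P. s q * (\<Prod>k\<in>UNIV. G $ (p k) $ (q k))))"
    by (simp add: sum_distrib_left[symmetric] sum_UNIV_funs[of "\<lambda>k a. x (p k) a * y (q k) a" for p q] G_def mult.assoc)
  also have "\<dots> = (\<Sum>p\<in>?P. s p * det (\<chi> k. G $ p k))"
    by (simp add: det_def s_def)
  also have "\<dots> = (\<Sum>p\<in>?P. det G)"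
  proof (intro sum.cong refl)
    fix p assume "p \<in> ?P"
    then have "det (\<chi> k. G $ p k) = s p * det G" by (simp add: det_permute_rows s_def)
    moreover have "s p * s p = 1" by (simp add: s_def sign_def)
    ultimately show "s p * det (\<chi> k. G $ p k) = det G" by (simp add: mult.assoc[symmetric])
  qed
  also have "\<dots> = fact CARD('n) * det G" by (simp add: card_permutations)
  finally show ?thesis by (simp add: G_def)
qed

definition unit_matrix :: "7 \<times> 7 \<Rightarrow> real^7^7" where
  "unit_matrix a = (\<chi> i j. if (i, j) = a then 1 else 0)"

text \<open>The orthogonal projection onto \<open>E_space T\<close> when \<open>T\<close> is
  \<open>reflection_like\<close>: symmetrise, average over conjugation by \<open>T\<close> (hence
  1/4), remove the trace. As an explicit formula it is polynomial in \<open>T\<close>.\<close>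

definition E_proj :: "real^7^7 \<Rightarrow> real^7^7 \<Rightarrow> real^7^7" where
  "E_proj T M = (1/4) *\<^sub>R (M + transpose M + T ** (M + transpose M) ** T) - (trace M / 7) *\<^sub>R mat 1"

text \<open>The properties of a reflection that the Gram determinant depends on. The value of the
  trace is what fixes the dimension 15.\<close>

definition reflection_like :: "real^7^7 \<Rightarrow> bool" where
  "reflection_like T \<longleftrightarrow> transpose T = T \<and> T ** T = mat 1 \<and> trace T = -1"

lemma inner_unit_matrix: "M \<bullet> unit_matrix a = M $ fst a $ snd a"
proof -
  have "M \<bullet> unit_matrix a = (\<Sum>i\<in>UNIV. \<Sum>j\<in>UNIV. if i = fst a then if j = snd a then M $ i $ j else 0 else 0)"
    unfolding inner_matrix by (intro sum.cong refl) (auto simp: unit_matrix_def)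
  also have "\<dots> = (\<Sum>i\<in>UNIV. if i = fst a then (\<Sum>j\<in>UNIV. if j = snd a then M $ i $ j else 0) else 0)"
    by (intro sum.cong refl) auto
  finally show ?thesis by simp
qed

lemma trace_scaleR: "trace (c *\<^sub>R A) = c * trace (A :: real^'n^'n)"
  by (simp add: trace_def sum_distrib_left)

lemma trace_mat1: "trace (mat c :: real^'n^'n) = real CARD('n) * c"
  by (simp add: trace_def mat_def)

lemma transpose_scaleR: "transpose (c *\<^sub>R A) = c *\<^sub>R transpose (A :: real^'n^'m)"
  by (simp add: transpose_def vec_eq_iff)

lemma trace_transpose: "trace (transpose A) = trace A"
  by (simp add: trace_def transpose_def)

lemma subspace_E_space: "subspace (E_space T)"
  by (auto simp: subspace_def E_space_def transpose_add trace_add matrix_mul_linear transpose_scaleR trace_scaleR)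
    (simp_all add: trace_def transpose_def vec_eq_iff)

lemma trace_conj_involution: "T ** T = mat 1 \<Longrightarrow> trace (T ** M ** T) = trace (M :: real^'n^'n)"
  using trace_mul_sym[of "T ** M" T] by (simp add: matrix_mul_assoc)

context
  fixes T assumes T: "reflection_like T"
begin

lemma involution_props: "transpose T = T" "T ** T = mat 1" "trace T = -1"
  using T by (auto simp: reflection_like_def)

lemma involution_cancel: "T ** (T ** M) = M" "M ** T ** T = M"
  using involution_props(2) by (simp_all add: matrix_mul_assoc, simp flip: matrix_mul_assoc)

lemma E_proj_in: "E_proj T M \<in> E_space T"
proof -
  have "transpose (E_proj T M) = E_proj T M"
    unfolding E_proj_def transpose_diff transpose_scaleR transpose_add matrix_transpose_mul involution_props transpose_mat transpose_transpose
      matrix_mul_assoc matrix_mul_linear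
    by (simp add: algebra_simps)
  moreover have "trace (E_proj T M) = 0"
    unfolding E_proj_def trace_sub trace_scaleR trace_add trace_mat1 trace_conj_involution[OF involution_props(2)] trace_transpose by simp
  moreover have "T ** E_proj T M ** T = E_proj T M"
    unfolding E_proj_def matrix_mul_linear matrix_mul_simps
    by (simp add: matrix_mul_assoc involution_props involution_cancel algebra_simps)
  ultimately show ?thesis by (simp add: E_space_def)
qed

text \<open>With \<open>E_proj_in\<close> this characterises \<open>E_proj T\<close> as the
  orthogonal projection onto \<open>E_space T\<close>.\<close>

lemma inner_E_proj: assumes "Q \<in> E_space T" shows "Q \<bullet> E_proj T M = Q \<bullet> M"
proof -
  have Q: "transpose Q = Q" "trace Q = 0" "T ** Q ** T = Q" using assms by (auto simp: E_space_def)
  have t: "Q \<bullet> transpose M' = Q \<bullet> M'" for M'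
    unfolding inner_eq_trace Q using trace_mul_sym[of Q "transpose M'"] trace_transpose[of "transpose M' ** Q"]
    by (simp add: matrix_transpose_mul Q)
  have c: "Q \<bullet> (T ** M' ** T) = Q \<bullet> M'" for M'
  proof -
    have "trace (Q ** (T ** M' ** T)) = trace (T ** (Q ** T ** M'))"
      using trace_mul_sym[of "Q ** T ** M'" T] by (simp add: matrix_mul_assoc)
    then show ?thesis unfolding inner_eq_trace Q by (simp add: matrix_mul_assoc Q)
  qed
  have "Q \<bullet> mat 1 = 0" by (simp add: inner_eq_trace Q)
  then show ?thesis by (simp add: E_proj_def inner_diff_right inner_add_right c t)
qed

lemma E_proj_unit: "E_proj T (unit_matrix (i,j)) $ i $ j =
  (1 + (if i = j then 1 else 0) + T $ i $ i * T $ j $ j + T $ i $ j * T $ i $ j) / 4 - (if i = j then 1 / 7 else 0)"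
proof -
  have mul: "(A ** unit_matrix (i,j) ** B) $ k $ l = A $ k $ i * B $ j $ l" for A B :: "real^7^7" and i j k l
  proof -
    have 1: "(A ** unit_matrix (i,j)) $ k $ m = (if m = j then A $ k $ i else 0)" for m
      by (simp add: matrix_matrix_mult_def unit_matrix_def if_distrib cong: if_cong)
    show ?thesis unfolding matrix_matrix_mult_def[of _ B] by (simp add: 1 if_distribR if_distrib[of "\<lambda>x. x * _"] cong: if_cong)
  qed
  have t: "transpose (unit_matrix (i,j)) = unit_matrix (j,i)" by (auto simp: transpose_def unit_matrix_def vec_eq_iff)
  have "T $ j $ i = T $ i $ j" using involution_props(1) by (simp add: transpose_def vec_eq_iff)
  moreover have "trace (unit_matrix (i,j)) = (if i = j then 1 else 0)"
    by (auto simp: trace_def unit_matrix_def intro!: sum.neutral)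
  ultimately show ?thesis
    by (simp add: E_proj_def t matrix_mul_linear mul) (simp add: unit_matrix_def mat_def)
qed

text \<open>The dimension is the trace of the orthogonal projection, that is, the sum of the
  diagonal coefficients \<open>E_proj T (unit_matrix (i,j)) $ i $ j\<close>.\<close>

lemma dim_E_space: "dim (E_space T) = 15"
proof -
  obtain B where B: "B \<subseteq> E_space T" "pairwise orthogonal B" "\<And>b. b \<in> B \<Longrightarrow> norm b = 1"
    "card B = dim (E_space T)" "span B = E_space T" "independent B"
    using orthonormal_basis_subspace[OF subspace_E_space[of T]] by metis
  have fin: "finite B" using B(6) by (simp add: independent_imp_finite)
  have "real (card B) = (\<Sum>b\<in>B. b \<bullet> b)" using B(3) by (simp add: norm_eq_1)
  also have "\<dots> = (\<Sum>i\<in>UNIV. \<Sum>j\<in>UNIV. \<Sum>b\<in>B. b $ i $ j * b $ i $ j)"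
    unfolding inner_matrix by (subst sum.swap) (intro sum.cong refl sum.swap)
  also have "\<dots> = (\<Sum>i\<in>UNIV. \<Sum>j\<in>UNIV. E_proj T (unit_matrix (i,j)) $ i $ j)"
  proof (intro sum.cong refl)
    fix i j :: 7
    have "E_proj T (unit_matrix (i,j)) = (\<Sum>b\<in>B. (b \<bullet> E_proj T (unit_matrix (i,j))) *\<^sub>R b)"
      using E_proj_in B fin by (intro span_orthonormal_expansion[symmetric]) auto
    also have "\<dots> = (\<Sum>b\<in>B. (b $ i $ j) *\<^sub>R b)"
      using B(1) by (intro sum.cong refl) (auto simp: inner_E_proj inner_unit_matrix)
    finally show "(\<Sum>b\<in>B. b $ i $ j * b $ i $ j) = E_proj T (unit_matrix (i,j)) $ i $ j" by simp
  qed
  \<comment> \<open>49 index pairs, 7 of them diagonal, then \<open>(trace T)^2 = 1\<close> and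
    \<open>T \<bullet> T = 7\<close>; the 1 subtracted is seven times 1/7. Altogether
    \<open>64/4 - 1\<close>.\<close>
  also have "\<dots> = (49 + 7 + (trace T)\<^sup>2 + T \<bullet> T) / 4 - 1"
    unfolding E_proj_unit trace_def power2_eq_square sum_product inner_matrix
    by (simp add: sum.distrib sum_subtractf flip: sum_divide_distrib)
  also have "\<dots> = 15" by (simp add: inner_eq_trace involution_props trace_mat1)
  finally show ?thesis using B by simp
qed

lemma frob_onb_exists: "\<exists>Q. frob_onb Q (E_space T)"
proof -
  obtain B where B: "B \<subseteq> E_space T" "pairwise orthogonal B" "\<And>b. b \<in> B \<Longrightarrow> norm b = 1"
    "card B = dim (E_space T)" "span B = E_space T" "independent B"
    using orthonormal_basis_subspace[OF subspace_E_space[of T]] by metis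
  have fin: "finite B" using B(6) by (simp add: independent_imp_finite)
  then obtain Q where Q: "bij_betw Q (UNIV :: 15 set) B"
    using finite_same_card_bij[of "UNIV :: 15 set" B] B dim_E_space by auto
  have "frob (Q i) (Q j) = (if i = j then 1 else 0)" for i j
  proof -
    have "Q i \<in> B" "Q j \<in> B" "Q i = Q j \<longleftrightarrow> i = j" using Q by (auto simp: bij_betw_def inj_eq)
    then show ?thesis using B(2,3) by (auto simp: frob_eq_inner pairwise_def orthogonal_def norm_eq_1)
  qed
  moreover have "range Q = B" using Q by (simp add: bij_betw_def)
  ultimately show ?thesis using B(5) unfolding frob_onb_def by blast
qed

end

lemma onb_expansion:
  assumes "frob_onb Q E" "x \<in> E"
  shows "(\<Sum>i\<in>UNIV. (Q i \<bullet> x) *\<^sub>R Q i) = x"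
proof -
  have ip: "Q i \<bullet> Q j = (if i = j then 1 else 0)" for i j using assms by (simp add: frob_onb_def frob_eq_inner)
  then have inj: "inj Q" by (metis injI zero_neq_one)
  have "(\<Sum>b\<in>range Q. (b \<bullet> x) *\<^sub>R b) = x"
    by (rule span_orthonormal_expansion)
      (use assms in \<open>auto simp: frob_onb_def frob_eq_inner pairwise_def orthogonal_def norm_eq_1\<close>)
  then show ?thesis by (simp add: sum.reindex[OF inj])
qed

definition gram :: "real^7^7 \<Rightarrow> (15 \<Rightarrow> real^7^7) \<Rightarrow> real^15^15" where
  "gram Z Q = (\<chi> i j. lie_bracket Z (Q i) \<bullet> lie_bracket Z (Q j))"

text \<open>The matrices under the determinant are the principal submatrices of \<open>(ad Z)\<^sup>T (ad Z)\<close> compressed to \<open>E_T\<close>, in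
  the coordinates of all \<open>7 \<times> 7\<close> matrices.  No basis of \<open>E_T\<close> is chosen, so the entries are polynomial in \<open>T\<close>.\<close>

definition R30_poly :: "real^7^7 \<Rightarrow> real^7^7 \<Rightarrow> real" where
  "R30_poly T Z = (\<Sum>J\<in>(UNIV::(15 \<Rightarrow> 7 \<times> 7) set). det ((\<chi> k l.
     lie_bracket Z (E_proj T (unit_matrix (J k))) \<bullet> lie_bracket Z (E_proj T (unit_matrix (J l)))) :: real^15^15)) / fact 15"

lemma lie_bracket_sum: "lie_bracket Z (\<Sum>i\<in>I. f i) = (\<Sum>i\<in>I. lie_bracket Z (f i :: real^'n^'n))"
  by (induction I rule: infinite_finite_induct) (simp_all add: lie_bracket_linear)

lemma inner_matrix_pairs: "(A::real^'n^'m) \<bullet> B = (\<Sum>a\<in>UNIV. A $ fst a $ snd a * B $ fst a $ snd a)"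
  unfolding inner_matrix sum.cartesian_product UNIV_Times_UNIV by (simp add: case_prod_beta)

text \<open>Expanding the projected unit matrices in \<open>Q\<close> turns each summand into the
  determinant of \<open>A J ** gram Z Q ** transpose (A J)\<close>. Orthonormality of
  \<open>Q\<close> and \<open>cauchy_binet_functions\<close> give the squares of
  \<open>det (A J)\<close> the sum \<open>15!\<close>, which the denominator cancels.\<close>

lemma det_gram_eq_poly:
  assumes T: "reflection_like T" and Q: "frob_onb Q (E_space T)"
  shows "det (gram Z Q) = R30_poly T Z"
proof -
  define A :: "(15 \<Rightarrow> 7 \<times> 7) \<Rightarrow> real^15^15" where "A J = (\<chi> k i. Q i $ fst (J k) $ snd (J k))" for J
  have QE: "Q i \<in> E_space T" for i using Q span_base[of "Q i" "range Q"] by (simp add: frob_onb_def)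
  have exp: "E_proj T (unit_matrix a) = (\<Sum>i\<in>UNIV. (Q i $ fst a $ snd a) *\<^sub>R Q i)" for a
    using onb_expansion[OF Q E_proj_in[OF T], of "unit_matrix a"]
    by (simp add: inner_E_proj[OF T QE] inner_unit_matrix)
  have "(\<chi> k l. lie_bracket Z (E_proj T (unit_matrix (J k))) \<bullet> lie_bracket Z (E_proj T (unit_matrix (J l))))
    = A J ** gram Z Q ** transpose (A J)" for J
    by (simp add: vec_eq_iff exp lie_bracket_sum inner_sum_left inner_sum_right A_def gram_def matrix_matrix_mult_def
        transpose_def sum_distrib_left sum_distrib_right mult.commute mult.left_commute)
  then have "R30_poly T Z = (\<Sum>J\<in>UNIV. det (A J) * det (A J)) * det (gram Z Q) / fact 15"
    by (simp add: R30_poly_def det_mul det_transpose sum_distrib_right mult.assoc)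
      (simp add: mult_ac)
  also have "(\<Sum>J\<in>UNIV. det (A J) * det (A J)) = fact 15"
  proof -
    have "(\<chi> i j. \<Sum>a\<in>UNIV. Q i $ fst a $ snd a * Q j $ fst a $ snd a) = (mat 1 :: real^15^15)"
      using Q by (simp add: vec_eq_iff mat_def frob_onb_def frob_eq_inner flip: inner_matrix_pairs)
    then show ?thesis
      using cauchy_binet_functions[of "\<lambda>i a. Q i $ fst a $ snd a" "\<lambda>i a. Q i $ fst a $ snd a"] by (simp add: A_def)
  qed
  finally show ?thesis by simp
qed

text \<open>The definite description has a solution because all bases give the same determinant, and
  only one because a basis exists.\<close>

lemma R30_eq_poly: assumes "reflection_like T" shows "R30 T Z = R30_poly T Z"
  unfolding R30_def
proof (rule the_equality)
  show "\<forall>Q. frob_onb Q (E_space T) \<longrightarrow> R30_poly T Z = det (\<chi> i j. frob (lie_bracket Z (Q i)) (lie_bracket Z (Q j)))"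
    using det_gram_eq_poly[OF assms] by (simp add: gram_def frob_eq_inner)
  show "r = R30_poly T Z" if "\<forall>Q. frob_onb Q (E_space T) \<longrightarrow> r = det (\<chi> i j. frob (lie_bracket Z (Q i)) (lie_bracket Z (Q j)))" for r
    using frob_onb_exists[OF assms] that det_gram_eq_poly[OF assms] by (auto simp: gram_def frob_eq_inner)
qed

lemma R30_eq_gram: "reflection_like T \<Longrightarrow> frob_onb Q (E_space T) \<Longrightarrow> R30 T Z = det (gram Z Q)"
  by (simp add: R30_eq_poly det_gram_eq_poly)

text \<open>By \<open>cauchy_binet_functions\<close>, \<open>15!\<close> times the determinant is a
  sum of squares of minors.\<close>

lemma det_gram_nonneg: "det (gram Z Q) \<ge> 0"
proof -
  have "gram Z Q = (\<chi> i j. \<Sum>a\<in>UNIV. lie_bracket Z (Q i) $ fst a $ snd a * lie_bracket Z (Q j) $ fst a $ snd a)"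
    by (simp add: gram_def vec_eq_iff inner_matrix_pairs)
  then have "fact 15 * det (gram Z Q) \<ge> 0"
    using cauchy_binet_functions[of "\<lambda>i a. lie_bracket Z (Q i) $ fst a $ snd a" "\<lambda>i a. lie_bracket Z (Q i) $ fst a $ snd a", symmetric]
    by (simp add: sum_nonneg)
  then show ?thesis using fact_gt_zero[of 15, where 'a=real] by (simp only: zero_le_mult_iff) linarith
qed

lemma R30_nonneg: "reflection_like T \<Longrightarrow> R30 T Z \<ge> 0"
  using frob_onb_exists R30_eq_gram det_gram_nonneg by metis

lemma gram_vector: "gram Z Q *v c = (\<chi> i. lie_bracket Z (Q i) \<bullet> lie_bracket Z (\<Sum>j\<in>UNIV. (c $ j) *\<^sub>R Q j))"
  by (simp add: gram_def matrix_vector_mult_def vec_eq_iff lie_bracket_sum inner_sum_right mult.commute)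

text \<open>A kernel vector \<open>c\<close> of the Gram matrix is the coordinate vector of an
  \<open>M\<close> whose bracket with \<open>Z\<close> is orthogonal to every
  \<open>[Z, Q i]\<close>, hence to itself.\<close>

lemma R30_eq_0_iff:
  assumes T: "reflection_like T"
  shows "R30 T Z = 0 \<longleftrightarrow> (\<exists>M\<in>E_space T. M \<noteq> 0 \<and> lie_bracket Z M = 0)"
proof -
  obtain Q where Q: "frob_onb Q (E_space T)" using frob_onb_exists[OF T] by blast
  have ip: "Q i \<bullet> Q j = (if i = j then 1 else 0)" for i j using Q by (simp add: frob_onb_def frob_eq_inner)
  have QE: "Q i \<in> E_space T" for i using Q span_base[of "Q i" "range Q"] by (simp add: frob_onb_def)
  have "R30 T Z = 0 \<longleftrightarrow> (\<exists>c. c \<noteq> 0 \<and> gram Z Q *v c = 0)"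
    using R30_eq_gram[OF T Q] invertible_det_nz[of "gram Z Q"] matrix_left_invertible_ker[of "gram Z Q"] invertible_left_inverse[of "gram Z Q"]
    by auto
  also have "\<dots> \<longleftrightarrow> (\<exists>M\<in>E_space T. M \<noteq> 0 \<and> lie_bracket Z M = 0)"
  proof
    assume "\<exists>c. c \<noteq> 0 \<and> gram Z Q *v c = 0"
    then obtain c where c: "c \<noteq> 0" "gram Z Q *v c = 0" by blast
    define M where "M = (\<Sum>j\<in>UNIV. (c $ j) *\<^sub>R Q j)"
    have "M \<in> E_space T" unfolding M_def using QE subspace_E_space by (intro subspace_sum) (auto simp: subspace_scale)
    have "Q i \<bullet> M = c $ i" for i by (simp add: M_def inner_sum_right ip if_distrib cong: if_cong)
    then have "M \<noteq> 0" using c(1) by (metis inner_zero_right vec_eq_iff zero_index)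
    have "lie_bracket Z (Q i) \<bullet> lie_bracket Z M = 0" for i
      using c(2) by (simp add: gram_vector M_def vec_eq_iff)
    then have "lie_bracket Z M \<bullet> lie_bracket Z M = 0"
      by (subst (1) M_def) (simp add: lie_bracket_sum inner_sum_left)
    then show "\<exists>M\<in>E_space T. M \<noteq> 0 \<and> lie_bracket Z M = 0" using \<open>M \<in> _\<close> \<open>M \<noteq> 0\<close> by auto
  next
    assume "\<exists>M\<in>E_space T. M \<noteq> 0 \<and> lie_bracket Z M = 0"
    then obtain M where M: "M \<in> E_space T" "M \<noteq> 0" "lie_bracket Z M = 0" by blast
    define c :: "real^15" where "c = (\<chi> i. Q i \<bullet> M)"
    have sumM: "(\<Sum>j\<in>UNIV. (c $ j) *\<^sub>R Q j) = M" using onb_expansion[OF Q M(1)] by (simp add: c_def)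
    have "gram Z Q *v c = 0" unfolding gram_vector sumM M(3) by (simp add: vec_eq_iff)
    moreover have "c \<noteq> 0" using sumM M(2) by auto
    ultimately
    show "\<exists>c. c \<noteq> 0 \<and> gram Z Q *v c = 0" by blast
  qed
  finally show ?thesis .
qed

lemma R30_homogeneous: assumes T: "reflection_like T" shows "R30 T (c *\<^sub>R Z) = c ^ 30 * R30 T Z"
proof -
  obtain Q where Q: "frob_onb Q (E_space T)" using frob_onb_exists[OF T] by blast
  have "gram (c *\<^sub>R Z) Q = (\<chi> i. c\<^sup>2 *s (gram Z Q $ i))"
    by (simp add: gram_def vec_eq_iff power2_eq_square)
  then have "det (gram (c *\<^sub>R Z) Q) = (c\<^sup>2) ^ 15 * det (gram Z Q)"
    using det_rows_mul[of "\<lambda>_. c\<^sup>2" "\<lambda>i. gram Z Q $ i"] by simp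
  then show ?thesis using R30_eq_gram[OF T Q] by (simp flip: power_mult)
qed

section \<open>Generated subalgebras and reducibility\<close>

lemma lie_subalgebra_Inter: "(\<And>L. L \<in> F \<Longrightarrow> lie_subalgebra L) \<Longrightarrow> lie_subalgebra (\<Inter>F)"
  by (auto simp: lie_subalgebra_def intro: subspace_Inter)

lemma lie_subalgebra_Lie_gen: "lie_subalgebra (Lie_gen U W)"
  unfolding Lie_gen_def by (rule hull_in) (auto intro: lie_subalgebra_Inter)

lemma Lie_gen_mem: "U \<in> Lie_gen U W" "W \<in> Lie_gen U W"
  unfolding Lie_gen_def by (auto intro: hull_inc)

lemma Lie_gen_minimal: "lie_subalgebra S \<Longrightarrow> U \<in> S \<Longrightarrow> W \<in> S \<Longrightarrow> Lie_gen U W \<subseteq> S"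
  unfolding Lie_gen_def by (rule hull_minimal) auto

lemma lie_subalgebraD:
  assumes "lie_subalgebra L"
  shows "subspace L" "A \<in> L \<Longrightarrow> B \<in> L \<Longrightarrow> lie_bracket A B \<in> L" "A \<in> L \<Longrightarrow> B \<in> L \<Longrightarrow> A + B \<in> L"
    "A \<in> L \<Longrightarrow> B \<in> L \<Longrightarrow> A - B \<in> L" "A \<in> L \<Longrightarrow> c *\<^sub>R A \<in> L"
  using assms by (auto simp: lie_subalgebra_def subspace_add subspace_diff subspace_scale)

lemma lie_subalgebra_centralizer: "lie_subalgebra {A. lie_bracket A M = 0}"
proof -
  have "lie_bracket (lie_bracket A B) M = 0" if "lie_bracket A M = 0" "lie_bracket B M = 0" for A B :: "real^7^7"
    using lie_bracket_jacobi[of A B M] that by simp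
  then show ?thesis by (auto simp: lie_subalgebra_def subspace_def lie_bracket_linear)
qed

lemma lie_bracket_vector: "lie_bracket A B *v x = A *v (B *v x) - B *v (A *v (x :: real^'n))"
  by (simp add: lie_bracket_def matrix_vector_mult_diff_rdistrib matrix_vector_mul_assoc)

lemma lie_subalgebra_annihilator: "lie_subalgebra {A. A *v x = 0}"
  by (auto simp: lie_subalgebra_def subspace_def matrix_vector_mult_add_rdistrib lie_bracket_vector)

lemma lie_subalgebra_g2: "lie_subalgebra g2"
proof -
  have "lie_bracket A B \<in> g2" if "A \<in> g2" "B \<in> g2" for A B
    using that unfolding g2_iff derives_cross_def
    by (simp add: lie_bracket_vector matrix_vector_right_distrib cross7_linear)
      (simp add: lie_bracket_def transpose_diff matrix_transpose_mul)
  moreover have "subspace g2"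
    by (auto simp: subspace_def g2_iff derives_cross_def transpose_add transpose_scaleR matrix_vector_mult_add_rdistrib
        cross7_linear algebra_simps) (simp add: transpose_def vec_eq_iff)
  ultimately show ?thesis by (simp add: lie_subalgebra_def)
qed

lemma g2_skew: "A \<in> g2 \<Longrightarrow> transpose A = - A"
  by (simp add: g2_iff)

lemma orthogonal_conj_g2:
  assumes g: "orthogonal_matrix g" "preserves_cross g" and A: "A \<in> g2"
  shows "g ** A ** transpose g \<in> g2"
proof -
  have inv: "g *v (transpose g *v v) = v" for v
    using g by (simp add: orthogonal_matrix_def matrix_vector_mul_assoc)
  have gt: "transpose g *v cross7 u v = cross7 (transpose g *v u) (transpose g *v v)" for u v
  proof -
    have "g *v cross7 (transpose g *v u) (transpose g *v v) = cross7 u v" using g by (simp add: preserves_cross_def inv)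
    then show ?thesis using g by (metis orthogonal_matrix_def matrix_vector_mul_assoc matrix_vector_mul_lid)
  qed
  have "transpose (g ** A ** transpose g) = - (g ** A ** transpose g)"
    using g2_skew[OF A] by (simp add: matrix_transpose_mul matrix_mul_assoc)
  moreover have "derives_cross (g ** A ** transpose g)"
    using A g unfolding derives_cross_def g2_iff preserves_cross_def
    by (simp add: gt inv matrix_vector_right_distrib flip: matrix_vector_mul_assoc)
  ultimately show ?thesis by (simp add: g2_iff)
qed

text \<open>The complex matrix \<open>X + i Y\<close> is antisymmetric of odd size, hence singular.\<close>

lemma odd_skew_commuting_common_kernel:
  fixes X Y :: "real^'n^'n"
  assumes odd: "odd CARD('n)" and X: "transpose X = - X" and Y: "transpose Y = - Y" and comm: "lie_bracket X Y = 0"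
  obtains v where "v \<noteq> 0" "X *v v = 0" "Y *v v = 0"
proof -
  define A :: "complex^'n^'n" where "A = (\<chi> i j. Complex (X $ i $ j) (Y $ i $ j))"
  have XY: "X $ j $ i = - X $ i $ j" "Y $ j $ i = - Y $ i $ j" for i j
    using arg_cong[OF X, of "\<lambda>M. M $ i $ j"] arg_cong[OF Y, of "\<lambda>M. M $ i $ j"] by (simp_all add: transpose_def)
  have "A $ j $ i = - A $ i $ j" for i j
    by (simp add: A_def complex_eq_iff XY(1)[of j i] XY(2)[of j i])
  then have "transpose A = (\<chi> i. (- 1) *s (A $ i))"
    unfolding transpose_def vec_eq_iff vec_lambda_beta vector_smult_component by (metis mult_minus1)
  then have "det A = (\<Prod>i\<in>(UNIV::'n set). - 1) * det A"
    using det_rows_mul[of "\<lambda>_. - 1" "\<lambda>i. A $ i"] det_transpose[of A] by simp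
  then have "det A = - det A" using odd by simp
  then have "det A = 0" by simp
  then obtain z where z: "z \<noteq> 0" "A *v z = 0"
    using invertible_det_nz[of A] matrix_left_invertible_ker[of A] invertible_left_inverse[of A] by auto
  define p where "p = (\<chi> i. Re (z $ i))"
  define q where "q = (\<chi> i. Im (z $ i))"
  have Re: "Re ((A *v z) $ i) = (X *v p - Y *v q) $ i" and Im: "Im ((A *v z) $ i) = (X *v q + Y *v p) $ i" for i
    by (simp_all add: matrix_vector_mult_def A_def p_def q_def sum_subtractf sum.distrib Re_sum Im_sum)
  have 1: "X *v p = Y *v q" using Re z(2) by (simp add: vec_eq_iff)
  have 2: "X *v q = - (Y *v p)" using Im z(2) by (simp add: vec_eq_iff eq_neg_iff_add_eq_0)
  have c: "X *v (Y *v v) = Y *v (X *v v)" for v using lie_bracket_vector[of X Y v] comm by simp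
  \<comment> \<open>The two real equations and commutation give \<open>X^2 p + Y^2 p = 0\<close>;
    pairing with \<open>p\<close> makes this a vanishing sum of two squares.\<close>
  have "X *v (X *v p) = - (Y *v (Y *v p))" by (simp add: 1 c 2)
  then have "(X *v p) \<bullet> (X *v p) + (Y *v p) \<bullet> (Y *v p) = 0"
    using skew_inner[OF X, of p "X *v p"] skew_inner[OF Y, of p "Y *v p"] by simp
  then have "X *v p = 0 \<and> Y *v p = 0"
    using inner_ge_zero[of "X *v p"] inner_ge_zero[of "Y *v p"] by (simp add: add_nonneg_eq_0_iff)
  then have zero: "X *v p = 0" "Y *v p = 0" "X *v q = 0" "Y *v q = 0" using 1 2 by auto
  have "p \<noteq> 0 \<or> q \<noteq> 0" using z(1) by (auto simp: p_def q_def vec_eq_iff complex_eq_iff)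
  then show ?thesis using that zero by blast
qed

lemma cauchy_schwarz_equality:
  fixes x y :: "'a::real_inner"
  assumes "(x \<bullet> y)\<^sup>2 = (x \<bullet> x) * (y \<bullet> y)"
  shows "(x \<bullet> x) *\<^sub>R y = (x \<bullet> y) *\<^sub>R x"
proof -
  define z where "z = (x \<bullet> x) *\<^sub>R y - (x \<bullet> y) *\<^sub>R x"
  have "z \<bullet> z = (x \<bullet> x) * ((x \<bullet> x) * (y \<bullet> y) - (x \<bullet> y)\<^sup>2)"
    by (simp add: z_def inner_diff_left inner_diff_right power2_eq_square inner_commute algebra_simps)
  then show ?thesis using assms by (simp add: z_def)
qed

lemma dim_span_singleton_less: "span {v :: real^7} \<noteq> UNIV"
proof
  assume "span {v} = UNIV"
  then have "dim (span {v}) = 7" by (simp only: dim_UNIV) simp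
  moreover have "dim (span {v}) \<le> 1" using dim_le_card[of "span {v}" "{v}"] by simp
  ultimately show False by simp
qed

lemma annihilated_vector_reducible:
  assumes "v \<noteq> 0" "\<And>A. A \<in> L \<Longrightarrow> A *v v = 0"
  shows "acts_reducibly L"
  unfolding acts_reducibly_def
proof (intro exI conjI ballI)
  show "subspace (span {v})" "span {v} \<noteq> UNIV" by (simp_all add: dim_span_singleton_less)
  show "span {v} \<noteq> {0}" using assms(1) span_base[of v "{v}"] by auto
  show "A *v w \<in> span {v}" if Aw: "A \<in> L" "w \<in> span {v}" for A w
  proof -
    obtain c where "w = c *\<^sub>R v" using Aw by (auto simp: span_singleton)
    then show ?thesis using assms(2)[OF Aw(1)] by (simp add: matrix_vector_mult_scaleR span_zero)
  qed
qed

lemma symmetric_eigenvalue: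
  fixes M :: "real^'n^'n"
  assumes "transpose M = M"
  obtains v l where "v \<noteq> 0" "M *v v = l *\<^sub>R v"
proof -
  have ne: "(UNIV :: (real^'n) set) \<noteq> {0}" using UNIV_not_singleton by auto
  obtain v l where "norm v = 1" "M *v v = l *\<^sub>R v"
    by (rule top_eigenvector[of "(*v) M" "UNIV :: (real^'n) set"])
      (use ne inner_transpose[of M] assms in auto)
  moreover from this have "v \<noteq> 0" by auto
  ultimately show ?thesis using that by blast
qed

text \<open>The eigenspace is a proper subspace because a scalar matrix of trace zero
  vanishes.\<close>

lemma centralizing_symmetric_reducible:
  fixes M :: "real^7^7"
  assumes M: "transpose M = M" "trace M = 0" "M \<noteq> 0" and L: "\<And>A. A \<in> L \<Longrightarrow> lie_bracket A M = 0"
  shows "acts_reducibly L"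
proof -
  obtain v l where v: "v \<noteq> 0" "M *v v = l *\<^sub>R v" using symmetric_eigenvalue[OF M(1)] by metis
  define W where "W = {x. M *v x = l *\<^sub>R x}"
  have "subspace W" by (auto simp: W_def subspace_def matrix_vector_right_distrib matrix_vector_mult_scaleR scaleR_add_right)
  moreover have "W \<noteq> {0}" using v by (auto simp: W_def)
  moreover have "W \<noteq> UNIV"
  proof
    assume "W = UNIV"
    then have "M *v x = (l *\<^sub>R mat 1) *v x" for x by (auto simp: W_def)
    then have *: "M = l *\<^sub>R mat 1" by (simp add: matrix_eq)
    then have "l = 0" using M(2) by (simp add: trace_scaleR trace_mat1)
    then show False using * M(3) by simp
  qed
  moreover have "A *v w \<in> W" if "A \<in> L" "w \<in> W" for A w
  proof -
    have "A *v (M *v w) = M *v (A *v w)" using lie_bracket_vector[of A M w] L[OF that(1)] by simp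
    then show ?thesis using that(2) by (simp add: W_def matrix_vector_mult_scaleR)
  qed
  ultimately show ?thesis unfolding acts_reducibly_def by blast
qed

lemma reflections_like: "T \<in> reflections \<Longrightarrow> reflection_like T"
  by (simp add: reflection_like_def reflection_props)

lemma reflection_conj_bracket:
  assumes "T ** T = mat (1::real)"
  shows "T ** lie_bracket A B ** T = lie_bracket (T ** A ** T) (T ** (B::real^'n^'n) ** T)"
proof -
  have "M ** T ** T = M" for M :: "real^'n^'n" using assms by (simp flip: matrix_mul_assoc)
  then show ?thesis by (simp add: lie_bracket_def matrix_mul_linear matrix_mul_assoc)
qed

lemma reducible_imp_centralizing:
  assumes T: "reflection_like T" and L: "\<And>A. A \<in> L \<Longrightarrow> transpose A = - A" and Z: "Z \<in> L" "T ** Z ** T \<in> L"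
    and red: "acts_reducibly L"
  shows "\<exists>M\<in>E_space T. M \<noteq> 0 \<and> lie_bracket Z M = 0"
proof -
  obtain W where W: "subspace W" "W \<noteq> {0}" "W \<noteq> UNIV" and inv: "\<And>A w. A \<in> L \<Longrightarrow> w \<in> W \<Longrightarrow> A *v w \<in> W"
    using red by (auto simp: acts_reducibly_def)
  obtain P where P: "transpose P = P" "\<And>w. w \<in> W \<Longrightarrow> P *v w = w"
    "\<And>y. y \<in> orthogonal_comp W \<Longrightarrow> P *v y = 0" "trace P = real (dim W)" "\<And>x. P *v x \<in> W"
    using orthogonal_projection_matrix[OF W(1)] by metis
  have PP: "P ** P = P" by (simp add: matrix_eq P(2,5) flip: matrix_vector_mul_assoc)
  have comm: "lie_bracket A P = 0" if A: "A \<in> L" for A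
  proof (rule matrix_eqI_decomp[OF W(1)])
    show "lie_bracket A P *v w = 0 *v w" if "w \<in> W" for w
      using inv[OF A that] that by (simp add: lie_bracket_vector P)
    show "lie_bracket A P *v y = 0 *v y" if y: "y \<in> orthogonal_comp W" for y
    proof -
      have "w \<bullet> (A *v y) = 0" if "w \<in> W" for w
        using skew_inner[OF L[OF A], of w y] orthogonal_compD(2)[OF y inv[OF A that]] by simp
      then have "A *v y \<in> orthogonal_comp W" by (auto simp: orthogonal_comp_def orthogonal_def)
      then show ?thesis using y by (simp add: lie_bracket_vector P)
    qed
  qed
  have TT: "transpose T = T" "T ** T = mat 1" using T by (auto simp: reflection_like_def)
  have MTT: "M ** T ** T = M" for M :: "real^7^7" using TT by (simp flip: matrix_mul_assoc)
  \<comment> \<open>\<open>P + T P T\<close> has trace \<open>2 dim W\<close> and the identity has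
    trace 7.\<close>
  define c where "c = 2 * real (dim W) / 7"
  define M where "M = P + T ** P ** T - c *\<^sub>R mat 1"
  have "transpose M = M"
    unfolding M_def transpose_diff transpose_add transpose_scaleR by (simp add: matrix_transpose_mul TT P matrix_mul_assoc transpose_mat)
  moreover have "trace M = 0"
    unfolding M_def trace_sub trace_add trace_scaleR trace_mat1 trace_conj_involution[OF TT(2)] P(4) by (simp add: c_def)
  moreover have "T ** M ** T = M"
    unfolding M_def matrix_mul_linear matrix_mul_simps by (simp add: matrix_mul_assoc TT MTT)
  ultimately have ME: "M \<in> E_space T" by (simp add: E_space_def)
  \<comment> \<open>\<open>P\<close> commutes with the second generator \<open>T Z T\<close>;
    conjugating by \<open>T\<close> shows that \<open>T P T\<close> commutes with
    \<open>Z\<close>.\<close>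
  have "T ** lie_bracket (T ** Z ** T) P ** T = lie_bracket Z (T ** P ** T)"
    unfolding reflection_conj_bracket[OF TT(2)] by (simp add: matrix_mul_assoc TT MTT)
  then have "lie_bracket Z (T ** P ** T) = 0" by (simp add: comm Z)
  moreover have "lie_bracket Z (mat 1) = 0" by (simp add: lie_bracket_def)
  ultimately have "lie_bracket Z M = 0" by (simp add: M_def lie_bracket_linear comm Z)
  \<comment> \<open>If \<open>P + T P T = c\<close>, the idempotent \<open>T P T\<close> acts on
    \<open>W\<close> as \<open>c - 1\<close>, so \<open>c\<close> is 1 or 2 and
    \<open>dim W = 7 c / 2\<close> is 7/2 or 7.\<close>
  moreover have "M \<noteq> 0"
  proof
    assume "M = 0"
    then have TPT: "T ** P ** T = c *\<^sub>R mat 1 - P" by (simp add: M_def algebra_simps)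
    obtain w where w: "w \<in> W" "w \<noteq> 0" using W subspace_0 by blast
    have 1: "(T ** P ** T) *v w = (c - 1) *\<^sub>R w"
      unfolding TPT by (simp add: matrix_vector_mult_diff_rdistrib P w algebra_simps)
    have "(T ** P ** T) ** (T ** P ** T) = T ** P ** T"
      by (simp add: matrix_mul_assoc MTT) (metis PP matrix_mul_assoc)
    then have "(T ** P ** T) *v ((T ** P ** T) *v w) = (T ** P ** T) *v w" by (simp add: matrix_vector_mul_assoc)
    then have "((c - 1) * (c - 1)) *\<^sub>R w = (c - 1) *\<^sub>R w" by (simp add: 1 matrix_vector_mult_scaleR)
    then have "(c - 1) * (c - 1) = c - 1" using w by (metis scaleR_cancel_right)
    then have "(c - 1) * (c - 2) = 0" by (simp add: algebra_simps)
    then have "c = 1 \<or> c = 2" by auto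
    then have "2 * dim W = 7 \<or> dim W = 7" by (auto simp: c_def)
    then have "dim W = 7" by presburger
    then have "W = UNIV" using dim_eq_full[of W] W(1) by (simp add: span_eq_iff[THEN iffD2])
    then show False using W by simp
  qed
  ultimately show ?thesis using ME by blast
qed

section \<open>The invariant of degree eight\<close>

lemma scaleR_eq_divide: "a *\<^sub>R x = b *\<^sub>R y \<Longrightarrow> a \<noteq> 0 \<Longrightarrow> x = (b / a) *\<^sub>R (y :: 'a::real_vector)"
  by (metis (no_types) divide_inverse_commute scaleR_one scaleR_scaleR left_inverse)

lemma trace_uminus: "trace (- A) = - trace (A :: real^'n^'n)"
  by (simp add: trace_def sum_negf)

locale reflection_pair =
  fixes T Z :: "real^7^7"
  assumes T: "T \<in> reflections" and Z: "Z \<in> g2"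
begin

definition "Ap = (1/2) *\<^sub>R (Z + T ** Z ** T)"
definition "Am = (1/2) *\<^sub>R (Z - T ** Z ** T)"
definition "C = lie_bracket Ap Am"
definition "Cp = lie_bracket Ap C"
definition "Cm = lie_bracket Am C"
definition "L = Lie_gen Z (T ** Z ** T)"

lemma H8_eq: "H8 T Z = (Am \<bullet> Am) * (Cp \<bullet> Cp) + (Ap \<bullet> Ap) * (Cm \<bullet> Cm) - 2 * (C \<bullet> C)\<^sup>2"
  unfolding H8_def Let_def frob_eq_inner Ap_def[symmetric] Am_def[symmetric] C_def[symmetric] Cp_def[symmetric] Cm_def[symmetric] ..

lemma T_props: "transpose T = T" "T ** T = mat 1" "reflection_like T"
  using reflection_props[OF T] reflections_like[OF T] by auto

lemma ZT_g2: "T ** Z ** T \<in> g2"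
  using orthogonal_conj_g2[OF reflection_props(5,4)[OF T] Z] T_props by simp

lemma L_subalgebra: "lie_subalgebra L" and L_g2: "L \<subseteq> g2" and L_mem: "Z \<in> L" "T ** Z ** T \<in> L"
  using Lie_gen_minimal[OF lie_subalgebra_g2 Z ZT_g2] by (simp_all add: L_def lie_subalgebra_Lie_gen Lie_gen_mem)

lemma A_mem: "Ap \<in> L" "Am \<in> L" "C \<in> L" "Cp \<in> L" "Cm \<in> L"
  using lie_subalgebraD[OF L_subalgebra] L_mem by (auto simp: Ap_def Am_def C_def Cp_def Cm_def)

lemma L_skew: "A \<in> L \<Longrightarrow> transpose A = - A"
  using L_g2 g2_skew by blast

lemma Z_split: "Z = Ap + Am" "T ** Z ** T = Ap - Am"
  unfolding Ap_def Am_def vec_eq_iff by (simp_all add: field_simps)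

lemma L_minimal:
  assumes "lie_subalgebra S" "Ap \<in> S" "Am \<in> S"
  shows "L \<subseteq> S"
  unfolding L_def
  by (rule Lie_gen_minimal[OF assms(1)]; subst Z_split; use assms lie_subalgebraD[OF assms(1)] in simp)

text \<open>\<open>Ap\<close> and \<open>Am\<close> are orthogonal because conjugation by
  \<open>T\<close> preserves the norm of \<open>Z\<close>; the rest is invariance of the inner
  product. The last two relations are the input for Cauchy-Schwarz.\<close>

lemma inner_relations:
  "Ap \<bullet> Am = 0" "Ap \<bullet> C = 0" "Am \<bullet> C = 0" "C \<bullet> Cp = 0" "C \<bullet> Cm = 0" "Ap \<bullet> Cp = 0" "Am \<bullet> Cm = 0"
  "Am \<bullet> Cp = - (C \<bullet> C)" "Ap \<bullet> Cm = C \<bullet> C"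
proof -
  have "(T ** Z ** T) \<bullet> (T ** Z ** T) = Z \<bullet> Z"
  proof -
    have "trace (T ** (Z ** (Z ** T))) = trace (Z ** (Z ** T) ** T)" by (rule trace_mul_sym)
    moreover have "M ** T ** T = M" for M :: "real^7^7" using T_props by (simp flip: matrix_mul_assoc)
    ultimately show ?thesis
      by (simp add: inner_eq_trace matrix_transpose_mul T_props g2_skew[OF Z] matrix_mul_assoc trace_uminus)
  qed
  then show "Ap \<bullet> Am = 0" by (simp add: Ap_def Am_def inner_add_left inner_diff_right inner_commute[of "T ** Z ** T" Z])
  note inv = lie_bracket_invariant[OF L_skew]
  show 1: "Ap \<bullet> C = 0" using inv[OF A_mem(1), of Ap Am] by (simp add: C_def)
  show 2: "Am \<bullet> C = 0" using inv[OF A_mem(2), of Ap Am] by (simp add: C_def inner_commute)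
  show "C \<bullet> Cp = 0" using inv[OF A_mem(3), of Ap C] by (simp add: Cp_def inner_commute)
  show "C \<bullet> Cm = 0" using inv[OF A_mem(3), of Am C] by (simp add: Cm_def inner_commute)
  show "Ap \<bullet> Cp = 0" using inv[OF A_mem(1), of Ap C] by (simp add: Cp_def)
  show "Am \<bullet> Cm = 0" using inv[OF A_mem(2), of Am C] by (simp add: Cm_def)
  show "Am \<bullet> Cp = - (C \<bullet> C)" using inv[OF A_mem(1), of Am C] lie_bracket_skew[of Am Ap] by (simp add: C_def[symmetric] Cp_def)
  show "Ap \<bullet> Cm = C \<bullet> C" using inv[OF A_mem(2), of Ap C] by (simp add: C_def[symmetric] Cm_def)
qed

lemma H8_cauchy_schwarz:
  "(C \<bullet> C)\<^sup>2 \<le> (Am \<bullet> Am) * (Cp \<bullet> Cp)" "(C \<bullet> C)\<^sup>2 \<le> (Ap \<bullet> Ap) * (Cm \<bullet> Cm)"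
  using Cauchy_Schwarz_ineq[of Am Cp] Cauchy_Schwarz_ineq[of Ap Cm] by (simp_all add: inner_relations)

lemma H8_nonneg: "H8 T Z \<ge> 0"
  using H8_cauchy_schwarz by (simp add: H8_eq)

text \<open>\<open>H8\<close> is a sum of two nonnegative Cauchy-Schwarz defects, so both
  inequalities become equalities.\<close>

lemma H8_zero_relations:
  assumes "H8 T Z = 0"
  shows "(Am \<bullet> Am) *\<^sub>R Cp = - (C \<bullet> C) *\<^sub>R Am" "(Ap \<bullet> Ap) *\<^sub>R Cm = (C \<bullet> C) *\<^sub>R Ap"
proof -
  have "(C \<bullet> C)\<^sup>2 = (Am \<bullet> Am) * (Cp \<bullet> Cp)" "(C \<bullet> C)\<^sup>2 = (Ap \<bullet> Ap) * (Cm \<bullet> Cm)"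
    using H8_cauchy_schwarz assms unfolding H8_eq by linarith+
  then show "(Am \<bullet> Am) *\<^sub>R Cp = - (C \<bullet> C) *\<^sub>R Am" "(Ap \<bullet> Ap) *\<^sub>R Cm = (C \<bullet> C) *\<^sub>R Ap"
    using cauchy_schwarz_equality[of Am Cp] cauchy_schwarz_equality[of Ap Cm] by (simp_all add: inner_relations)
qed

lemma reducible_iff: "acts_reducibly L \<longleftrightarrow> R30 T Z = 0"
proof
  assume "acts_reducibly L"
  then show "R30 T Z = 0"
    using reducible_imp_centralizing[OF T_props(3) L_skew L_mem] R30_eq_0_iff[OF T_props(3)] by blast
next
  assume "R30 T Z = 0"
  then obtain M where M: "M \<in> E_space T" "M \<noteq> 0" "lie_bracket Z M = 0" using R30_eq_0_iff[OF T_props(3)] by blast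
  then have "T ** M ** T = M" by (simp add: E_space_def)
  \<comment> \<open>Invariance of \<open>M\<close> under conjugation by \<open>T\<close> carries the
    commutation from \<open>Z\<close> to the other generator.\<close>
  then have "lie_bracket (T ** Z ** T) M = 0"
    using reflection_conj_bracket[OF T_props(2), of Z M] M(3) by simp
  then have "L \<subseteq> {A. lie_bracket A M = 0}"
    unfolding L_def using M by (intro Lie_gen_minimal lie_subalgebra_centralizer) auto
  then show "acts_reducibly L"
    using M by (intro centralizing_symmetric_reducible[of M]) (auto simp: E_space_def)
qed

text \<open>Commuting \<open>Ap\<close> and \<open>Am\<close> would have a common kernel vector,
  since 7 is odd, and all of \<open>L\<close> would annihilate it.\<close>

lemma irreducible_imp_C_nonzero:
  assumes "\<not> acts_reducibly L"
  shows "C \<noteq> 0"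
proof
  assume "C = 0"
  then obtain v where v: "v \<noteq> 0" "Ap *v v = 0" "Am *v v = 0"
    using odd_skew_commuting_common_kernel[OF _ L_skew[OF A_mem(1)] L_skew[OF A_mem(2)]] by (auto simp: C_def)
  then have "L \<subseteq> {A. A *v v = 0}" by (intro L_minimal lie_subalgebra_annihilator) auto
  then show False using annihilated_vector_reducible[OF v(1), of L] assms by auto
qed

end

section \<open>Recognising a principal su(2) and the vanishing of \<open>H8\<close>\<close>

lemma su2_iff: "X \<in> su2 \<longleftrightarrow> Re (X$1$1) = 0 \<and> X$2$2 = - X$1$1 \<and> X$2$1 = - cnj (X$1$2)"
  unfolding su2_def mem_Collect_eq trace_def sum_2 forall_2
  by (auto simp: complex_eq_iff)

lemma principal_su2_span:
  fixes e1 e2 e3 :: "real^7^7"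
  assumes br: "lie_bracket e1 e2 = e3" "lie_bracket e2 e3 = e1" "lie_bracket e3 e1 = e2"
    and ne: "e1 \<noteq> 0" "e2 \<noteq> 0" "e3 \<noteq> 0" and orth: "e1 \<bullet> e2 = 0" "e1 \<bullet> e3 = 0" "e2 \<bullet> e3 = 0"
    and L: "lie_subalgebra L" "L \<subseteq> g2" "\<not> acts_reducibly L" "L = span {e1, e2, e3}"
  shows "principal_su2 L"
proof -
  \<comment> \<open>The factor 2 makes the preimages of \<open>e1\<close>, \<open>e2\<close>,
    \<open>e3\<close> halves of the usual basis of \<open>su2\<close>, whose brackets are cyclic
    with constant 1. Reading the first row is enough, as it determines the second on
    \<open>su2\<close>.\<close>
  define f :: "complex^2^2 \<Rightarrow> real^7^7" where
    "f X = (2 * Im (X$1$1)) *\<^sub>R e1 + (2 * Re (X$1$2)) *\<^sub>R e2 + (2 * Im (X$1$2)) *\<^sub>R e3" for X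
  have "linear f" by (auto intro!: linearI simp: f_def algebra_simps)
  moreover have "bij_betw f su2 L"
  proof (rule bij_betwI')
    fix X Y assume XY: "X \<in> su2" "Y \<in> su2"
    have ip: "f X \<bullet> e1 = 2 * Im (X$1$1) * (e1 \<bullet> e1)" "f X \<bullet> e2 = 2 * Re (X$1$2) * (e2 \<bullet> e2)"
      "f X \<bullet> e3 = 2 * Im (X$1$2) * (e3 \<bullet> e3)" for X
      using orth by (simp_all add: f_def inner_add_left inner_commute[of e2 e1] inner_commute[of e3 e1] inner_commute[of e3 e2])
    show "f X = f Y \<longleftrightarrow> X = Y"
    proof
      assume "f X = f Y"
      then have "Im (X$1$1) = Im (Y$1$1)" "Re (X$1$2) = Re (Y$1$2)" "Im (X$1$2) = Im (Y$1$2)"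
        using ip[of X] ip[of Y] ne by auto
      then show "X = Y" using XY by (simp add: su2_iff vec_eq_iff forall_2 complex_eq_iff)
    qed simp
  next
    fix X assume "X \<in> su2"
    show "f X \<in> L" unfolding L(4) f_def by (intro span_add span_scale span_base) auto
  next
    fix A assume "A \<in> L"
    then obtain a b c where "A - a *\<^sub>R e1 - b *\<^sub>R e2 - c *\<^sub>R e3 = 0"
      by (auto simp: L(4) span_breakdown_eq)
    then have A: "A = a *\<^sub>R e1 + b *\<^sub>R e2 + c *\<^sub>R e3" by (simp add: algebra_simps)
    define X :: "complex^2^2" where "X = vector [vector [Complex 0 (a/2), Complex (b/2) (c/2)], vector [Complex (- b/2) (c/2), Complex 0 (- a/2)]]"
    have "X \<in> su2" "f X = A" by (simp_all add: X_def su2_iff f_def A complex_eq_iff)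
    then show "\<exists>X\<in>su2. A = f X" by blast
  qed
  moreover have "f (lie_bracket X Y) = lie_bracket (f X) (f Y)" if "X \<in> su2" "Y \<in> su2" for X Y
  proof -
    have 11: "Im (lie_bracket X Y $1$1) = 2 * (Re (X$1$2) * Im (Y$1$2) - Im (X$1$2) * Re (Y$1$2))"
      and 12: "Re (lie_bracket X Y $1$2) = 2 * (Im (X$1$2) * Im (Y$1$1) - Im (X$1$1) * Im (Y$1$2))"
        "Im (lie_bracket X Y $1$2) = 2 * (Im (X$1$1) * Re (Y$1$2) - Re (X$1$2) * Im (Y$1$1))"
      using that by (simp_all add: su2_iff lie_bracket_def matrix_matrix_mult_def sum_2 algebra_simps)
    have br': "lie_bracket e2 e1 = - e3" "lie_bracket e3 e2 = - e1" "lie_bracket e1 e3 = - e2"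
      using br lie_bracket_skew[of e2 e1] lie_bracket_skew[of e3 e2] lie_bracket_skew[of e1 e3] by simp_all
    have *: "lie_bracket (a *\<^sub>R e1 + b *\<^sub>R e2 + c *\<^sub>R e3) (a' *\<^sub>R e1 + b' *\<^sub>R e2 + c' *\<^sub>R e3)
      = (b * c' - c * b') *\<^sub>R e1 + (c * a' - a * c') *\<^sub>R e2 + (a * b' - b * a') *\<^sub>R e3" for a b c a' b' c'
      by (simp add: lie_bracket_linear br br' algebra_simps)
    show ?thesis unfolding f_def 11 12 * by (simp add: algebra_simps)
  qed
  ultimately show ?thesis using L unfolding principal_su2_def by blast
qed

context reflection_pair begin

lemma H8_zero_imp_span:
  assumes "H8 T Z = 0" "C \<noteq> 0"
  shows "L = span {Ap, Am, C}"
proof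
  have ne: "Ap \<noteq> 0" "Am \<noteq> 0" using assms(2) by (auto simp: C_def)
  let ?K = "span {Ap, Am, C}"
  have mem: "Ap \<in> ?K" "Am \<in> ?K" "C \<in> ?K" by (auto intro: span_base)
  have "Cp = (- (C \<bullet> C) / (Am \<bullet> Am)) *\<^sub>R Am" "Cm = ((C \<bullet> C) / (Ap \<bullet> Ap)) *\<^sub>R Ap"
    by (rule scaleR_eq_divide, use H8_zero_relations[OF assms(1)] ne in simp_all)+
  then have CC: "Cp \<in> ?K" "Cm \<in> ?K" using mem by (metis span_scale)+
  have gen: "lie_bracket A B \<in> ?K" if "A \<in> {Ap, Am, C}" "B \<in> {Ap, Am, C}" for A B
    using that mem CC lie_bracket_skew[of Am Ap] lie_bracket_skew[of C Ap] lie_bracket_skew[of C Am]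
    by (auto simp: C_def[symmetric] Cp_def[symmetric] Cm_def[symmetric] span_neg span_zero)
  have 1: "lie_bracket A B \<in> ?K" if A: "A \<in> {Ap, Am, C}" and B: "B \<in> ?K" for A B
    using B by (induction rule: span_induct_alt) (auto simp: lie_bracket_linear span_zero intro!: span_add span_scale gen[OF A])
  have "lie_bracket A B \<in> ?K" if A: "A \<in> ?K" and B: "B \<in> ?K" for A B
    using A by (induction rule: span_induct_alt) (auto simp: lie_bracket_linear span_zero intro!: span_add span_scale 1 B)
  then have "lie_subalgebra ?K" by (simp add: lie_subalgebra_def)
  then show "L \<subseteq> ?K" using mem L_minimal by blast
  show "?K \<subseteq> L" using A_mem lie_subalgebraD(1)[OF L_subalgebra] by (intro span_minimal) auto
qed

lemma H8_zero_imp_principal: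
  assumes "H8 T Z = 0" and irr: "\<not> acts_reducibly L"
  shows "principal_su2 L"
proof -
  have C: "C \<noteq> 0" using irreducible_imp_C_nonzero[OF irr] .
  then have ne: "Ap \<noteq> 0" "Am \<noteq> 0" by (auto simp: C_def)
  define p where "p = sqrt (Ap \<bullet> Ap)"
  define q where "q = sqrt (Am \<bullet> Am)"
  define r where "r = sqrt (C \<bullet> C)"
  have pos: "p > 0" "q > 0" "r > 0" using ne C by (simp_all add: p_def q_def r_def)
  have sq: "Ap \<bullet> Ap = p * p" "Am \<bullet> Am = q * q" "C \<bullet> C = r * r" by (simp_all add: p_def q_def r_def)
  have Cp: "Cp = (- (r * r) / (q * q)) *\<^sub>R Am" and Cm: "Cm = ((r * r) / (p * p)) *\<^sub>R Ap"
    by (rule scaleR_eq_divide, use H8_zero_relations[OF assms(1)] pos in \<open>simp_all add: sq\<close>)+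
  \<comment> \<open>For \<open>e1 = x Ap\<close>, \<open>e2 = y Am\<close>,
    \<open>e3 = x y C\<close> the cyclic relations read \<open>y^2 r^2 = p^2\<close> and
    \<open>x^2 r^2 = q^2\<close>, which dictates the factors.\<close>
  define e1 where "e1 = (q / r) *\<^sub>R Ap"
  define e2 where "e2 = (p / r) *\<^sub>R Am"
  define e3 where "e3 = (p * q / (r * r)) *\<^sub>R C"
  have br: "lie_bracket Ap Am = C" "lie_bracket Ap C = Cp" "lie_bracket Am C = Cm" "lie_bracket C Ap = - Cp"
    using lie_bracket_skew[of Ap C] by (simp_all add: C_def Cp_def Cm_def)
  show ?thesis
  proof (rule principal_su2_span[of e1 e2 e3 L])
    show "lie_bracket e1 e2 = e3" "lie_bracket e2 e3 = e1" "lie_bracket e3 e1 = e2"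
      using pos by (simp_all add: e1_def e2_def e3_def br Cp Cm field_simps)
    show "e1 \<noteq> 0" "e2 \<noteq> 0" "e3 \<noteq> 0" using pos ne C by (simp_all add: e1_def e2_def e3_def)
    show "e1 \<bullet> e2 = 0" "e1 \<bullet> e3 = 0" "e2 \<bullet> e3 = 0" by (simp_all add: e1_def e2_def e3_def inner_relations)
    show "lie_subalgebra L" "L \<subseteq> g2" "\<not> acts_reducibly L" by (fact L_subalgebra L_g2 irr)+
    show "L = span {e1, e2, e3}"
      unfolding H8_zero_imp_span[OF assms(1) C]
    proof (rule antisym; rule span_minimal)
      have "Ap = (r / q) *\<^sub>R e1" "Am = (r / p) *\<^sub>R e2" "C = (r * r / (p * q)) *\<^sub>R e3"
        using pos by (simp_all add: e1_def e2_def e3_def)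
      then show "{Ap, Am, C} \<subseteq> span {e1, e2, e3}"
        using span_scale[OF span_base] by (metis (no_types, lifting) empty_subsetI insert_iff insert_subset)
      show "{e1, e2, e3} \<subseteq> span {Ap, Am, C}" 
        unfolding e1_def e2_def e3_def by (simp add: span_scale span_base)
    qed simp_all
  qed
qed

text \<open>\<open>Ap\<close>, \<open>Am\<close>, \<open>C\<close> are nonzero and orthogonal, so
  they fill \<open>L\<close>. The inner products then show \<open>Cp\<close> and \<open>Cm\<close>
  to be multiples of \<open>Am\<close> and \<open>Ap\<close>, which is equality in both
  Cauchy-Schwarz inequalities.\<close>

lemma dim_le_3_imp_H8_zero:
  assumes "dim L \<le> 3" "C \<noteq> 0"
  shows "H8 T Z = 0"
proof -
  have ne: "Ap \<noteq> 0" "Am \<noteq> 0" using assms(2) by (auto simp: C_def)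
  let ?B = "{Ap, Am, C}"
  have d: "Ap \<noteq> Am" "Ap \<noteq> C" "Am \<noteq> C" using ne inner_relations by (metis inner_eq_zero_iff)+
  have "pairwise orthogonal ?B" using inner_relations by (auto simp: pairwise_def orthogonal_def inner_commute)
  then have "independent ?B" using ne assms(2) by (intro pairwise_orthogonal_independent) auto
  moreover have "card ?B = 3" using d by simp
  ultimately have "L \<subseteq> span ?B" using card_ge_dim_independent[of ?B L] A_mem assms(1) by simp
  then have zero: "x = 0" if "x \<in> L" "x \<bullet> Ap = 0" "x \<bullet> Am = 0" "x \<bullet> C = 0" for x
    using orthogonal_to_span[of x ?B x] that by (auto simp: orthogonal_def)
  have "Cp - (- (C \<bullet> C) / (Am \<bullet> Am)) *\<^sub>R Am = 0"
    using A_mem lie_subalgebraD(1)[OF L_subalgebra] ne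
    by (intro zero) (simp_all add: subspace_add subspace_diff subspace_scale inner_add_left inner_diff_left
        inner_relations inner_commute[of Cp] inner_commute[of Am Ap])
  moreover have "Cm - ((C \<bullet> C) / (Ap \<bullet> Ap)) *\<^sub>R Ap = 0"
    using A_mem lie_subalgebraD(1)[OF L_subalgebra] ne
    by (intro zero) (simp_all add: subspace_diff subspace_scale inner_diff_left inner_relations inner_commute[of Cm])
  ultimately have "Cp = (- (C \<bullet> C) / (Am \<bullet> Am)) *\<^sub>R Am" "Cm = ((C \<bullet> C) / (Ap \<bullet> Ap)) *\<^sub>R Ap"
    by (simp_all only: right_minus_eq)
  then have "Cp \<bullet> Cp = (C \<bullet> C)\<^sup>2 / (Am \<bullet> Am)" "Cm \<bullet> Cm = (C \<bullet> C)\<^sup>2 / (Ap \<bullet> Ap)"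
    using ne by (simp_all add: power2_eq_square)
  then show ?thesis using ne by (simp add: H8_eq)
qed

end

section \<open>Octonion frames\<close>

text \<open>Shift 3 comes from \<open>cross7_double\<close>, shift 2 from reading the same line from
  its second point, and shifts 4, 5, 6 are shifts 3, 2, 1 with the factors exchanged.\<close>

lemma fano_table:
  fixes F :: "7 \<Rightarrow> real^7"
  assumes line: "\<And>i. cross7 (F i) (F (i+1)) = F (i+3)" and unit: "\<And>i. F i \<bullet> F i = 1" and orth: "\<And>i. F i \<bullet> F (i+1) = 0"
  shows "cross7 (F i) (F (i+1)) = F (i+3)" "cross7 (F i) (F (i+2)) = F (i+6)" "cross7 (F i) (F (i+3)) = - F (i+1)"
    "cross7 (F i) (F (i+4)) = F (i+5)" "cross7 (F i) (F (i+5)) = - F (i+4)" "cross7 (F i) (F (i+6)) = - F (i+2)"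
proof -
  show 1: "cross7 (F i) (F (i+1)) = F (i+3)" for i by (rule line)
  show 3: "cross7 (F i) (F (i+3)) = - F (i+1)" for i
    using cross7_double[of "F i" "F (i+1)"] by (simp add: line unit orth)
  have "cross7 (F (i+1)) (F (i+3)) = F i" for i
  proof -
    have "F (i+3) = - cross7 (F (i+1)) (F i)" using line[of i] cross7_skew[of "F i" "F (i+1)"] by simp
    then show ?thesis using orth[of i] by (simp add: cross7_double unit inner_commute)
  qed
  from this[of "i+6" for i] show 2: "cross7 (F i) (F (i+2)) = F (i+6)" for i by (simp add: add.assoc numerals_mod_7)
  show 4: "cross7 (F i) (F (i+4)) = F (i+5)"
    using 3[of "i+4"] cross7_skew[of "F i" "F (i+4)"] by (simp add: add.assoc numerals_mod_7)
  show "cross7 (F i) (F (i+5)) = - F (i+4)"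
    using 2[of "i+5"] cross7_skew[of "F i" "F (i+5)"] by (simp add: add.assoc numerals_mod_7)
  show "cross7 (F i) (F (i+6)) = - F (i+2)"
    using 1[of "i+6"] cross7_skew[of "F i" "F (i+6)"] by (simp add: add.assoc numerals_mod_7)
qed

text \<open>Each \<open>F i\<close> is orthogonal to its products, and by the table these include,
  up to sign, \<open>F\<close> at the shifts 1, 2, 3; the other shifts follow by symmetry.\<close>

lemma fano_orthonormal:
  fixes F :: "7 \<Rightarrow> real^7"
  assumes "\<And>i. cross7 (F i) (F (i+1)) = F (i+3)" "\<And>i. F i \<bullet> F i = 1" "\<And>i. F i \<bullet> F (i+1) = 0"
  shows "F i \<bullet> F j = (if i = j then 1 else 0)"
proof -
  note tab = fano_table[of F, OF assms]
  have 1: "F i \<bullet> F (i+1) = 0" "F i \<bullet> F (i+2) = 0" "F i \<bullet> F (i+3) = 0" for i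
    using cross7_orth(1)[of "F i" "F (i+3)"] cross7_orth(1)[of "F i" "F (i+6)"] cross7_orth(1)[of "F i" "F (i+1)"]
    by (simp_all add: tab)
  have "F i \<bullet> F (i+4) = 0" "F i \<bullet> F (i+5) = 0" "F i \<bullet> F (i+6) = 0" for i
    using 1(3)[of "i+4"] 1(2)[of "i+5"] 1(1)[of "i+6"] by (simp_all add: add.assoc inner_commute numerals_mod_7)
  with 1 have "\<forall>d. d \<noteq> 0 \<longrightarrow> F i \<bullet> F (i + d) = 0" for i unfolding forall_7 by simp
  from this[of i, rule_format, of "j - i"] show ?thesis using assms(2) by auto
qed

lemma axis_line: "cross7 (axis i 1) (axis (i+1) 1) = axis (i+3) 1"
proof -
  have "\<forall>i. cross7 (axis i 1) (axis (i+1) 1) = axis (i+3) 1"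
    unfolding forall_7 vec_eq_iff cross7_nth by (simp add: axis_def)
  then show ?thesis by blast
qed

lemma fano_matrix:
  fixes F :: "7 \<Rightarrow> real^7"
  assumes F: "\<And>i. cross7 (F i) (F (i+1)) = F (i+3)" "\<And>i. F i \<bullet> F i = 1" "\<And>i. F i \<bullet> F (i+1) = 0"
  defines "g \<equiv> (\<chi> r c. F c $ r)"
  shows "orthogonal_matrix g" "preserves_cross g" "g *v axis i 1 = F i"
proof -
  show g: "g *v axis i 1 = F i" for i by (simp add: g_def matrix_vector_mult_basis column_def)
  have "(transpose g ** g) $ i $ j = F i \<bullet> F j" for i j
    by (simp add: matrix_matrix_mult_def transpose_def g_def inner_vec_def)
  then show "orthogonal_matrix g"
    by (simp add: orthogonal_matrix vec_eq_iff mat_def fano_orthonormal[of F, OF F])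
  have lin: "linear ((*v) g)" by simp
  have ax: "g *v cross7 (axis i 1) (axis j 1) = cross7 (F i) (F j)" for i j
  proof -
    have "axis i (1::real) \<bullet> axis i 1 = 1" "axis i (1::real) \<bullet> axis (i+1) 1 = 0" for i :: 7 
      by (simp_all add: inner_axis_axis)
    note t = fano_table[of "\<lambda>i. axis i 1", OF axis_line this] fano_table[of F, OF F]
    have "\<forall>d. g *v cross7 (axis i 1) (axis (i + d) 1) = cross7 (F i) (F (i + d))"
      unfolding forall_7 by (simp add: t g)
    from this[rule_format, of "j - i"] show ?thesis by simp
  qed
  have "(\<lambda>u v. g *v cross7 u v) = (\<lambda>u v. cross7 (g *v u) (g *v v))"
  proof (rule bilinear_eq_stdbasis)
    show "bilinear (\<lambda>u v. g *v cross7 u v)" "bilinear (\<lambda>u v. cross7 (g *v u) (g *v v))"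
      unfolding bilinear_def by (auto intro!: linearI simp: cross7_linear matrix_vector_right_distrib matrix_vector_mult_scaleR)
    show "g *v cross7 i j = cross7 (g *v i) (g *v j)" if "i \<in> Basis" "j \<in> Basis" for i j
      using that by (auto simp: Basis_vec_def ax g)
  qed
  then show "preserves_cross g" unfolding preserves_cross_def by meson
qed

text \<open>Cayley-Dickson doubling: \<open>e\<close> and \<open>u\<close> generate a quaternion
  algebra, and a unit vector \<open>w\<close> orthogonal to it completes the octonions. Putting them
  at the indices 0, 1, 2 forces the four products \<open>f3\<close> to \<open>f6\<close>.\<close>

lemma octonion_frame:
  assumes unit: "e \<bullet> e = 1" "u \<bullet> u = 1" "w \<bullet> w = 1" and orth: "e \<bullet> u = 0" "e \<bullet> w = 0" "u \<bullet> w = 0" "cross7 e u \<bullet> w = 0"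
  obtains g where "orthogonal_matrix g" "preserves_cross g" "g *v axis 0 1 = e" "g *v axis 1 1 = u" "g *v axis 2 1 = w"
    "g *v axis 3 1 = cross7 e u" "g *v axis 6 1 = cross7 e w"
proof -
  note orth' = orth[unfolded inner_commute[of e u] inner_commute[of e w] inner_commute[of u w] inner_commute[of _ w]]
  note comm = unit orth orth'
  define f3 where "f3 = cross7 e u"
  define f4 where "f4 = cross7 u w"
  define f5 where "f5 = cross7 w f3"
  define f6 where "f6 = cross7 e w"
  define F :: "7 \<Rightarrow> real^7" where
    "F i = (if i = 0 then e else if i = 1 then u else if i = 2 then w else if i = 3 then f3
      else if i = 4 then f4 else if i = 5 then f5 else f6)" for i
  have F: "F 0 = e" "F 1 = u" "F 2 = w" "F 3 = f3" "F 4 = f4" "F 5 = f5" "F 6 = f6"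
    by (simp_all add: F_def)
  have swap: "cross7 a (cross7 b c) = - cross7 b (cross7 a c)" if "a \<bullet> b = 0" "a \<bullet> c = 0" "b \<bullet> c = 0" for a b c
    using cross7_polar[of a b c] that by (simp add: eq_neg_iff_add_eq_0)
  have dbl: "cross7 a (cross7 a b) = - b" if "a \<bullet> a = 1" "a \<bullet> b = 0" for a b
    using that by (simp add: cross7_double)
  have wf3: "w \<bullet> f3 = 0" "f3 \<bullet> w = 0" using orth(4) by (simp_all add: f3_def inner_commute)
  have ef4: "e \<bullet> f4 = 0" using orth(4) cross7_triple[of e u w] by (simp add: f4_def)
  have n3: "f3 \<bullet> f3 = 1" and n4: "f4 \<bullet> f4 = 1" and n6: "f6 \<bullet> f6 = 1"
    by (simp_all add: f3_def f4_def f6_def norm_cross7 comm)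
  have n5: "f5 \<bullet> f5 = 1" by (simp add: f5_def norm_cross7 comm n3 wf3)
  have o34: "f3 \<bullet> f4 = 0"
    using cross7_triple[of e u f4] dbl[of u w] comm by (simp add: f3_def f4_def)
  have o45: "f4 \<bullet> f5 = 0"
    using cross7_triple[of u w f5] dbl[of w f3] comm wf3 by (simp add: f4_def f5_def) (simp add: f3_def)
  have f3w: "cross7 f3 w = - f5" using cross7_skew[of f3 w] by (simp add: f5_def)
  have o56: "f5 \<bullet> f6 = 0"
  proof -
    have "f5 \<bullet> f6 = f3 \<bullet> cross7 w (cross7 w e)"
      using cross7_triple[of f3 w f6] cross7_skew[of w e] by (simp add: f3w f6_def)
    then show ?thesis using dbl[of w e] comm by (simp add: f3_def)
  qed
  have f5e: "f5 \<bullet> e = 0"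
    using cross7_triple[of w f3 e] cross7_skew[of f3 e] dbl[of e u] comm by (simp add: f5_def f3_def)
  \<comment> \<open>Three of the seven lines hold by definition. The other four follow by
    anticommuting factors (\<open>swap\<close>) and cancelling repeated ones
    (\<open>dbl\<close>).\<close>
  have p34: "cross7 f3 f4 = f6"
  proof -
    have "f5 = cross7 e f4"
      using swap[of w e u] swap[of e u w] cross7_skew[of w u] comm by (simp add: f5_def f3_def f4_def)
    moreover have "cross7 f3 f4 = - cross7 u (cross7 f3 w)"
      unfolding f4_def by (rule swap) (use comm wf3 in \<open>simp_all add: f3_def\<close>)
    moreover have "cross7 u (cross7 e f4) = - cross7 e (cross7 u f4)"
      by (rule swap) (use comm ef4 in \<open>simp_all add: f4_def\<close>)
    moreover have "cross7 u f4 = - w" unfolding f4_def using comm by (intro dbl)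
    ultimately show ?thesis by (simp add: f3w f6_def)
  qed
  have p45: "cross7 f4 f5 = e"
  proof -
    have "cross7 f4 f5 = - cross7 w (cross7 f4 f3)"
      unfolding f5_def by (rule swap) (use wf3 o34 in \<open>simp_all add: f4_def inner_commute\<close>)
    also have "cross7 f4 f3 = - f6" using p34 cross7_skew[of f4 f3] by simp
    finally show ?thesis using dbl[of w e] comm cross7_skew[of e w] by (simp add: f6_def)
  qed
  have p56: "cross7 f5 f6 = u"
  proof -
    have "cross7 f5 f6 = - cross7 e (cross7 f5 w)"
      unfolding f6_def by (rule swap) (use f5e comm in \<open>simp_all add: f5_def\<close>)
    also have "cross7 f5 w = f3"
      using dbl[of w f3] comm wf3 cross7_skew[of f5 w] by (simp add: f5_def)
    finally show ?thesis using dbl[of e u] comm by (simp add: f3_def)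
  qed
  have p60: "cross7 f6 e = w"
    using dbl[of e w] comm cross7_skew[of f6 e] by (simp add: f6_def)
  have "\<forall>i. cross7 (F i) (F (i+1)) = F (i+3)"
    unfolding forall_7 by (simp add: F p34 p45 p56 p60 numerals_mod_7) (simp add: f3_def f4_def f5_def)
  moreover have "\<forall>i. F i \<bullet> F i = 1" unfolding forall_7 by (simp add: F comm n3 n4 n5 n6)
  moreover have "\<forall>i. F i \<bullet> F (i+1) = 0" unfolding forall_7 by (simp add: F comm wf3 o34 o45 o56 numerals_mod_7) (simp add: f6_def)
  ultimately have F': "\<And>i. cross7 (F i) (F (i+1)) = F (i+3)" "\<And>i. F i \<bullet> F i = 1" "\<And>i. F i \<bullet> F (i+1) = 0" by blast+
  show ?thesis
    using fano_matrix[of F, OF F'] that[of "\<chi> r c. F c $ r"] by (simp add: F f3_def f6_def)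
qed

text \<open>For orthogonal \<open>g\<close> this is \<open>conj_by\<close>, with the transpose in
  place of the inverse obtained by choice.\<close>

definition conj_orth :: "real^7^7 \<Rightarrow> real^7^7 \<Rightarrow> real^7^7" where
  "conj_orth g A = g ** A ** transpose g"

lemma preserves_cross_transpose:
  assumes g: "orthogonal_matrix g" "preserves_cross g"
  shows "orthogonal_matrix (transpose g)" "preserves_cross (transpose g)"
proof -
  have inv: "transpose g *v (g *v v) = v" "g *v (transpose g *v v) = v" for v
    using g by (simp_all add: orthogonal_matrix_def matrix_vector_mul_assoc)
  have "transpose g *v cross7 u v = cross7 (transpose g *v u) (transpose g *v v)" for u v
  proof -
    have "g *v cross7 (transpose g *v u) (transpose g *v v) = cross7 u v" using g by (simp add: preserves_cross_def inv)
    then show ?thesis by (metis inv(1))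
  qed
  then show "preserves_cross (transpose g)" by (simp add: preserves_cross_def)
  show "orthogonal_matrix (transpose g)" using g by (simp add: orthogonal_matrix_transpose)
qed

context
  fixes g :: "real^7^7"
  assumes og: "orthogonal_matrix g"
begin

lemma og_cancel: "transpose g *v (g *v v) = v" "g *v (transpose g *v v) = v" "M ** g ** transpose g = M" "M ** transpose g ** g = M"
  "transpose g ** g = mat 1" "g ** transpose g = mat 1"
  for M :: "real^7^7"
  using og by (simp_all add: orthogonal_matrix_def matrix_vector_mul_assoc) (simp_all add: orthogonal_matrix_def flip: matrix_mul_assoc)

lemma linear_conj_orth: "linear (conj_orth g)"
  by (auto intro!: linearI simp: conj_orth_def matrix_mul_linear)

lemma conj_orth_mult: "conj_orth g A ** conj_orth g B = conj_orth g (A ** B)"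
  by (simp add: conj_orth_def matrix_mul_assoc og_cancel)

lemma conj_orth_bracket: "lie_bracket (conj_orth g A) (conj_orth g B) = conj_orth g (lie_bracket A B)"
  by (simp add: lie_bracket_def conj_orth_mult linear_diff[OF linear_conj_orth])

lemma conj_orth_inverse: "conj_orth (transpose g) (conj_orth g A) = A" "conj_orth g (conj_orth (transpose g) A) = A"
  by (simp_all add: conj_orth_def matrix_mul_assoc og_cancel)

lemma lie_subalgebra_conj_orth: "lie_subalgebra L \<Longrightarrow> lie_subalgebra (conj_orth g ` L)"
  by (auto simp: lie_subalgebra_def conj_orth_bracket linear_subspace_image[OF linear_conj_orth])

lemma conj_orth_vector: "conj_orth g A *v (g *v v) = g *v (A *v v)"
  by (simp add: conj_orth_def og_cancel flip: matrix_vector_mul_assoc)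

lemma acts_reducibly_conj_orth:
  assumes "acts_reducibly L"
  shows "acts_reducibly (conj_orth g ` L)"
proof -
  obtain W where W: "subspace W" "W \<noteq> {0}" "W \<noteq> UNIV" "\<forall>A\<in>L. \<forall>w\<in>W. A *v w \<in> W"
    using assms by (auto simp: acts_reducibly_def)
  obtain w where w: "w \<in> W" "w \<noteq> 0" using W subspace_0 by blast
  obtain v where v: "v \<notin> W" using W by blast
  have "g *v w \<noteq> 0" using w og_cancel(1)[of w] by auto
  moreover have "g *v v \<notin> (*v) g ` W"
    using v og_cancel(1) by (metis imageE)
  ultimately have "(*v) g ` W \<noteq> {0}" "(*v) g ` W \<noteq> UNIV" using w by auto
  moreover have "subspace ((*v) g ` W)" using W by (simp add: linear_subspace_image)
  moreover have "\<forall>A\<in>conj_orth g ` L. \<forall>w\<in>(*v) g ` W. A *v w \<in> (*v) g ` W"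
    using W(4) by (auto simp: conj_orth_vector)
  ultimately show ?thesis unfolding acts_reducibly_def by blast
qed

end

section \<open>Root planes\<close>

lemma skew_entry: "transpose A = - A \<Longrightarrow> A $ i $ j = - A $ j $ (i :: 'n) " for A :: "real^'n^'n"
  by (metis (no_types, lifting) transpose_def vec_lambda_beta vector_uminus_component)

text \<open>One coordinate of the Leibniz rule at a product of consecutive axes. The seven rotations
  of this relation reduce the 21 entries of a skew matrix to the 14 parameters of
  \<open>g2\<close>.\<close>

lemma g2_relation:
  assumes "A \<in> g2"
  shows "A$(k+1)$(k+3) + A$(k+2)$(k+6) + A$(k+4)$(k+5) = 0"
proof -
  have d: "A *v cross7 u v = cross7 (A *v u) v + cross7 u (A *v v)" for u v using assms by (simp add: g2_iff derives_cross_def)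
  have sk: "A $ i $ j = - A $ j $ i" for i j using assms by (intro skew_entry g2_skew)
  have col: "(A *v axis i 1) $ j = A $ j $ i" for i j by (simp add: matrix_vector_mult_basis column_def)
  have "A $ (i+2) $ (i+3) = A $ (i+4) $ i - A $ (i+6) $ (i+1)" for i
  proof -
    have 1: "(A *v cross7 (axis i 1) (axis (i+1) 1)) $ (i+2) = A $ (i+2) $ (i+3)" by (simp add: axis_line col)
    have 2: "cross7 a (axis (i+1) 1) $ (i+2) = a $ (i+4)" for a
      by (simp add: cross7_def add.assoc numerals_mod_7 axis_def)
    have 3: "cross7 (axis i 1) a $ (i+2) = - a $ (i+6)" for a
      by (simp add: cross7_def add.assoc numerals_mod_7 axis_def)
    show ?thesis using d[of "axis i 1" "axis (i+1) 1"] 1 2 3 by (simp add: col)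
  qed
  from this[of "k+2"] show ?thesis using sk[of "k+1" "k+3"] sk[of "k+2" "k+6"]
    by (simp add: add.assoc numerals_mod_7)
qed

lemma g2_relations:
  assumes "A \<in> g2"
  shows "A$4$5 = - A$1$3 - A$2$6" "A$5$6 = A$0$3 - A$2$4" "A$3$5 = A$1$4 + A$0$6" "A$4$6 = A$2$5 - A$0$1"
    "A$3$6 = A$1$2 - A$0$5" "A$2$3 = A$1$6 - A$0$4" "A$3$4 = - A$0$2 - A$1$5"
proof -
  have sk: "A $ i $ j = - A $ j $ i" for i j using assms by (intro skew_entry g2_skew)
  note r = g2_relation[OF assms]
  show "A$4$5 = - A$1$3 - A$2$6" using r[of 0] by simp
  show "A$5$6 = A$0$3 - A$2$4" using r[of 1] sk[of 3 0] by (simp add: numerals_mod_7)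
  show "A$3$5 = A$1$4 + A$0$6" using r[of 2] sk[of 4 1] sk[of 6 0] by (simp add: numerals_mod_7)
  show "A$4$6 = A$2$5 - A$0$1" using r[of 3] sk[of 5 2] by (simp add: numerals_mod_7)
  show "A$3$6 = A$1$2 - A$0$5" using r[of 4] sk[of 5 0] sk[of 6 3] by (simp add: numerals_mod_7)
  show "A$2$3 = A$1$6 - A$0$4" using r[of 5] sk[of 6 1] by (simp add: numerals_mod_7)
  show "A$3$4 = - A$0$2 - A$1$5" using r[of 6] by (simp add: numerals_mod_7)
qed

lemma skew_eqI_7:
  fixes A B :: "real^7^7"
  assumes "transpose A = - A" "transpose B = - B"
    and "A$0$1 = B$0$1" "A$0$2 = B$0$2" "A$0$3 = B$0$3" "A$0$4 = B$0$4" "A$0$5 = B$0$5" "A$0$6 = B$0$6"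
    "A$1$2 = B$1$2" "A$1$3 = B$1$3" "A$1$4 = B$1$4" "A$1$5 = B$1$5" "A$1$6 = B$1$6"
    "A$2$3 = B$2$3" "A$2$4 = B$2$4" "A$2$5 = B$2$5" "A$2$6 = B$2$6"
    "A$3$4 = B$3$4" "A$3$5 = B$3$5" "A$3$6 = B$3$6" "A$4$5 = B$4$5" "A$4$6 = B$4$6" "A$5$6 = B$5$6"
  shows "A = B"
proof -
  have flip: "A $ j $ i = B $ j $ i" if "A $ i $ j = B $ i $ j" for i j
    using that skew_entry[OF assms(1), of j i] skew_entry[OF assms(2), of j i] by linarith
  have diag: "A $ i $ i = B $ i $ i" for i
    using skew_entry[OF assms(1), of i i] skew_entry[OF assms(2), of i i] by linarith
  show ?thesis
    unfolding vec_eq_iff forall_7 by (intro conjI diag; (rule assms | rule flip, rule assms))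
qed

definition rot :: "7 \<Rightarrow> 7 \<Rightarrow> real^7^7" where
  "rot i j = unit_matrix (i, j) - unit_matrix (j, i)"

text \<open>The axis \<open>0\<close> splits the remaining six into the complex lines \<open>(k, 3k)\<close> for \<open>k = 1, 2, 4\<close>, indices modulo 7;
  multiplication of indices by 2 permutes them cyclically.  The torus rotates the three lines with total
  angle zero.  The short root plane \<open>k\<close> moves the axis \<open>0\<close> into line \<open>k\<close>, and it and the long root plane \<open>k\<close> are the
  antilinear and the linear maps between the other two lines \<open>2k\<close> and \<open>4k\<close>.\<close>

definition torus :: "real \<Rightarrow> real \<Rightarrow> real^7^7" where
  "torus a b = a *\<^sub>R rot 1 3 + b *\<^sub>R rot 2 6 - (a + b) *\<^sub>R rot 4 5"

definition short_root :: "7 \<Rightarrow> real \<Rightarrow> real \<Rightarrow> real^7^7" where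
  "short_root k p q = p *\<^sub>R rot 0 k + q *\<^sub>R rot 0 (3*k) + (q/2) *\<^sub>R rot (2*k) (4*k) + (p/2) *\<^sub>R rot (2*k) (5*k)
     - (p/2) *\<^sub>R rot (4*k) (6*k) + (q/2) *\<^sub>R rot (5*k) (6*k)"

definition long_root :: "7 \<Rightarrow> real \<Rightarrow> real \<Rightarrow> real^7^7" where
  "long_root k p q = p *\<^sub>R rot (2*k) (4*k) + q *\<^sub>R rot (2*k) (5*k) + q *\<^sub>R rot (4*k) (6*k) - p *\<^sub>R rot (5*k) (6*k)"

lemma rot_entry: "rot i j $ r $ c = (if r = i \<and> c = j then 1 else 0) - (if r = j \<and> c = i then 1 else 0)"
  by (simp add: rot_def unit_matrix_def)

lemma transpose_unit_matrix: "transpose (unit_matrix (i, j)) = unit_matrix (j, i)"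
  by (auto simp: transpose_def unit_matrix_def vec_eq_iff)

lemma rot_skew: "transpose (rot i j) = - rot i j"
  by (simp add: rot_def transpose_diff transpose_unit_matrix)

lemma subspace_skew: "subspace {A :: real^'n^'n. transpose A = - A}"
  by (auto simp: subspace_def transpose_add transpose_scaleR) (simp add: transpose_def vec_eq_iff)

lemma root_skew: "transpose (torus a b) = - torus a b" "transpose (short_root k p q) = - short_root k p q"
  "transpose (long_root k p q) = - long_root k p q"
proof -
  note closed = subspace_add[OF subspace_skew] subspace_diff[OF subspace_skew] subspace_scale[OF subspace_skew]
  have "rot i j \<in> {A. transpose A = - A}" for i j using rot_skew by simp
  then have "torus a b \<in> {A. transpose A = - A}" "short_root k p q \<in> {A. transpose A = - A}"
    "long_root k p q \<in> {A. transpose A = - A}"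
    unfolding torus_def short_root_def long_root_def by (intro closed; simp)+
  then show "transpose (torus a b) = - torus a b" "transpose (short_root k p q) = - short_root k p q"
    "transpose (long_root k p q) = - long_root k p q" by simp_all
qed

lemma rot_vector: "(rot i j *v x) $ r = (if r = i then x $ j else 0) - (if r = j then x $ i else 0)"
proof -
  have "(unit_matrix (i, j) *v x) $ r = (if r = i then x $ j else 0)" for i j
  proof -
    have "(unit_matrix (i, j) *v x) $ r = (\<Sum>c\<in>UNIV. if c = j then (if r = i then x $ c else 0) else 0)"
      unfolding matrix_vector_mult_def unit_matrix_def vec_lambda_beta by (intro sum.cong refl) auto
    then show ?thesis by simp
  qed
  then show ?thesis by (simp add: rot_def matrix_vector_mult_diff_rdistrib)
qed

lemma numerals_mod_7_product: "(16 :: 7) = 2" "(20 :: 7) = 6" "(24 :: 7) = 3"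
  by simp_all

lemma torus_vector:
  "(torus a b *v x) $ 0 = 0" "(torus a b *v x) $ 1 = a * x $ 3" "(torus a b *v x) $ 2 = b * x $ 6"
  "(torus a b *v x) $ 3 = - a * x $ 1" "(torus a b *v x) $ 4 = - ((a + b) * x $ 5)"
  "(torus a b *v x) $ 5 = (a + b) * x $ 4" "(torus a b *v x) $ 6 = - b * x $ 2"
  by (simp_all add: torus_def matrix_vector_mult_add_rdistrib matrix_vector_mult_diff_rdistrib rot_vector)

lemma short_root_vector:
  "(short_root 1 p q *v x) $ 0 = p * x$1 + q * x$3" "(short_root 1 p q *v x) $ 1 = - p * x$0"
  "(short_root 1 p q *v x) $ 2 = q/2 * x$4 + p/2 * x$5" "(short_root 1 p q *v x) $ 3 = - q * x$0"
  "(short_root 1 p q *v x) $ 4 = - q/2 * x$2 - p/2 * x$6" "(short_root 1 p q *v x) $ 5 = - p/2 * x$2 + q/2 * x$6"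
  "(short_root 1 p q *v x) $ 6 = p/2 * x$4 - q/2 * x$5"
  "(short_root 2 p q *v x) $ 0 = p * x$2 + q * x$6" "(short_root 2 p q *v x) $ 2 = - p * x$0"
  "(short_root 2 p q *v x) $ 4 = q/2 * x$1 + p/2 * x$3" "(short_root 2 p q *v x) $ 6 = - q * x$0"
  "(short_root 2 p q *v x) $ 1 = - q/2 * x$4 - p/2 * x$5" "(short_root 2 p q *v x) $ 3 = - p/2 * x$4 + q/2 * x$5"
  "(short_root 2 p q *v x) $ 5 = p/2 * x$1 - q/2 * x$3"
  "(short_root 4 p q *v x) $ 0 = p * x$4 + q * x$5" "(short_root 4 p q *v x) $ 4 = - p * x$0"
  "(short_root 4 p q *v x) $ 1 = q/2 * x$2 + p/2 * x$6" "(short_root 4 p q *v x) $ 5 = - q * x$0"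
  "(short_root 4 p q *v x) $ 2 = - q/2 * x$1 - p/2 * x$3" "(short_root 4 p q *v x) $ 6 = - p/2 * x$1 + q/2 * x$3"
  "(short_root 4 p q *v x) $ 3 = p/2 * x$2 - q/2 * x$6"
  by (simp_all add: short_root_def matrix_vector_mult_add_rdistrib matrix_vector_mult_diff_rdistrib rot_vector numerals_mod_7 numerals_mod_7_product)

lemma long_root_vector:
  "(long_root 1 p q *v x) $ 0 = 0" "(long_root 1 p q *v x) $ 1 = 0" "(long_root 1 p q *v x) $ 3 = 0"
  "(long_root 1 p q *v x) $ 2 = p * x$4 + q * x$5" "(long_root 1 p q *v x) $ 4 = - p * x$2 + q * x$6"
  "(long_root 1 p q *v x) $ 5 = - q * x$2 - p * x$6" "(long_root 1 p q *v x) $ 6 = - q * x$4 + p * x$5"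
  "(long_root 2 p q *v x) $ 0 = 0" "(long_root 2 p q *v x) $ 2 = 0" "(long_root 2 p q *v x) $ 6 = 0"
  "(long_root 2 p q *v x) $ 4 = p * x$1 + q * x$3" "(long_root 2 p q *v x) $ 1 = - p * x$4 + q * x$5"
  "(long_root 2 p q *v x) $ 3 = - q * x$4 - p * x$5" "(long_root 2 p q *v x) $ 5 = - q * x$1 + p * x$3"
  "(long_root 4 p q *v x) $ 0 = 0" "(long_root 4 p q *v x) $ 4 = 0" "(long_root 4 p q *v x) $ 5 = 0"
  "(long_root 4 p q *v x) $ 1 = p * x$2 + q * x$6" "(long_root 4 p q *v x) $ 2 = - p * x$1 + q * x$3"
  "(long_root 4 p q *v x) $ 6 = - q * x$1 - p * x$3" "(long_root 4 p q *v x) $ 3 = - q * x$2 + p * x$6"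
  by (simp_all add: long_root_def matrix_vector_mult_add_rdistrib matrix_vector_mult_diff_rdistrib rot_vector numerals_mod_7 numerals_mod_7_product)

lemmas root_vector = torus_vector short_root_vector long_root_vector

lemma short_root_g2: "k \<in> {1, 2, 4} \<Longrightarrow> short_root k p q \<in> g2"
  unfolding g2_iff derives_cross_def vec_eq_iff forall_7 vector_add_component cross7_nth
  by (auto simp: root_skew root_vector cross7_nth field_simps)

definition torus_weight :: "7 \<Rightarrow> real \<Rightarrow> real \<Rightarrow> real" where
  "torus_weight k a b = (if k = 1 then a else if k = 2 then b else - (a + b))"

definition torus_weight_diff :: "7 \<Rightarrow> real \<Rightarrow> real \<Rightarrow> real" where
  "torus_weight_diff k a b = torus_weight (2*k) a b - torus_weight (4*k) a b"

lemma torus_short_root: "k \<in> {1, 2, 4} \<Longrightarrow> lie_bracket (torus a b) (short_root k p q)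
    = torus_weight k a b *\<^sub>R short_root k q (- p)"
  unfolding matrix_eq lie_bracket_vector vec_eq_iff forall_7 
  by (auto simp: root_vector torus_weight_def algebra_simps)

lemma torus_long_root: "k \<in> {1, 2, 4} \<Longrightarrow> lie_bracket (torus a b) (long_root k p q)
    = torus_weight_diff k a b *\<^sub>R long_root k (- q) p"
  unfolding matrix_eq lie_bracket_vector vec_eq_iff forall_7 
  by (auto simp: root_vector torus_weight_def torus_weight_diff_def numerals_mod_7 algebra_simps)

text \<open>With weights \<open>w\<close>, the sum \<open>w_k + w_2k = - w_4k\<close> is a short
  root and \<open>w_k - w_2k\<close> is the long root of index \<open>4*k\<close>. A real plane
  stands for a root and its negative, so one bracket meets both planes.\<close>

lemma short_short_bracket: "k \<in> {1, 2, 4} \<Longrightarrow> lie_bracket (short_root k 1 0) (short_root (2*k) 1 0)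
    = short_root (4*k) 0 (- 1) + long_root (4*k) (- 3/4) 0"
  unfolding matrix_eq lie_bracket_vector vec_eq_iff forall_7 matrix_vector_mult_add_rdistrib
  by (auto simp: root_vector numerals_mod_7 numerals_mod_7_product field_simps)

text \<open>Root arithmetic: \<open>w_k + (w_4k - w_k) = w_4k\<close> and
  \<open>w_k - (w_k - w_2k) = w_2k\<close>, while the combinations with the opposite sign are not
  roots.\<close>

lemma short_long_bracket:
  assumes "k \<in> {1, 2, 4}"
  shows "lie_bracket (short_root k 1 0) (long_root (2*k) 1 0) = short_root (4*k) (- 1) 0"
    "lie_bracket (short_root k 1 0) (long_root (4*k) 1 0) = short_root (2*k) 1 0"
  using assms unfolding matrix_eq lie_bracket_vector vec_eq_iff forall_7
  by (auto simp: root_vector numerals_mod_7 numerals_mod_7_product field_simps)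

text \<open>Row 0 determines the short parts. Short and long plane of the same index share their
  remaining entries, with opposite relative signs, so a half sum or half difference isolates the
  long part.\<close>

lemma g2_decomposition:
  assumes "A \<in> g2"
  shows "A = torus (A$1$3) (A$2$6)
    + (short_root 1 (A$0$1) (A$0$3) + short_root 2 (A$0$2) (A$0$6) + short_root 4 (A$0$4) (A$0$5)
     + long_root 1 ((A$2$4 - A$5$6)/2) ((A$2$5 + A$4$6)/2) + long_root 2 ((A$4$1 - A$3$5)/2) ((A$4$3 + A$1$5)/2)
     + long_root 4 ((A$1$2 - A$6$3)/2) ((A$1$6 + A$2$3)/2))" (is "A = ?R")
proof -
  have sk: "A$4$1 = - A$1$4" "A$4$3 = - A$3$4" "A$6$3 = - A$3$6" by (rule skew_entry[OF g2_skew[OF assms]])+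
  note rel = g2_relations[OF assms] sk
  show ?thesis
  proof (rule skew_eqI_7)
    show "transpose A = - A" using assms by (rule g2_skew)
    have "?R \<in> {A. transpose A = - A}" by (intro subspace_add[OF subspace_skew]) (simp_all add: root_skew)
    then show "transpose ?R = - ?R" by simp
  qed (simp_all add: rel torus_def short_root_def long_root_def rot_entry numerals_mod_7 numerals_mod_7_product field_simps)
qed

text \<open>Applying \<open>D - c j\<close> to the sum removes the term \<open>j\<close> and
  rescales the others by the nonzero factors \<open>c i - c j\<close>.\<close>

lemma eigenvector_sum_components:
  fixes D :: "'a::real_vector \<Rightarrow> 'a"
  assumes lin: "linear D" and L: "subspace L" "\<And>x. x \<in> L \<Longrightarrow> D x \<in> L" and fin: "finite I"
    and eig: "\<And>i. i \<in> I \<Longrightarrow> D (v i) = c i *\<^sub>R v i" and inj: "inj_on c I" and sum: "(\<Sum>i\<in>I. v i) \<in> L"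
  shows "\<forall>i\<in>I. v i \<in> L"
  using fin eig inj sum
proof (induction I arbitrary: v rule: finite_induct)
  case (insert j I)
  have "D (\<Sum>i\<in>insert j I. v i) - c j *\<^sub>R (\<Sum>i\<in>insert j I. v i) \<in> L"
    using insert.prems L by (simp add: subspace_diff subspace_scale)
  also have "D (\<Sum>i\<in>insert j I. v i) - c j *\<^sub>R (\<Sum>i\<in>insert j I. v i) = (\<Sum>i\<in>insert j I. (c i - c j) *\<^sub>R v i)"
    unfolding linear_sum[OF lin] scaleR_sum_right sum_subtractf[symmetric]
    by (intro sum.cong refl) (simp add: insert.prems(1) algebra_simps)
  also have "\<dots> = (\<Sum>i\<in>I. (c i - c j) *\<^sub>R v i)" using insert.hyps by simp
  finally have "\<forall>i\<in>I. (c i - c j) *\<^sub>R v i \<in> L"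
    by (intro insert.IH) (use insert.prems in \<open>auto simp: linear_scale[OF lin] mult.commute intro: inj_on_subset\<close>)
  moreover have "c i - c j \<noteq> 0" if "i \<in> I" for i using that insert.prems(2) insert.hyps by (auto simp: inj_on_def)
  ultimately have I: "\<forall>i\<in>I. v i \<in> L" 
    using subspace_scale[OF L(1), of "(c i - c j) *\<^sub>R v i" "1 / (c i - c j)" for i] by fastforce
  have "v j = (\<Sum>i\<in>insert j I. v i) - (\<Sum>i\<in>I. v i)" using insert.hyps by simp
  moreover have "(\<Sum>i\<in>I. v i) \<in> L" using I L(1) by (simp add: subspace_sum)
  ultimately have "v j \<in> L" using insert.prems(3) L(1) by (metis subspace_diff)
  then show ?case using I by simp
qed simp

lemma short_root_linear: "short_root k (a * p + b * p') (a * q + b * q') = a *\<^sub>R short_root k p q + b *\<^sub>R short_root k p' q'"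
  unfolding short_root_def vec_eq_iff by (simp add: field_simps)

lemma long_root_linear: "long_root k (a * p + b * p') (a * q + b * q') = a *\<^sub>R long_root k p q + b *\<^sub>R long_root k p' q'"
  unfolding long_root_def vec_eq_iff by (simp add: field_simps)

lemma torus_linear: "torus (a * p + b * p') (a * q + b * q') = a *\<^sub>R torus p q + b *\<^sub>R torus p' q'"
  unfolding torus_def vec_eq_iff by (simp add: field_simps)

lemma axis_basis_7: 
  assumes "subspace W" "\<And>i. axis i (1::real) \<in> W" shows "W = (UNIV :: (real^7) set)"
proof -
  have "(\<Sum>i\<in>UNIV. (x $ i) *\<^sub>R axis i 1) = x" for x :: "real^7"
    by (simp add: basis_expansion flip: scalar_mult_eq_scaleR)
  moreover have "(\<Sum>i\<in>UNIV. (x $ i) *\<^sub>R axis i 1) \<in> W" for x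
    using assms by (intro subspace_sum subspace_scale) auto
  ultimately show ?thesis by (metis UNIV_eq_I)
qed

section \<open>Subalgebras containing the maximal torus\<close>

locale torus_subalgebra =
  fixes L :: "(real^7^7) set"
  assumes L: "lie_subalgebra L" "L \<subseteq> g2" and tor: "\<And>a b. torus a b \<in> L"
begin

lemmas closed = lie_subalgebraD[OF L(1)]

definition "short_in k \<longleftrightarrow> (\<forall>p q. short_root k p q \<in> L)"
definition "long_in k \<longleftrightarrow> (\<forall>p q. long_root k p q \<in> L)"

lemma root_components:
  assumes A: "A \<in> L"
  shows "short_root 1 (A$0$1) (A$0$3) \<in> L" "short_root 2 (A$0$2) (A$0$6) \<in> L" "short_root 4 (A$0$4) (A$0$5) \<in> L"
    "long_root 1 ((A$2$4 - A$5$6)/2) ((A$2$5 + A$4$6)/2) \<in> L" "long_root 2 ((A$4$1 - A$3$5)/2) ((A$4$3 + A$1$5)/2) \<in> L"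
    "long_root 4 ((A$1$2 - A$6$3)/2) ((A$1$6 + A$2$3)/2) \<in> L"
proof -
  \<comment> \<open>\<open>torus 1 3\<close> has the weights 1, 3, -4 with differences 7, -5, -2, so
    six distinct squares. Squaring the bracket map turns its rotation of each root plane into a
    scalar.\<close>
  define D where "D B = lie_bracket (torus 1 3) (lie_bracket (torus 1 3) B)" for B
  define vs where "vs = [short_root 1 (A$0$1) (A$0$3), short_root 2 (A$0$2) (A$0$6), short_root 4 (A$0$4) (A$0$5),
    long_root 1 ((A$2$4 - A$5$6)/2) ((A$2$5 + A$4$6)/2), long_root 2 ((A$4$1 - A$3$5)/2) ((A$4$3 + A$1$5)/2),
    long_root 4 ((A$1$2 - A$6$3)/2) ((A$1$6 + A$2$3)/2)]"
  define cs :: "real list" where "cs = [-1, -9, -16, -49, -25, -4]"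
  define I where "I = {0, 1, 2, 3, 4, 5 :: nat}"
  have neg: "short_root k (- p) (- q) = - short_root k p q" "long_root k (- p) (- q) = - long_root k p q" for k p q
    using short_root_linear[of k "-1" p 0 0 q 0] long_root_linear[of k "-1" p 0 0 q 0] by simp_all
  have "linear D" by (auto intro!: linearI simp: D_def lie_bracket_linear)
  moreover have "D B \<in> L" if "B \<in> L" for B using that closed tor by (simp add: D_def)
  moreover have "D (vs ! i) = cs ! i *\<^sub>R vs ! i" if "i \<in> I" for i
    using that by (auto simp: I_def vs_def cs_def D_def torus_short_root torus_long_root torus_weight_diff_def torus_weight_def
        numerals_mod_7 neg)
  moreover have "inj_on ((!) cs) I" by (auto simp: inj_on_def I_def cs_def)
  moreover have "(\<Sum>i\<in>I. vs ! i) \<in> L"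
  proof -
    have "A - torus (A$1$3) (A$2$6) \<in> L" using A tor closed by simp
    moreover have "A - torus (A$1$3) (A$2$6) = (\<Sum>i\<in>I. vs ! i)"
      by (subst (1) g2_decomposition[of A]) (use A L in \<open>auto simp: I_def vs_def add.assoc\<close>)
    ultimately show ?thesis by simp
  qed
  ultimately have "\<forall>i\<in>I. vs ! i \<in> L"
    using eigenvector_sum_components[of D L I "(!) vs" "(!) cs"] closed(1) by (simp add: I_def)
  then show "short_root 1 (A$0$1) (A$0$3) \<in> L" "short_root 2 (A$0$2) (A$0$6) \<in> L" "short_root 4 (A$0$4) (A$0$5) \<in> L"
    "long_root 1 ((A$2$4 - A$5$6)/2) ((A$2$5 + A$4$6)/2) \<in> L" "long_root 2 ((A$4$1 - A$3$5)/2) ((A$4$3 + A$1$5)/2) \<in> L"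
    "long_root 4 ((A$1$2 - A$6$3)/2) ((A$1$6 + A$2$3)/2) \<in> L"
    by (simp_all add: I_def vs_def)
qed

text \<open>The parameter vectors \<open>(p, q)\<close> and \<open>(q, - p)\<close> are orthogonal
  and nonzero, so they span the plane.\<close>

lemma root_plane_fill:
  fixes r :: "real \<Rightarrow> real \<Rightarrow> real^7^7"
  assumes lin: "\<And>a b p q p' q'. r (a * p + b * p') (a * q + b * q') = a *\<^sub>R r p q + b *\<^sub>R r p' q'"
    and mem: "r p q \<in> L" "r q (- p) \<in> L" and ne: "p \<noteq> 0 \<or> q \<noteq> 0"
  shows "r x y \<in> L"
proof -
  define n where "n = p * p + q * q"
  have n: "n \<noteq> 0" using ne by (auto simp: n_def sum_squares_eq_zero_iff)
  define a where "a = (p * x + q * y) / n"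
  define b where "b = (q * x - p * y) / n"
  have "(p * x + q * y) * p + (q * x - p * y) * q = x * n" "(p * x + q * y) * q - (q * x - p * y) * p = y * n"
    by (simp_all add: n_def algebra_simps)
  then have "a * p + b * q = x" "a * q + b * (- p) = y"
    using n by (simp_all add: a_def b_def flip: add_divide_distrib diff_divide_distrib)
  then have "r x y = a *\<^sub>R r p q + b *\<^sub>R r q (- p)" using lin[of a p b q q "- p"] by simp
  then show ?thesis using mem closed by simp
qed

lemma short_inI:
  assumes k: "k \<in> {1, 2, 4}" and mem: "short_root k p q \<in> L" and ne: "p \<noteq> 0 \<or> q \<noteq> 0"
  shows "short_in k"
proof -
  \<comment> \<open>The torus element is chosen so that line \<open>k\<close> has weight 1 or
    -1.\<close>
  have "lie_bracket (torus 1 (if k = 4 then 0 else 1)) (short_root k p q) \<in> L" using tor mem closed by simp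
  then have "short_root k q (- p) \<in> L \<or> - short_root k q (- p) \<in> L"
    using k by (auto simp: torus_short_root torus_weight_def)
  then have "short_root k q (- p) \<in> L" using subspace_neg[OF closed(1), of "- short_root k q (- p)"] by auto
  then show ?thesis
    unfolding short_in_def using root_plane_fill[of "short_root k" p q, OF short_root_linear mem _ ne] by blast
qed

lemma long_inI:
  assumes k: "k \<in> {1, 2, 4}" and mem: "long_root k p q \<in> L" and ne: "p \<noteq> 0 \<or> q \<noteq> 0"
  shows "long_in k"
proof -
  \<comment> \<open>The values of \<open>a\<close> and \<open>b\<close> only have to make the long
    root \<open>c\<close> nonzero; it is 2, -1, 1 for \<open>k\<close> equal to 1, 2, 4.\<close>
  define a :: real where "a = (if k = 1 then 0 else 1)"
  define b :: real where "b = (if k = 1 then 1 else if k = 2 then - 1 else 0)"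
  define c where "c = torus_weight_diff k a b"
  have "lie_bracket (torus a b) (long_root k p q) \<in> L" using tor mem closed(2) by blast
  then have "c *\<^sub>R long_root k (- q) p \<in> L" unfolding torus_long_root[OF k] c_def .
  then have "(- 1 / c) *\<^sub>R c *\<^sub>R long_root k (- q) p \<in> L" by (rule closed(5))
  moreover have "c \<noteq> 0"
    using k by (auto simp: c_def a_def b_def torus_weight_diff_def torus_weight_def numerals_mod_7 numerals_mod_7_product)
  ultimately have "- long_root k (- q) p \<in> L" by simp
  moreover have "- long_root k (- q) p = long_root k q (- p)"
    using long_root_linear[of k "-1" "- q" 0 0 p 0] by simp
  ultimately have "long_root k q (- p) \<in> L" by simp
  then show ?thesis 
    unfolding long_in_def using root_plane_fill[of "long_root k" p q, OF long_root_linear mem _ ne] by blast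
qed

text \<open>The bracket of the two short elements has a part in each plane of index
  \<open>4*k\<close>, and \<open>root_components\<close> separates them.\<close>

lemma short_short_closed:
  assumes k: "k \<in> {1, 2, 4}" and s: "short_in k" "short_in (2*k)"
  shows "short_in (4*k)" "long_in (4*k)"
proof -
  have k4: "4*k \<in> {1, 2, 4}" using k by (auto simp: numerals_mod_7 numerals_mod_7_product)
  define B where "B = lie_bracket (short_root k 1 0) (short_root (2*k) 1 0)"
  have B: "B = short_root (4*k) 0 (- 1) + long_root (4*k) (- 3/4) 0" unfolding B_def by (rule short_short_bracket[OF k])
  have BL: "B \<in> L" unfolding B_def using s closed by (simp add: short_in_def)
  have "short_root (4*k) 0 (- 1) \<in> L"
    using k root_components(1-3)[OF BL]
    by (auto simp: B short_root_def long_root_def rot_entry numerals_mod_7 numerals_mod_7_product)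
  then show "short_in (4*k)" using short_inI[OF k4] by fastforce
  have "long_root (4*k) (- 3/4) 0 = B - short_root (4*k) 0 (- 1)" by (simp add: B)
  then have "long_root (4*k) (- 3/4) 0 \<in> L" using BL \<open>short_root (4*k) 0 (- 1) \<in> L\<close> closed by simp
  then show "long_in (4*k)" using long_inI[OF k4] by fastforce
qed

lemma two_short_imp_full:
  assumes k: "k \<in> {1, 2, 4}" and s: "short_in k" "short_in (2*k)"
  shows "L = g2"
proof -
  note s4 = short_short_closed[OF k s]
  have k': "2*k \<in> {1, 2, 4}" "4*k \<in> {1, 2, 4}" "2*(2*k) = 4*k" "4*(2*k) = k" "2*(4*k) = k" "4*(4*k) = 2*k"
    using k by (auto simp: numerals_mod_7 numerals_mod_7_product)
  have "long_in k" using short_short_closed(2)[OF k'(1)] s s4 unfolding k' by blast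
  moreover have "long_in (2*k)" using short_short_closed(2)[OF k'(2)] s s4 unfolding k' by blast
  ultimately have "short_in 1" "short_in 2" "short_in 4" "long_in 1" "long_in 2" "long_in 4"
    using s s4 k by (auto simp: numerals_mod_7 numerals_mod_7_product)
  then have "A \<in> L" if "A \<in> g2" for A
    by (subst g2_decomposition[OF that]) (simp add: closed tor short_in_def long_in_def)
  then show ?thesis using L by blast
qed

lemma short_long_imp_full:
  assumes k: "k \<in> {1, 2, 4}" and s: "short_in k" and l: "long_in (2*k) \<or> long_in (4*k)"
  shows "L = g2"
proof -
  have k': "2*k \<in> {1, 2, 4}" "4*k \<in> {1, 2, 4}" "2*(4*k) = k"
    using k by (auto simp: numerals_mod_7 numerals_mod_7_product)
  from l have "short_in (4*k) \<or> short_in (2*k)"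
  proof
    assume "long_in (2*k)"
    then have "lie_bracket (short_root k 1 0) (long_root (2*k) 1 0) \<in> L"
      using s closed by (simp add: short_in_def long_in_def)
    then show ?thesis using short_inI[OF k'(2)] short_long_bracket(1)[OF k] by fastforce
  next
    assume "long_in (4*k)"
    then have "lie_bracket (short_root k 1 0) (long_root (4*k) 1 0) \<in> L"
      using s closed by (simp add: short_in_def long_in_def)
    then show ?thesis using short_inI[OF k'(1)] short_long_bracket(2)[OF k] by fastforce
  qed
  then show ?thesis
    using two_short_imp_full[OF k s] two_short_imp_full[OF k'(2)] s unfolding k' by blast
qed

text \<open>Besides the torus only planes of index \<open>k\<close> can occur. They map axis
  \<open>0\<close> and line \<open>k\<close> among themselves and mix the other two lines, so the
  span \<open>W\<close> of the axes \<open>0\<close>, \<open>k\<close>, \<open>3*k\<close> is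
  invariant.\<close>

lemma invariant_if_one_short:
  assumes k: "k \<in> {1, 2, 4}" and no: "\<not> short_in (2*k)" "\<not> short_in (4*k)" "\<not> long_in (2*k)" "\<not> long_in (4*k)"
  shows "acts_reducibly L"
proof -
  define W :: "(real^7) set" where "W = {x. x$(2*k) = 0 \<and> x$(4*k) = 0 \<and> x$(5*k) = 0 \<and> x$(6*k) = 0}"
  have k': "2*k \<in> {1, 2, 4}" "4*k \<in> {1, 2, 4}" using k by (auto simp: numerals_mod_7 numerals_mod_7_product)
  have sz: "p = 0 \<and> q = 0" if "short_root j p q \<in> L" "j = 2*k \<or> j = 4*k" for j p q
    using short_inI[OF k'(1)] short_inI[OF k'(2)] that no by blast
  have lz: "p = 0 \<and> q = 0" if "long_root j p q \<in> L" "j = 2*k \<or> j = 4*k" for j p q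
    using long_inI[OF k'(1)] long_inI[OF k'(2)] that no by blast
  have "A *v w \<in> W" if A: "A \<in> L" and w: "w \<in> W" for A w
  proof -
    note rc = root_components[OF A]
    have zero: "short_root j 0 0 = 0" "long_root j 0 0 = 0" for j by (simp_all add: short_root_def long_root_def)
    have "A *v w = (torus (A$1$3) (A$2$6)
    + (short_root 1 (A$0$1) (A$0$3) + short_root 2 (A$0$2) (A$0$6) + short_root 4 (A$0$4) (A$0$5)
     + long_root 1 ((A$2$4 - A$5$6)/2) ((A$2$5 + A$4$6)/2) + long_root 2 ((A$4$1 - A$3$5)/2) ((A$4$3 + A$1$5)/2)
     + long_root 4 ((A$1$2 - A$6$3)/2) ((A$1$6 + A$2$3)/2))) *v w"
      using g2_decomposition[of A] A L by auto
    also have "\<dots> \<in> W"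
      using k sz[OF rc(1)] sz[OF rc(2)] sz[OF rc(3)] lz[OF rc(4)] lz[OF rc(5)] lz[OF rc(6)] w
      by (auto simp: W_def matrix_vector_mult_add_rdistrib root_vector zero numerals_mod_7 numerals_mod_7_product)
    finally show ?thesis .
  qed
  moreover have "subspace W" by (auto simp: W_def subspace_def)
  moreover have "axis 0 1 \<in> W" using k by (auto simp: W_def axis_def numerals_mod_7 numerals_mod_7_product)
  then have "W \<noteq> {0}" by (metis axis_eq_0_iff singletonD zero_neq_one)
  moreover have "axis (2*k) 1 \<notin> W" by (auto simp: W_def axis_def)
  then have "W \<noteq> UNIV" by auto
  ultimately show ?thesis unfolding acts_reducibly_def by blast
qed

text \<open>Without a short plane, axis \<open>0\<close> is annihilated. With the short plane
  \<open>k\<close>, any plane of another index already generates \<open>g2\<close>.\<close>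

theorem irreducible_imp_full:
  assumes irr: "\<not> acts_reducibly L"
  shows "L = g2"
proof -
  have "\<exists>k\<in>{1, 2, 4}. short_in k"
  proof (rule ccontr)
    assume "\<not> (\<exists>k\<in>{1, 2, 4}. short_in k)"
    then have no: "p = 0 \<and> q = 0" if "short_root k p q \<in> L" "k \<in> {1, 2, 4}" for k p q using that short_inI by blast
    have "A *v axis 0 1 = 0" if A: "A \<in> L" for A
    proof -
      have 0: "A$0$1 = 0 \<and> A$0$3 = 0" "A$0$2 = 0 \<and> A$0$6 = 0" "A$0$4 = 0 \<and> A$0$5 = 0"
        by (rule no[OF root_components(1)[OF A]] no[OF root_components(2)[OF A]] no[OF root_components(3)[OF A]], simp)+
      have sk: "A $ i $ 0 = - A $ 0 $ i" for i using skew_entry[OF g2_skew] A L(2) by blast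
      have "A $ 0 $ 0 = 0" using sk[of 0] by linarith
      then have "\<forall>i. A $ i $ 0 = 0"
        unfolding forall_7 using 0 by (simp add: sk[of 1] sk[of 2] sk[of 3] sk[of 4] sk[of 5] sk[of 6])
      then show ?thesis by (simp add: vec_eq_iff matrix_vector_mult_basis column_def)
    qed
    then show False using annihilated_vector_reducible[of "axis 0 1" L] irr by (metis axis_eq_0_iff zero_neq_one)
  qed
  then obtain k where k: "k \<in> {1, 2, 4}" "short_in k" by blast
  have k': "4*k \<in> {1, 2, 4}" "2*(4*k) = k" using k by (auto simp: numerals_mod_7 numerals_mod_7_product)
  show ?thesis
  proof (rule ccontr)
    assume ne: "L \<noteq> g2"
    have "\<not> short_in (2*k)" using two_short_imp_full[OF k] ne by blast
    moreover have "\<not> short_in (4*k)"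
    proof
      assume "short_in (4*k)"
      then have "L = g2" by (rule two_short_imp_full[OF k'(1)]) (simp only: k'(2) k(2))
      then show False using ne by blast
    qed
    moreover have "\<not> long_in (2*k)" "\<not> long_in (4*k)" using short_long_imp_full[OF k] ne by blast+
    ultimately show False using invariant_if_one_short[OF k(1)] irr by blast
  qed
qed

end

section \<open>Irreducible subalgebras\<close>

lemma common_eigenvector:
  fixes f h :: "'a::euclidean_space \<Rightarrow> 'a"
  assumes lin: "linear f" "linear h" and W: "subspace W" "W \<noteq> {0}"
    and inv: "\<And>x. x \<in> W \<Longrightarrow> f x \<in> W" "\<And>x. x \<in> W \<Longrightarrow> h x \<in> W"
    and sym: "\<And>x y. f x \<bullet> y = x \<bullet> f y" "\<And>x y. h x \<bullet> y = x \<bullet> h y" and comm: "\<And>x. f (h x) = h (f x)"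
  obtains v l m where "v \<in> W" "norm v = 1" "f v = l *\<^sub>R v" "h v = m *\<^sub>R v"
proof -
  obtain v0 l where v0: "v0 \<in> W" "norm v0 = 1" "f v0 = l *\<^sub>R v0"
    by (rule top_eigenvector[OF lin(1) W inv(1) sym(1)])
  define W' where "W' = {x \<in> W. f x = l *\<^sub>R x}"
  have sub: "subspace W'"
  proof (rule subspaceI)
    show "0 \<in> W'" using subspace_0[OF W(1)] linear_0[OF lin(1)] by (simp add: W'_def)
    show "x + y \<in> W'" if "x \<in> W'" "y \<in> W'" for x y
      using that subspace_add[OF W(1)] linear_add[OF lin(1)] by (simp add: W'_def scaleR_add_right)
    show "c *\<^sub>R x \<in> W'" if "x \<in> W'" for c x
      using that subspace_scale[OF W(1)] linear_scale[OF lin(1)] by (simp add: W'_def mult.commute)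
  qed
  have "v0 \<in> W'" "v0 \<noteq> 0" using v0 by (simp_all add: W'_def) (metis norm_zero zero_neq_one)
  then have ne: "W' \<noteq> {0}" by blast
  have inv': "h x \<in> W'" if "x \<in> W'" for x
    using that inv(2) linear_scale[OF lin(2), of l x] comm[of x] by (simp add: W'_def)
  obtain v m where "v \<in> W'" "norm v = 1" "h v = m *\<^sub>R v"
    by (rule top_eigenvector[OF lin(2) sub ne inv' sym(2)])
  then show ?thesis using that[of v l m] by (simp add: W'_def)
qed

lemma orthogonal_vector_exists:
  fixes B :: "'a::euclidean_space set"
  assumes "finite B" "card B < DIM('a)"
  obtains x where "x \<noteq> 0" "\<And>b. b \<in> B \<Longrightarrow> b \<bullet> x = 0"
proof -
  have "dim (span B) \<le> card B" using assms(1) by (intro dim_le_card) auto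
  then have "dim (span B) \<noteq> dim (span (UNIV :: 'a set))" using assms(2) by simp
  then have "span B \<noteq> span UNIV" by metis
  then have "span B \<subset> span UNIV" by auto
  then obtain x where x: "x \<noteq> 0" "\<And>y. y \<in> span B \<Longrightarrow> orthogonal x y"
    using orthogonal_to_subspace_exists_gen[of B UNIV] by metis
  have "b \<bullet> x = 0" if "b \<in> B" for b
    using x(2)[OF span_base[OF that]] by (simp add: orthogonal_def inner_commute[of b x])
  then show ?thesis using x(1) by (rule that[rotated])
qed

text \<open>Columns 0, 3 and 6 suffice: skewness turns them into rows, and the seven linear
  relations of \<open>g2\<close> determine the remaining entries.\<close>

lemma torusI:
  assumes X: "X \<in> g2" and col: "X *v axis 0 1 = 0" "X *v axis 3 1 = l *\<^sub>R axis 1 1" "X *v axis 6 1 = m *\<^sub>R axis 2 1"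
  shows "X = torus l m"
proof -
  have entry: "(X *v axis i 1) $ j = X $ j $ i" for i j by (simp add: matrix_vector_mult_basis column_def)
  have sk: "X $ i $ j = - X $ j $ i" for i j using skew_entry[OF g2_skew[OF X]] .
  have c0: "X $ j $ 0 = 0" and c3: "X $ j $ 3 = (if j = 1 then l else 0)" and c6: "X $ j $ 6 = (if j = 2 then m else 0)" for j
    using entry[of 0 j] entry[of 3 j] entry[of 6 j] col by (auto simp: axis_def)
  have r0: "X $ 0 $ j = 0" and r3: "X $ 3 $ j = (if j = 1 then - l else 0)" for j
    using sk[of 0 j] sk[of 3 j] c0[of j] c3[of j] by auto
  note rel = g2_relations[OF X]
  have z: "X$1$4 = 0" "X$1$5 = 0" "X$1$2 = 0" "X$2$4 = 0" "X$2$5 = 0"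
    using rel c6[of 5] c6[of 4] c0 r0 r3[of 5] r3[of 4] r3[of 6] by simp_all
  show ?thesis
    by (rule skew_eqI_7[OF g2_skew[OF X] root_skew(1)])
      (simp_all add: torus_def rot_entry z r0 r3 c3 c6 rel)
qed

text \<open>With \<open>e\<close> a common kernel vector, \<open>J = e \<times> _\<close> is a complex structure on the complement of \<open>e\<close> commuting with \<open>X\<close> and
  \<open>Y\<close>, so \<open>X J\<close> and \<open>Y J\<close> are commuting symmetric maps, and real common eigenvectors span common complex
  eigenlines.\<close>

theorem commuting_pair_diagonal:
  assumes X: "X \<in> g2" and Y: "Y \<in> g2" and comm: "lie_bracket X Y = 0"
  obtains g a b a' b' where "orthogonal_matrix g" "preserves_cross g"
    "conj_orth (transpose g) X = torus a b" "conj_orth (transpose g) Y = torus a' b'"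
proof -
  obtain e0 where e0: "e0 \<noteq> 0" "X *v e0 = 0" "Y *v e0 = 0"
    using odd_skew_commuting_common_kernel[OF _ g2_skew[OF X] g2_skew[OF Y] comm] by auto
  define e where "e = (1 / norm e0) *\<^sub>R e0"
  have "norm e = 1" using e0 by (simp add: e_def)
  then have "e \<bullet> e = 1" by (simp add: norm_eq_1)
  moreover have "X *v e = 0" "Y *v e = 0" using e0 by (simp_all add: e_def matrix_vector_mult_scaleR)
  ultimately have e: "e \<bullet> e = 1" "X *v e = 0" "Y *v e = 0" .
  define S where "S A x = A *v cross7 e x" for A :: "real^7^7" and x
  have lin: "linear (S A)" for A
    by (auto intro!: linearI simp: S_def cross7_linear matrix_vector_right_distrib matrix_vector_mult_scaleR)
  have d: "A *v cross7 e x = cross7 e (A *v x)" if "A \<in> g2" "A *v e = 0" for A x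
    using that by (simp add: g2_iff derives_cross_def)
  have skc: "cross7 e x \<bullet> y = - (x \<bullet> cross7 e y)" for x y
    using cross7_triple[of x e y] cross7_skew[of x e] by simp
  have sym: "S A x \<bullet> y = x \<bullet> S A y" if "A \<in> g2" "A *v e = 0" for A x y
    using skew_inner[OF g2_skew[OF that(1)], of "cross7 e x" y] d[OF that, of y] skc[of x "A *v y"] by (simp add: S_def)
  have Scomm: "S X (S Y x) = S Y (S X x)" for x
    using lie_bracket_vector[of X Y "cross7 e (cross7 e x)"] comm d[OF X e(2)] d[OF Y e(3)] by (simp add: S_def)
  have Se: "e \<bullet> S A x = 0" if "A \<in> g2" "A *v e = 0" for A x
    using sym[OF that, of e x] by (simp add: S_def)
  define W1 where "W1 = {x. e \<bullet> x = 0}"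
  have W1: "subspace W1" by (auto simp: W1_def subspace_def inner_add_right)
  obtain x1 where x1: "x1 \<noteq> 0" "\<And>b. b \<in> {e} \<Longrightarrow> b \<bullet> x1 = 0" by (rule orthogonal_vector_exists[of "{e}"]) auto
  then have "x1 \<in> W1" by (simp add: W1_def)
  then have W1ne: "W1 \<noteq> {0}" using x1(1) by blast
  have SW1: "S A x \<in> W1" if "A \<in> g2" "A *v e = 0" for A x using Se[OF that] by (simp add: W1_def)
  obtain u l l' where u: "u \<in> W1" "norm u = 1" "S X u = l *\<^sub>R u" "S Y u = l' *\<^sub>R u"
    by (rule common_eigenvector[OF lin lin W1 W1ne SW1[OF X e(2)] SW1[OF Y e(3)] sym[OF X e(2)] sym[OF Y e(3)] Scomm])
  define W2 where "W2 = {x. e \<bullet> x = 0 \<and> u \<bullet> x = 0 \<and> cross7 e u \<bullet> x = 0}"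
  have W2: "subspace W2" by (auto simp: W2_def subspace_def inner_add_right)
  have "card {e, u, cross7 e u} < DIM(real^7)" by (simp add: card_insert_if)
  then obtain x2 where x2: "x2 \<noteq> 0" "\<And>b. b \<in> {e, u, cross7 e u} \<Longrightarrow> b \<bullet> x2 = 0"
    using orthogonal_vector_exists[of "{e, u, cross7 e u}"] by blast
  then have "x2 \<in> W2" by (simp add: W2_def)
  then have W2ne: "W2 \<noteq> {0}" using x2(1) by blast
  \<comment> \<open>\<open>S A\<close> commutes with multiplication by \<open>e\<close>, so
    \<open>cross7 e u\<close> is an eigenvector along with \<open>u\<close>, and the complement of
    \<open>e\<close>, \<open>u\<close>, \<open>cross7 e u\<close> is stable.\<close>
  have SW2: "S A x \<in> W2" if A: "A \<in> g2" "A *v e = 0" and eig: "S A u = k *\<^sub>R u" and x: "x \<in> W2" for A x k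
  proof -
    have eu: "e \<bullet> u = 0" using u by (simp add: W1_def)
    have "S A (cross7 e u) = k *\<^sub>R cross7 e u"
      using d[OF A, of "cross7 e u"] eig by (simp add: S_def)
    then have "cross7 e u \<bullet> S A x = 0" "u \<bullet> S A x = 0"
      using sym[OF A, of "cross7 e u" x] sym[OF A, of u x] eig x by (simp_all add: W2_def)
    then show ?thesis using Se[OF A] by (simp add: W2_def)
  qed
  obtain w m m' where w: "w \<in> W2" "norm w = 1" "S X w = m *\<^sub>R w" "S Y w = m' *\<^sub>R w"
    by (rule common_eigenvector[OF lin lin W2 W2ne SW2[OF X e(2) u(3)] SW2[OF Y e(3) u(4)] sym[OF X e(2)] sym[OF Y e(3)] Scomm])
  have "u \<bullet> u = 1" "w \<bullet> w = 1" "e \<bullet> u = 0" "e \<bullet> w = 0" "u \<bullet> w = 0" "cross7 e u \<bullet> w = 0"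
    using u(1,2) w(1,2) by (simp_all add: W1_def W2_def norm_eq_1)
  then obtain g where g: "orthogonal_matrix g" "preserves_cross g" "g *v axis 0 1 = e" "g *v axis 1 1 = u" "g *v axis 2 1 = w"
    "g *v axis 3 1 = cross7 e u" "g *v axis 6 1 = cross7 e w"
    using octonion_frame[OF e(1)] by blast
  note gt = preserves_cross_transpose[OF g(1,2)]
  have tor: "conj_orth (transpose g) A = torus k k'" if A: "A \<in> g2" "A *v e = 0" and eig: "S A u = k *\<^sub>R u" "S A w = k' *\<^sub>R w" for A k k'
  proof (rule torusI)
    show "conj_orth (transpose g) A \<in> g2" unfolding conj_orth_def by (rule orthogonal_conj_g2[OF gt A(1)])
    have v: "conj_orth (transpose g) A *v x = transpose g *v (A *v (g *v x))" for x
      by (simp add: conj_orth_def flip: matrix_vector_mul_assoc)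
    show "conj_orth (transpose g) A *v axis 0 1 = 0" by (simp add: v g A)
    have "A *v (g *v axis 3 1) = k *\<^sub>R (g *v axis 1 1)" "A *v (g *v axis 6 1) = k' *\<^sub>R (g *v axis 2 1)"
      using eig by (simp_all add: g S_def)
    then show "conj_orth (transpose g) A *v axis 3 1 = k *\<^sub>R axis 1 1" "conj_orth (transpose g) A *v axis 6 1 = k' *\<^sub>R axis 2 1"
      by (simp_all add: v matrix_vector_mult_scaleR og_cancel[OF g(1)])
  qed
  show ?thesis using that[OF g(1,2) tor[OF X e(2) u(3) w(3)] tor[OF Y e(3) u(4) w(4)]] .
qed

theorem rank_two_irreducible_imp_full:
  assumes L: "lie_subalgebra L" "L \<subseteq> g2" and irr: "\<not> acts_reducibly L"
    and XY: "X \<in> L" "Y \<in> L" "lie_bracket X Y = 0" "X \<noteq> 0" "Y \<notin> span {X}"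
  shows "L = g2"
proof -
  obtain g a b a' b' where g: "orthogonal_matrix g" "preserves_cross g" and
    X: "conj_orth (transpose g) X = torus a b" and Y: "conj_orth (transpose g) Y = torus a' b'"
    by (rule commuting_pair_diagonal[OF subsetD[OF L(2) XY(1)] subsetD[OF L(2) XY(2)] XY(3)])
  note gt = preserves_cross_transpose[OF g]
  define c where "c = conj_orth (transpose g)"
  have inv: "conj_orth g (c A) = A" "c (conj_orth g A) = A" for A
    by (simp_all add: c_def conj_orth_inverse[OF g(1)])
  have lin: "linear (conj_orth g)" by (rule linear_conj_orth[OF g(1)])
  have XY': "X = conj_orth g (torus a b)" "Y = conj_orth g (torus a' b')" using inv(1)[of X] inv(1)[of Y] X Y by (simp_all add: c_def)
  have tl: "torus (s * p) (s * q) = s *\<^sub>R torus p q" for s p q using torus_linear[of s p 0 0 q 0] by simp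
  \<comment> \<open>A vanishing determinant would make \<open>Y\<close> a multiple of
    \<open>X\<close>.\<close>
  have D: "a * b' - a' * b \<noteq> 0"
  proof
    assume D: "a * b' - a' * b = 0"
    have "\<exists>s. Y = s *\<^sub>R X"
    proof (cases "a = 0")
      case False
      then have "b' = a' / a * b" using D by (simp add: field_simps)
      then have "torus a' b' = (a' / a) *\<^sub>R torus a b" using False tl[of "a'/a" a b] by simp
      then show ?thesis using XY' linear_scale[OF lin] by metis
    next
      case True
      then have "b \<noteq> 0" using XY(4) XY' linear_0[OF lin] tl[of 0 0 0] by auto
      then have "torus a' b' = (b' / b) *\<^sub>R torus a b" using D True tl[of "b'/b" a b] by (simp add: field_simps)
      then show ?thesis using XY' linear_scale[OF lin] by metis
    qed
    then show False using XY(5) by (auto simp: span_singleton)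
  qed
  have cg2: "c A \<in> g2" if "A \<in> g2" for A unfolding c_def conj_orth_def by (rule orthogonal_conj_g2[OF gt that])
  interpret torus_subalgebra "c ` L"
  proof
    show sub: "lie_subalgebra (c ` L)" unfolding c_def by (rule lie_subalgebra_conj_orth[OF gt(1) L(1)])
    show "c ` L \<subseteq> g2" using cg2 L(2) by blast
    show "torus p q \<in> c ` L" for p q
    proof -
      \<comment> \<open>Cramer's rule for \<open>torus p q\<close> in terms of
        \<open>torus a b\<close> and \<open>torus a' b'\<close>.\<close>
      define s where "s = (p * b' - q * a') / (a * b' - a' * b)"
      define t where "t = (q * a - p * b) / (a * b' - a' * b)"
      have "(p * b' - q * a') * a + (q * a - p * b) * a' = p * (a * b' - a' * b)"
        "(p * b' - q * a') * b + (q * a - p * b) * b' = q * (a * b' - a' * b)" by (simp_all add: algebra_simps)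
      then have "s * a + t * a' = p" "s * b + t * b' = q"
        using D by (simp_all add: s_def t_def flip: add_divide_distrib)
      then have "torus p q = s *\<^sub>R torus a b + t *\<^sub>R torus a' b'" using torus_linear[of s a t a' b b'] by simp
      then have "torus p q = s *\<^sub>R c X + t *\<^sub>R c Y" using X Y by (simp add: c_def)
      then show ?thesis using lie_subalgebraD[OF sub] XY(1,2) by simp
    qed
  qed
  have "\<not> acts_reducibly (c ` L)"
  proof
    assume "acts_reducibly (c ` L)"
    then have "acts_reducibly (conj_orth g ` c ` L)" by (rule acts_reducibly_conj_orth[OF g(1)])
    moreover have "conj_orth g ` c ` L = L" by (simp add: image_image inv)
    ultimately show False using irr by simp
  qed
  then have full: "c ` L = g2" by (rule irreducible_imp_full)
  have "A \<in> L" if A: "A \<in> g2" for A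
  proof -
    have "c A \<in> c ` L" unfolding full by (rule cg2[OF A])
    then obtain B where B: "c A = c B" "B \<in> L" by (rule imageE)
    have "A = B" using arg_cong[OF B(1), of "conj_orth g"] unfolding inv(1) .
    then show ?thesis using B(2) by simp
  qed
  then have "g2 \<subseteq> L" by (rule subsetI)
  then show ?thesis using assms(2) by (rule equalityI[rotated])
qed

text \<open>Any unit vector is axis \<open>0\<close> of an octonion frame, and the short root planes
  of that frame move axis \<open>0\<close> to the other six. So a nonzero invariant subspace
  contains a whole frame.\<close>

theorem g2_irreducible: "\<not> acts_reducibly g2"
proof
  assume "acts_reducibly g2"
  then obtain W where W: "subspace W" "W \<noteq> {0}" "W \<noteq> UNIV" and inv: "\<And>A w. A \<in> g2 \<Longrightarrow> w \<in> W \<Longrightarrow> A *v w \<in> W"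
    by (auto simp: acts_reducibly_def)
  obtain e0 where e0: "e0 \<in> W" "e0 \<noteq> 0" using W subspace_0 by blast
  define e where "e = (1 / norm e0) *\<^sub>R e0"
  have e: "e \<in> W" "e \<bullet> e = 1" using e0 W(1) by (simp_all add: e_def subspace_scale dot_square_norm power2_eq_square)
  obtain u0 where u0': "u0 \<noteq> 0" "\<And>b. b \<in> {e} \<Longrightarrow> b \<bullet> u0 = 0" by (rule orthogonal_vector_exists[of "{e}"]) auto
  then have u0: "u0 \<noteq> 0" "e \<bullet> u0 = 0" by simp_all
  define u where "u = (1 / norm u0) *\<^sub>R u0"
  have u: "u \<bullet> u = 1" "e \<bullet> u = 0" using u0 by (simp_all add: u_def dot_square_norm power2_eq_square)
  have "card {e, u, cross7 e u} < DIM(real^7)" by (simp add: card_insert_if)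
  then obtain w0 where w0': "w0 \<noteq> 0" "\<And>b. b \<in> {e, u, cross7 e u} \<Longrightarrow> b \<bullet> w0 = 0"
    using orthogonal_vector_exists[of "{e, u, cross7 e u}"] by blast
  then have w0: "w0 \<noteq> 0" "e \<bullet> w0 = 0" "u \<bullet> w0 = 0" "cross7 e u \<bullet> w0 = 0" by simp_all
  define w where "w = (1 / norm w0) *\<^sub>R w0"
  have w: "w \<bullet> w = 1" "e \<bullet> w = 0" "u \<bullet> w = 0" "cross7 e u \<bullet> w = 0"
    using w0 by (simp_all add: w_def dot_square_norm power2_eq_square)
  obtain g where g: "orthogonal_matrix g" "preserves_cross g" "g *v axis 0 1 = e"
    using octonion_frame[OF e(2) u(1) w(1) u(2) w(2-4)] by metis
  have A: "g *v (A *v axis 0 1) \<in> W" if "A \<in> g2" for A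
  proof -
    have "conj_orth g A \<in> g2" unfolding conj_orth_def by (rule orthogonal_conj_g2[OF g(1,2) that])
    then show ?thesis using inv e(1) conj_orth_vector[OF g(1), of A "axis 0 1"] by (metis g(3))
  qed
  have "\<forall>i. g *v axis i 1 \<in> W"
  proof -
    have S: "short_root k p q *v axis 0 1 = - (p *\<^sub>R axis k 1 + q *\<^sub>R axis (3*k) 1)" if "k \<in> {1, 2, 4}" for k p q
      using that unfolding vec_eq_iff forall_7 by (auto simp: root_vector axis_def numerals_mod_7 numerals_mod_7_product)
    have "g *v (p *\<^sub>R axis k 1 + q *\<^sub>R axis (3*k) 1) \<in> W" if k: "k \<in> {1, 2, 4}" for k p q
    proof -
      have "g *v (- (p *\<^sub>R axis k 1 + q *\<^sub>R axis (3*k) 1)) \<in> W" using A[OF short_root_g2[OF k, of p q]] unfolding S[OF k] .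
      then have "- (g *v (p *\<^sub>R axis k 1 + q *\<^sub>R axis (3*k) 1)) \<in> W" unfolding matrix_vector_simps(3) .
      then show ?thesis using subspace_neg[OF W(1), of "- (g *v (p *\<^sub>R axis k 1 + q *\<^sub>R axis (3*k) 1))"] unfolding minus_minus by blast
    qed
    from this[of 1 1 0] this[of 1 0 1] this[of 2 1 0] this[of 2 0 1] this[of 4 1 0] this[of 4 0 1]
    show ?thesis unfolding forall_7 using e(1) g(3) by (simp add: numerals_mod_7)
  qed
  moreover have "subspace {x. g *v x \<in> W}"
    using W(1) by (auto simp: subspace_def matrix_vector_right_distrib matrix_vector_mult_scaleR)
  ultimately have "{x. g *v x \<in> W} = UNIV" by (intro axis_basis_7) auto
  then have "g *v (transpose g *v x) \<in> W" for x by blast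
  then show False using W(3) og_cancel(2)[OF g(1)] by (metis UNIV_eq_I)
qed

text \<open>Evaluation at axis \<open>0\<close> takes four independent values on short root planes.
  The bound 3 is what separates \<open>g2\<close> from the span of \<open>Ap\<close>,
  \<open>Am\<close>, \<open>C\<close>.\<close>

lemma dim_g2_greater_3: "dim g2 > 3"
proof -
  define f :: "real^7^7 \<Rightarrow> real^7" where "f A = A *v axis 0 1" for A
  have "linear f" by (auto intro!: linearI simp: f_def matrix_vector_mult_add_rdistrib)
  have S: "f (short_root k p q) = - (p *\<^sub>R axis k 1 + q *\<^sub>R axis (3*k) 1)" if "k \<in> {1, 2, 4}" for k p q
    using that unfolding vec_eq_iff forall_7 by (auto simp: f_def root_vector axis_def numerals_mod_7 numerals_mod_7_product)
  have "f (short_root 1 (- 1) 0) = axis 1 1" "f (short_root 2 (- 1) 0) = axis 2 1" "f (short_root 4 (- 1) 0) = axis 4 1"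
    "f (short_root 1 0 (- 1)) = axis 3 1" by (simp_all add: S)
  then have "{axis 1 1, axis 2 1, axis 4 1, axis 3 1} \<subseteq> f ` g2"
    using short_root_g2 by (metis empty_subsetI imageI insert_iff insert_subset)
  moreover have "independent {axis 1 1, axis 2 1, axis 4 1, axis (3::7) (1::real)}"
    by (rule independent_mono[OF independent_Basis]) (auto simp: Basis_vec_def)
  ultimately have "card {axis 1 1, axis 2 1, axis 4 1, axis (3::7) (1::real)} \<le> dim (f ` g2)"
    by (rule independent_card_le_dim)
  moreover have "card {axis 1 1, axis 2 1, axis 4 1, axis (3::7) (1::real)} = 4" by (simp add: axis_eq_axis)
  moreover have "dim (f ` g2) \<le> dim g2" using \<open>linear f\<close> by (rule dim_image_le)
  ultimately show ?thesis by simp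
qed

theorem irreducible_subalgebra_cases:
  assumes L: "lie_subalgebra L" "L \<subseteq> g2" and irr: "\<not> acts_reducibly L"
  shows "dim L \<le> 3 \<or> L = g2"
proof (cases "\<exists>X\<in>L. \<exists>Y\<in>L. lie_bracket X Y = 0 \<and> X \<noteq> 0 \<and> Y \<notin> span {X}")
  case True
  then show ?thesis using rank_two_irreducible_imp_full[OF L irr] by blast
next
  case False
  have "dim L \<le> 3"
  proof (rule rank_one_dim_le_3)
    show "subspace L" using L(1) by (rule lie_subalgebraD)
    show "lie_bracket A B \<in> L" if "A \<in> L" "B \<in> L" for A B using lie_subalgebraD(2)[OF L(1) that] .
    show "transpose A = - A" if "A \<in> L" for A using g2_skew L(2) that by blast
    show "B \<in> span {A}" if "A \<in> L" "B \<in> L" "lie_bracket A B = 0" "A \<noteq> 0" for A B using False that by blast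
  qed
  then show ?thesis ..
qed

section \<open>Invariance, polynomiality and the criterion\<close>

lemma matrix_inv_orthogonal:
  assumes "orthogonal_matrix (g :: real^'n^'n)"
  shows "matrix_inv g = transpose g"
proof -
  have g: "g ** transpose g = mat 1" "transpose g ** g = mat 1" using assms by (auto simp: orthogonal_matrix_def)
  have "g ** matrix_inv g = mat 1 \<and> matrix_inv g ** g = mat 1"
    unfolding matrix_inv_def by (rule someI[of _ "transpose g"]) (simp add: g)
  then have "transpose g ** (g ** matrix_inv g) = transpose g" by simp
  then show ?thesis unfolding matrix_mul_assoc g by simp
qed

lemma conj_by_eq: "orthogonal_matrix g \<Longrightarrow> conj_by g A = conj_orth g A"
  by (simp add: conj_by_def conj_orth_def matrix_inv_orthogonal)

lemma conj_orth_reflections: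
  assumes g: "orthogonal_matrix g" "preserves_cross g" and T: "T \<in> reflections"
  shows "conj_orth g T \<in> reflections"
proof -
  obtain H where H: "quaternionic_context H" "acts_on_Im (quat_reflection H) T"
    using T by (auto simp: reflections_def)
  then obtain \<phi> :: "quat \<Rightarrow> octo" where sub: "subspace H" and one: "oone \<in> H"
    and mult: "\<And>x y. x \<in> H \<Longrightarrow> y \<in> H \<Longrightarrow> omult x y \<in> H"
    and \<phi>: "linear \<phi>" "bij_betw \<phi> UNIV H" "\<And>p q. \<phi> (qmult p q) = omult (\<phi> p) (\<phi> q)"
    by (auto simp: quaternionic_context_def)
  define f :: "octo \<Rightarrow> octo" where "f x = (fst x, g *v snd x)" for x
  have lin: "linear f" by (auto intro!: linearI simp: f_def matrix_vector_right_distrib matrix_vector_mult_scaleR)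
  have fm: "f (omult x y) = omult (f x) (f y)" for x y using g
    by (simp add: f_def omult_def preserves_cross_def inner_orthogonal_matrix matrix_vector_right_distrib matrix_vector_mult_scaleR)
  have fi: "f x \<bullet> f y = x \<bullet> y" for x y using g by (simp add: f_def inner_prod_def inner_orthogonal_matrix)
  have "(fst x, transpose g *v snd (f x)) = x" for x by (simp add: f_def og_cancel[OF g(1)])
  then have inj: "inj f" by (metis (mono_tags, lifting) f_def fst_conv injI)
  have f1: "f oone = oone" by (simp add: f_def oone_def)
  have sub': "subspace (f ` H)" by (rule linear_subspace_image[OF lin sub])
  have ctx: "quaternionic_context (f ` H)"
    unfolding quaternionic_context_def
  proof (intro conjI exI[of _ "f \<circ> \<phi>"] ballI allI)
    show "oone \<in> f ` H" using one f1 by (metis imageI)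
    show "omult x y \<in> f ` H" if im: "x \<in> f ` H" "y \<in> f ` H" for x y
    proof -
      obtain x' y' where xy: "x' \<in> H" "x = f x'" "y' \<in> H" "y = f y'" using im by blast
      then have "omult x y = f (omult x' y')" by (simp add: fm)
      then show ?thesis using mult[OF xy(1,3)] by blast
    qed
    show "linear (f \<circ> \<phi>)" by (rule linear_compose[OF \<phi>(1) lin])
    show "bij_betw (f \<circ> \<phi>) UNIV (f ` H)"
      using bij_betw_trans[OF \<phi>(2) inj_on_imp_bij_betw[OF inj_on_subset[OF inj]]] by simp
    show "(f \<circ> \<phi>) (qmult p q) = omult ((f \<circ> \<phi>) p) ((f \<circ> \<phi>) q)" for p q by (simp add: \<phi>(3) fm)
  qed (rule sub')
  have "quat_reflection (f ` H) (0, v) = (0, conj_orth g T *v v)" for v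
  proof -
    define w where "w = transpose g *v v"
    obtain h y where hy: "h \<in> H" "y \<in> orthogonal_comp H" "(0, w) = h + y"
      by (rule subspace_orthogonal_decomp[OF sub, of "(0, w)"])
    have "f y \<in> orthogonal_comp (f ` H)"
      using hy(2) fi unfolding orthogonal_comp_def orthogonal_def by auto
    then have "quat_reflection (f ` H) (f h + f y) = f h - f y"
      by (intro quat_reflection_eq[OF sub']) (use hy in auto)
    moreover have "f h + f y = (0, v)"
    proof -
      have "f h + f y = f (0, w)" unfolding hy(3) by (rule linear_add[OF lin, symmetric])
      also have "\<dots> = (0, v)" by (simp add: f_def w_def og_cancel[OF g(1)])
      finally show ?thesis .
    qed
    moreover have "f h - f y = (0, conj_orth g T *v v)"
    proof -
      have "(0, T *v w) = h - y"
        using H(2) quat_reflection_eq[OF sub hy(1,2)] unfolding hy(3)[symmetric] acts_on_Im_def by metis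
      then have "f (0, T *v w) = f h - f y" using linear_diff[OF lin] by metis
      then show ?thesis unfolding f_def w_def conj_orth_def by (simp add: matrix_vector_mul_assoc matrix_mul_assoc)
    qed
    ultimately show ?thesis by simp
  qed
  then show ?thesis using ctx by (auto simp: reflections_def acts_on_Im_def)
qed

text \<open>\<open>H8\<close> as a function of the even and odd parts, so that scaling and
  conjugation act directly on the two arguments.\<close>

definition H8_form :: "real^7^7 \<Rightarrow> real^7^7 \<Rightarrow> real" where
  "H8_form A B = (let C = lie_bracket A B; D = lie_bracket A C; E = lie_bracket B C
     in (B \<bullet> B) * (D \<bullet> D) + (A \<bullet> A) * (E \<bullet> E) - 2 * (C \<bullet> C)\<^sup>2)"

lemma H8_eq_form: "H8 T Z = H8_form ((1/2) *\<^sub>R (Z + T ** Z ** T)) ((1/2) *\<^sub>R (Z - T ** Z ** T))"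
  by (simp add: H8_def H8_form_def Let_def frob_eq_inner)

lemma H8_homogeneous: "H8 T (c *\<^sub>R Z) = c ^ 8 * H8 T Z"
proof -
  have eq: "(1/2) *\<^sub>R (c *\<^sub>R Z + T ** (c *\<^sub>R Z) ** T) = c *\<^sub>R ((1/2) *\<^sub>R (Z + T ** Z ** T))"
    "(1/2) *\<^sub>R (c *\<^sub>R Z - T ** (c *\<^sub>R Z) ** T) = c *\<^sub>R ((1/2) *\<^sub>R (Z - T ** Z ** T))"
    by (simp_all add: scaleR_add_right scaleR_diff_right mult.commute)
  have "H8_form (c *\<^sub>R A) (c *\<^sub>R B) = c ^ 8 * H8_form A B" for A B
    by (simp add: H8_form_def Let_def power2_eq_square eval_nat_numeral algebra_simps)
  then show ?thesis unfolding H8_eq_form eq .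
qed

context
  fixes g :: "real^7^7"
  assumes g: "orthogonal_matrix g"
begin

lemma inner_conj_orth: "conj_orth g A \<bullet> conj_orth g B = A \<bullet> B"
proof -
  have "trace (g ** (transpose A ** B ** transpose g)) = trace (transpose A ** B ** transpose g ** g)"
    by (rule trace_mul_sym)
  then show ?thesis
    by (simp add: inner_eq_trace conj_orth_def matrix_transpose_mul matrix_mul_assoc og_cancel[OF g])
qed

lemma H8_conj_orth: "H8 (conj_orth g T) (conj_orth g Z) = H8 T Z"
proof -
  have "H8_form (conj_orth g A) (conj_orth g B) = H8_form A B" for A B
    by (simp add: H8_form_def Let_def conj_orth_bracket[OF g] inner_conj_orth)
  moreover note lin = linear_conj_orth[OF g]
  ultimately show ?thesis
    unfolding H8_eq_form conj_orth_mult[OF g] by (simp flip: linear_add[OF lin] linear_diff[OF lin] linear_scale[OF lin])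
qed

lemma conj_orth_E_space:
  assumes "Q \<in> E_space T"
  shows "conj_orth g Q \<in> E_space (conj_orth g T)"
proof -
  have "transpose (conj_orth g Q) = conj_orth g (transpose Q)"
    by (simp add: conj_orth_def matrix_transpose_mul matrix_mul_assoc)
  moreover have "trace (conj_orth g Q) = trace Q"
    using trace_mul_sym[of "g ** Q" "transpose g"] by (simp add: conj_orth_def matrix_mul_assoc og_cancel[OF g])
  ultimately show ?thesis using assms by (simp add: E_space_def conj_orth_mult[OF g])
qed

end

lemma frob_onb_conj_orth:
  assumes g: "orthogonal_matrix g" and Q: "frob_onb Q (E_space T)"
  shows "frob_onb (\<lambda>i. conj_orth g (Q i)) (E_space (conj_orth g T))"
proof -
  have gt: "orthogonal_matrix (transpose g)" using g by (simp add: orthogonal_matrix_transpose)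
  have "span (range (\<lambda>i. conj_orth g (Q i))) = conj_orth g ` E_space T"
    using Q linear_span_image[OF linear_conj_orth[OF g], of "range Q"] by (simp add: frob_onb_def image_image)
  also have "\<dots> = E_space (conj_orth g T)"
  proof
    show "conj_orth g ` E_space T \<subseteq> E_space (conj_orth g T)" using conj_orth_E_space[OF g] by blast
    show "E_space (conj_orth g T) \<subseteq> conj_orth g ` E_space T"
    proof
      fix M assume "M \<in> E_space (conj_orth g T)"
      then have "conj_orth (transpose g) M \<in> E_space T"
        using conj_orth_E_space[OF gt] conj_orth_inverse(1)[OF g] by metis
      then show "M \<in> conj_orth g ` E_space T" using conj_orth_inverse(2)[OF g] by (metis imageI)
    qed
  qed
  finally show ?thesis using Q by (simp add: frob_onb_def frob_eq_inner inner_conj_orth[OF g])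
qed

lemma R30_conj_orth:
  assumes g: "orthogonal_matrix g" "preserves_cross g" and T: "T \<in> reflections"
  shows "R30 (conj_orth g T) (conj_orth g Z) = R30 T Z"
proof -
  obtain Q where Q: "frob_onb Q (E_space T)" using frob_onb_exists reflections_like[OF T] by blast
  have "gram (conj_orth g Z) (\<lambda>i. conj_orth g (Q i)) = gram Z Q"
    by (simp add: gram_def conj_orth_bracket[OF g(1)] inner_conj_orth[OF g(1)])
  then show ?thesis
    using R30_eq_gram[OF reflections_like[OF T] Q, of Z]
      R30_eq_gram[OF reflections_like[OF conj_orth_reflections[OF g T]] frob_onb_conj_orth[OF g(1) Q], of "conj_orth g Z"] by simp
qed

section \<open>Polynomial dependence on the matrix entries\<close>

definition matrix_polynomial :: "('a::real_normed_vector \<Rightarrow> real^'n^'m) \<Rightarrow> bool" where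
  "matrix_polynomial F \<longleftrightarrow> (\<forall>i j. real_polynomial_function (\<lambda>x. F x $ i $ j))"

lemma real_polynomial_function_det:
  "matrix_polynomial F \<Longrightarrow> real_polynomial_function (\<lambda>x. det (F x :: real^'n^'n))"
  unfolding det_def matrix_polynomial_def
  by (intro real_polynomial_function_sum real_polynomial_function.intros(4) real_polynomial_function.intros(2) real_polynomial_function_prod) auto

lemma matrix_polynomial_intros:
  fixes F G :: "'a::real_normed_vector \<Rightarrow> real^'n^'n"
  shows "matrix_polynomial (\<lambda>x. M :: real^'n^'n)"
    and "matrix_polynomial F \<Longrightarrow> matrix_polynomial G \<Longrightarrow> matrix_polynomial (\<lambda>x. F x + G x)"
    and "matrix_polynomial F \<Longrightarrow> matrix_polynomial G \<Longrightarrow> matrix_polynomial (\<lambda>x. F x - G x)"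
    and "matrix_polynomial F \<Longrightarrow> matrix_polynomial G \<Longrightarrow> matrix_polynomial (\<lambda>x. F x ** G x)"
    and "matrix_polynomial F \<Longrightarrow> matrix_polynomial (\<lambda>x. c *\<^sub>R F x)"
    and "matrix_polynomial F \<Longrightarrow> matrix_polynomial (\<lambda>x. transpose (F x))"
  unfolding matrix_polynomial_def
  by (auto simp: matrix_matrix_mult_def transpose_def intro!: real_polynomial_function.intros(2-4) real_polynomial_function_sum
      real_polynomial_function_diff)

lemma matrix_polynomial_bracket:
  fixes F G :: "'a::real_normed_vector \<Rightarrow> real^'n^'n"
  shows "matrix_polynomial F \<Longrightarrow> matrix_polynomial G \<Longrightarrow> matrix_polynomial (\<lambda>x. lie_bracket (F x) (G x))"
  unfolding lie_bracket_def by (intro matrix_polynomial_intros)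

lemma real_polynomial_function_inner:
  fixes F G :: "'a::real_normed_vector \<Rightarrow> real^'n^'m"
  shows "matrix_polynomial F \<Longrightarrow> matrix_polynomial G \<Longrightarrow> real_polynomial_function (\<lambda>x. F x \<bullet> G x)"
  unfolding matrix_polynomial_def inner_matrix
  by (intro real_polynomial_function_sum real_polynomial_function.intros(4)) auto

lemma matrix_polynomial_proj:
  "matrix_polynomial (\<lambda>x. fst x :: real^7^7)" "matrix_polynomial (\<lambda>x. snd x :: real^7^7)"
  unfolding matrix_polynomial_def
  by (auto intro!: real_polynomial_function.intros(1) bounded_linear_compose[OF bounded_linear_vec_nth]
      bounded_linear_fst bounded_linear_snd)

lemma polynomial_on_U38: "polynomial_on reflections g2 U38"
proof -
  \<comment> \<open>\<open>R30_poly\<close> replaces \<open>R30\<close>, with which it agrees on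
    \<open>reflections\<close>; \<open>H8\<close> is a polynomial expression as it stands.\<close>
  define p where "p x = R30_poly (fst x) (snd x) * H8 (fst x) (snd x)" for x
  note intros = matrix_polynomial_intros matrix_polynomial_bracket matrix_polynomial_proj
  have "matrix_polynomial (\<lambda>x. E_proj (fst x) M)" for M :: "real^7^7"
    unfolding E_proj_def by (intro intros)
  then have "real_polynomial_function (\<lambda>x. R30_poly (fst x) (snd x))"
    unfolding R30_poly_def divide_inverse
    by (intro real_polynomial_function.intros(4) real_polynomial_function.intros(2) real_polynomial_function_sum real_polynomial_function_det)
      (auto simp: matrix_polynomial_def[where 'n = 15] intro!: real_polynomial_function_inner intros)
  moreover have "real_polynomial_function (\<lambda>x. H8 (fst x) (snd x))"
    unfolding H8_eq_form H8_form_def Let_def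
    by (intro real_polynomial_function.intros(3) real_polynomial_function_diff real_polynomial_function.intros(4) real_polynomial_function.intros(2)
        real_polynomial_function_power real_polynomial_function_inner intros)
  ultimately have "real_polynomial_function p" unfolding p_def by (rule real_polynomial_function.intros(4))
  moreover have "U38 T Z = p (T, Z)" if "T \<in> reflections" for T Z
    using that by (simp add: U38_def p_def R30_eq_poly reflections_like)
  ultimately show ?thesis unfolding polynomial_on_def by blast
qed

section \<open>The criterion and the trichotomy\<close>

lemma U38_criterion:
  assumes T: "T \<in> reflections" and Z: "Z \<in> g2"
  shows "R30 T Z \<ge> 0" "H8 T Z \<ge> 0" "outcome_reducible T Z \<or> outcome_principal T Z \<or> outcome_full T Z"
    "Lie_gen Z (T ** Z ** T) = g2 \<longleftrightarrow> U38 T Z > 0"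
proof -
  interpret reflection_pair T Z by unfold_locales (fact T Z)+
  show R: "R30 T Z \<ge> 0" using R30_nonneg[OF T_props(3)] .
  show H: "H8 T Z \<ge> 0" by (rule H8_nonneg)
  \<comment> \<open>Irreducibility gives \<open>C \<noteq> 0\<close>, so dimension at most three
    would force \<open>H8 = 0\<close>; the remaining case is \<open>g2\<close>.\<close>
  have irr_full: "L = g2" if "\<not> acts_reducibly L" "H8 T Z > 0"
    using irreducible_subalgebra_cases[OF L_subalgebra L_g2 that(1)] dim_le_3_imp_H8_zero irreducible_imp_C_nonzero that by auto
  show "outcome_reducible T Z \<or> outcome_principal T Z \<or> outcome_full T Z"
  proof (cases "R30 T Z = 0")
    case True
    then have "acts_reducibly L" using reducible_iff by simp
    then have "L \<noteq> g2" using g2_irreducible by metis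
    then show ?thesis using True \<open>acts_reducibly L\<close> L_g2 by (auto simp: outcome_reducible_def L_def)
  next
    case False
    then have irr: "\<not> acts_reducibly L" using reducible_iff by simp
    show ?thesis
    proof (cases "H8 T Z = 0")
      case True
      then show ?thesis using H8_zero_imp_principal[OF True irr] False R by (simp add: outcome_principal_def L_def)
    next
      case F: False
      then show ?thesis using irr_full[OF irr] F H False R by (simp add: outcome_full_def L_def)
    qed
  qed
  show "Lie_gen Z (T ** Z ** T) = g2 \<longleftrightarrow> U38 T Z > 0"
  proof
    assume "Lie_gen Z (T ** Z ** T) = g2"
    then have full: "L = g2" by (simp add: L_def)
    then have irr: "\<not> acts_reducibly L" using g2_irreducible by simp
    then have "R30 T Z \<noteq> 0" using reducible_iff by simp
    \<comment> \<open>A zero would leave \<open>L\<close> with three spanning elements, fewer than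
      \<open>dim g2\<close>.\<close>
    moreover have "H8 T Z \<noteq> 0"
    proof
      assume "H8 T Z = 0"
      then have "L = span {Ap, Am, C}" using H8_zero_imp_span irreducible_imp_C_nonzero[OF irr] by simp
      then have "dim L \<le> card {Ap, Am, C}" by (intro dim_le_card) auto
      also have "\<dots> \<le> 3" by (simp add: card_insert_if)
      finally show False using dim_g2_greater_3 full by simp
    qed
    ultimately show "U38 T Z > 0" using R H by (simp add: U38_def)
  next
    assume "U38 T Z > 0"
    then have "R30 T Z \<noteq> 0" "H8 T Z > 0" using H by (auto simp: U38_def zero_less_mult_iff)
    then show "Lie_gen Z (T ** Z ** T) = g2" using irr_full reducible_iff by (simp add: L_def)
  qed
qed

theorem theorem6p4:
  shows "polynomial_on reflections g2 U38
    \<and> (\<forall>T\<in>reflections. \<forall>Z\<in>g2. U38 T Z \<ge> 0)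
    \<and> (\<forall>T\<in>reflections. \<forall>Z\<in>g2. \<forall>c::real. U38 T (c *\<^sub>R Z) = c ^ 38 * U38 T Z)
    \<and> (\<forall>T\<in>reflections. \<forall>Z\<in>g2. Lie_gen Z (T ** Z ** T) = g2 \<longleftrightarrow> U38 T Z > 0)
    \<and> (\<forall>H. quaternionic_context H \<longrightarrow> (\<forall>T\<in>reflections.
          {Z \<in> k_alg H. Lie_gen Z (T ** Z ** T) \<noteq> g2} = {Z \<in> k_alg H. U38 T Z = 0}))
    \<and> (\<forall>T\<in>reflections. \<forall>Z\<in>g2.
          (outcome_reducible T Z \<or> outcome_principal T Z \<or> outcome_full T Z)
          \<and> \<not> (outcome_reducible T Z \<and> outcome_principal T Z)
          \<and> \<not> (outcome_reducible T Z \<and> outcome_full T Z)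
          \<and> \<not> (outcome_principal T Z \<and> outcome_full T Z))
    \<and> (\<forall>g\<in>G2. \<forall>T\<in>reflections. \<forall>Z\<in>g2.
          conj_by g T \<in> reflections \<and> conj_by g Z \<in> g2
          \<and> R30 (conj_by g T) (conj_by g Z) = R30 T Z
          \<and> H8 (conj_by g T) (conj_by g Z) = H8 T Z
          \<and> U38 (conj_by g T) (conj_by g Z) = U38 T Z
          \<and> (Lie_gen (conj_by g Z) (conj_by g T ** conj_by g Z ** conj_by g T) = g2
               \<longleftrightarrow> Lie_gen Z (T ** Z ** T) = g2))"
proof (intro conjI ballI allI impI)
  show "polynomial_on reflections g2 U38" by (rule polynomial_on_U38)
next
  fix T Z assume TZ: "T \<in> reflections" "Z \<in> g2"
  note crit = U38_criterion[OF TZ]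
  show "U38 T Z \<ge> 0" using crit(1,2) by (simp add: U38_def)
  show "U38 T (c *\<^sub>R Z) = c ^ 38 * U38 T Z" for c :: real
    by (simp add: U38_def R30_homogeneous[OF reflections_like[OF TZ(1)]] H8_homogeneous mult.assoc mult.left_commute
        flip: power_add)
  show "Lie_gen Z (T ** Z ** T) = g2 \<longleftrightarrow> U38 T Z > 0" by (rule crit(4))
  show "outcome_reducible T Z \<or> outcome_principal T Z \<or> outcome_full T Z" by (rule crit(3))
  show "\<not> (outcome_reducible T Z \<and> outcome_principal T Z)" "\<not> (outcome_reducible T Z \<and> outcome_full T Z)"
    "\<not> (outcome_principal T Z \<and> outcome_full T Z)"
    by (auto simp: outcome_reducible_def outcome_principal_def outcome_full_def)
next
  fix H T assume "quaternionic_context H" and T: "T \<in> reflections"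
  have "Z \<in> g2" if "Z \<in> k_alg H" for Z using that by (auto simp: k_alg_def g2_def)
  then have "Lie_gen Z (T ** Z ** T) \<noteq> g2 \<longleftrightarrow> U38 T Z = 0" if "Z \<in> k_alg H" for Z
    using U38_criterion(1,2,4)[OF T] that unfolding U38_def
    by (metis less_le mult_nonneg_nonneg)
  then show "{Z \<in> k_alg H. Lie_gen Z (T ** Z ** T) \<noteq> g2} = {Z \<in> k_alg H. U38 T Z = 0}" by blast
next
  fix g T Z assume "g \<in> G2" and TZ: "T \<in> reflections" "Z \<in> g2"
  then have g: "orthogonal_matrix g" "preserves_cross g" by (simp_all add: G2_iff)
  have T': "conj_orth g T \<in> reflections" by (rule conj_orth_reflections[OF g TZ(1)])
  have Z': "conj_orth g Z \<in> g2" unfolding conj_orth_def by (rule orthogonal_conj_g2[OF g TZ(2)])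
  note R = R30_conj_orth[OF g TZ(1), of Z] and H = H8_conj_orth[OF g(1), of T Z]
  note [simp] = conj_by_eq[OF g(1)]
  show "conj_by g T \<in> reflections" "conj_by g Z \<in> g2" using T' Z' by simp_all
  show "R30 (conj_by g T) (conj_by g Z) = R30 T Z" "H8 (conj_by g T) (conj_by g Z) = H8 T Z" using R H by simp_all
  show U: "U38 (conj_by g T) (conj_by g Z) = U38 T Z" using R H by (simp add: U38_def)
  \<comment> \<open>No transport of generated algebras is involved: both sides are equivalent to
    positivity of the same value of \<open>U38\<close>.\<close>
  show "Lie_gen (conj_by g Z) (conj_by g T ** conj_by g Z ** conj_by g T) = g2 \<longleftrightarrow> Lie_gen Z (T ** Z ** T) = g2"
    using U38_criterion(4)[OF T' Z'] U38_criterion(4)[OF TZ] U by simp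
qed

end
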